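(* Let $\gamma>0$ and $0<a_0<a_1$. Consider the Riemann problem for $$(a\rho)_t+(a\rho u)_x=0,\qquad (a\rho(u+p))_t+(a\rho u(u+p))_x=\rho u p\,a_x,\qquad a_t=0,\qquad p=\rho^\gamma,$$ with initial data $(u,\rho,a)=U_-=(u_-,\rho_-,a_0)$ for $x<0$ and $(u,\rho,a)=U_+=(u_+,\rho_+,a_1)$ for $x>0$, where velocities and densities are nonnegative. With the elementary waves and notation of the context, the Riemann problem has a self-similar solution, constructed case by case as follows. **Case 1: $U_-\in D_2$.** Let $U_{-*}=(u_{-*},\rho_{-*},a_1)\in D_2$ be the state of width $a_1$ joined to $U_-$ by a stationary wave $S_0(U_{-*},U_-)$. Let $\widetilde U_-=(\tilde u_-,\tilde\rho_-,a_0)\in D_1$ and $\widetilde U_{-*}=(\tilde u_{-*},\tilde\rho_{-*},a_1)\in D_1$ be the states on the shock curves from $U_-$ and $U_{-*}$, respectively, at which the shock speed vanishes. Let $\widetilde U_-^*=(\tilde u_-^*,\tilde\rho_-^*,a_1)\in D_1$ be the state of width $a_1$ joined to $\widetilde U_-$ by a stationary wave. Let $\bar u=u_{-*}+\rho_{-*}^\gamma$ and $\overline U=(\bar u,0,a_1)$. (1.1) If $\tilde u_{-*}<u_+<u_{-*}$, let $U_{m_1}$ be the state on the shock curve from $U_{-*}$ with velocity $u_+$. The solution is $S_0(U_{-*},U_-)\oplus S(U_{m_1},U_{-*})\oplus J(U_+,U_{m_1})$. (1.2) If $u_{-*}<u_+<\bar u$, let $U_{m_2}$ be the state on the rarefaction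 curve from $U_{-*}$ with velocity $u_+$. The solution is $S_0(U_{-*},U_-)\oplus R(U_{m_2},U_{-*})\oplus J(U_+,U_{m_2})$. (1.3) If $u_+>\bar u$, the solution contains a vacuum and is $S_0(U_{-*},U_-)\oplus R(\overline U,U_{-*})\oplus \mathrm{Vacuum}\oplus J(U_+,M)$ with $M=(u_+,0,a_1)$. (1.4) If $0<u_+<\tilde u_-^*$, consider the curve of states $U_0^*\in D_1$ of width $a_1$ joined by a stationary wave to the states $U_0$ of width $a_0$ on the shock curve from $U_-$ with $\rho_0>\tilde\rho_-$. Let $U_{m_3}^*$ be the state on this curve with velocity $u_+$, and let $U_{m_3}$ be the corresponding state on the shock curve from $U_-$, joined to $U_{m_3}^*$ by $S_0(U_{m_3}^*,U_{m_3})$. The solution is $S(U_{m_3},U_-)\oplus S_0(U_{m_3}^*,U_{m_3})\oplus J(U_+,U_{m_3}^* )$. (1.5) One has $\tilde u_-^*<\tilde u_{-*}$ (since $a_1>a_0$), and this case holds when $\tilde u_-^*<u_+<\tilde u_{-*}$. For $a\in[a_0,a_1]$, let $U_1(a)$ be the state of width $a$ joined to $U_-$ by a stationary wave, let $\widetilde U_1(a)\in D_1$ be the state of width $a$ on the shock curve from $U_1(a)$ with zero shock speed, and let $U_2(a)$ be the state of width $a_1$ joined to $\widetilde U_1(a)$ by a stationary wave. Let $L=\{U_2(a): a\in[a_0,a_1]\}$. Whenever $L$ contains a state $U_2=U_2(a)$ with velocity $u_+$, the solution contains three discontinuities with the same zero speed and is $S_0(U_1(a),U_-)\oplus S(\widetilde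 U_1(a),U_1(a))\oplus S_0(U_2,\widetilde U_1(a))\oplus J(U_+,U_2)$. **Case 2: $U_-\in D_1$.** Let $U_C=(u_C,\rho_C,a_0)$ be the intersection of the rarefaction curve from $U_-$ with $\Gamma_+$. Let $U_{C*}=(u_{C*},\rho_{C*},a_1)\in D_2$ and $U_C^*=(u_C^*,\rho_C^*,a_1)\in D_1$ be the two states of width $a_1$ joined to $U_C$ by stationary waves. Let $\widetilde U_{C*}=(\tilde u_{C*},\tilde\rho_{C*},a_1)$ be the state on the shock curve from $U_{C*}$ at which the shock speed vanishes. Let $\bar u=u_{C*}+\rho_{C*}^\gamma$ and $\overline U=(\bar u,0,a_1)$. (2.1) If $u_{C*}<u_+<\bar u$, let $U_{n_1}$ be the state on the rarefaction curve from $U_{C*}$ with velocity $u_+$. The solution is $R(U_C,U_-)\oplus S_0(U_{C*},U_C)\oplus R(U_{n_1},U_{C*})\oplus J(U_+,U_{n_1})$. (2.2) If $\tilde u_{C*}<u_+<u_{C*}$, let $U_{n_2}$ be the state on the shock curve from $U_{C*}$ with velocity $u_+$. The solution is $R(U_C,U_-)\oplus S_0(U_{C*},U_C)\oplus S(U_{n_2},U_{C*})\oplus J(U_+,U_{n_2})$. (2.3) If $u_+>\bar u$, the solution contains a vacuum and is $R(U_C,U_-)\oplus S_0(U_{C*},U_C)\oplus R(\overline U,U_{C*})\oplus\mathrm{Vacuum}\oplus J(U_+,M)$ with $M=(u_+,0,a_1)$. (2.4) Consider the curve of states $U_0^*\in D_1$ of width $a_1$ joined by a stationary wave to the states $U_0$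 of width $a_0$ lying on the union of the shock curve and the rarefaction curve from $U_-$ with $\rho_0>\rho_C$. 1) If $0<u_+<u_-$, let $U_{k_1}^*$ be the state on this curve with velocity $u_+$, joined by the stationary wave $S_0(U_{k_1}^*,U_{k_1})$ to a state $U_{k_1}$ on the shock curve from $U_-$. The solution is $S(U_{k_1},U_-)\oplus S_0(U_{k_1}^*,U_{k_1})\oplus J(U_+,U_{k_1}^* )$. 2) If $u_-<u_+<u_C$, let $U_{k_2}^*$ be the state on this curve with velocity $u_+$, joined by the stationary wave $S_0(U_{k_2}^*,U_{k_2})$ to a state $U_{k_2}$ on the rarefaction curve from $U_-$. The solution is $R(U_{k_2},U_-)\oplus S_0(U_{k_2}^*,U_{k_2})\oplus J(U_+,U_{k_2}^* )$. (2.5) One has $u_C^*<\tilde u_{C*}$ (since $a_1>a_0$), and this case holds when $u_C^*<u_+<\tilde u_{C*}$. For $a\in[a_0,a_1]$, let $U_3(a)$ be the state of width $a$ joined to $U_C$ by a stationary wave on the $D_2$ side, let $\widetilde U_3(a)\in D_1$ be the state of width $a$ on the shock curve from $U_3(a)$ with zero shock speed (for $a=a_0$ both degenerate to $U_C$), and let $U_4(a)$ be the state of width $a_1$ joined to $\widetilde U_3(a)$ by a stationary wave. Let $L=\{U_4(a): a\in[a_0,a_1]\}$. Whenever $L$ contains a state $U_4=U_4(a)$ with velocity $u_+$, the solution contains three discontinuities with the same zero speed and is $R(U_C,U_-)\oplus S_0(U_3(a),U_C)\oplus S(\widetilde U_3(a),U_3(a))\oplus S_0(U_4,\widetilde U_3(a))\oplus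 J(U_+,U_4)$.
   Context: States are $U=(u,\rho,a)$, with velocity $u$, density $\rho$ and road width $a>0$. In the first quadrant of the $(u,\rho)$ plane let $D_1=\{0<u<\gamma\rho^\gamma\}$, $D_2=\{u>\gamma\rho^\gamma\}$, $\Gamma_+=\{u=\gamma\rho^\gamma\}$; $U\in D_i$ means $(u,\rho)\in D_i$. The first characteristic speed is $\lambda_1=u-\gamma\rho^\gamma$. Elementary waves, with left state $U_i$ and right state $U_j$: - Rarefaction wave $R(U_j,U_i)$: same width $a$; $u_j+\rho_j^\gamma=u_i+\rho_i^\gamma$, $\rho_j<\rho_i$, $u_j>u_i$; inside the wave $\xi=x/t=u-\gamma\rho^\gamma$ and $u+\rho^\gamma$ is constant. The rarefaction curve from $U_i$ is the set of such $U_j$ (its endpoint on $\rho=0$ allowed). - Shock wave $S(U_j,U_i)$: same width $a$; $u_j+\rho_j^\gamma=u_i+\rho_i^\gamma$, $\rho_j>\rho_i$, $u_j<u_i$, with speed $\sigma(U_j,U_i)=u_j+\frac{\rho_i(\rho_i^\gamma-\rho_j^\gamma)}{\rho_j-\rho_i}$. The shock curve from $U_i$ is the set of such $U_j$. - Contact discontinuity $J(U_j,U_i)$: same width; $u_j=u_i$ equals its speed, with (in general different) densities $\rho_i,\rho_j$. - Stationary wave $S_0(U_j,U_i)$: speed $0$; the widths $a_i,a_j$ may differ and $$a_i\rho_iu_i=a_j\rho_ju_j,\qquad u_i^{\frac{\gamma}{1+\gamma}}\Big(\rho_i^\gamma+\frac{\gamma}{1+2\gamma}u_i\Big)=u_j^{\frac{\gamma}{1+\gamma}}\Big(\rho_j^\gamma+\frac{\gamma}{1+2\gamma}u_j\Big).$$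 It must satisfy the global entropy condition: the width $a$ is a monotone function of $\rho$ along the stationary curve in the $(u,\rho)$ plane; equivalently, the stationary wave remains in the closure of only one of the domains $D_1$, $D_2$. The notation $W_1\oplus W_2\oplus\cdots$ means that the waves occur in this order from left to right, separated by constant states, possibly trivial when consecutive waves have equal speeds or adjoin. A wave joining two equal states is trivial and may be omitted. "Vacuum" is a region with $\rho=0$.
   Formalization: In (2.4) the states U_{k1}, U_{k2} need not exist on the printed ranges; there their existence is assumed, and it is proved on 0<u_+<u_-^* and u_-^*<u_+<u_C^*, where U_-^* is the state of width a_1 joined to U_- by a stationary wave. *)

theory Defs
  imports "HOL-Analysis.Analysis"
begin

section \<open>States and the phase plane\<close>

text \<open>A state \<open>U = (u, \<rho>, a)\<close>: velocity, density, road width.\<close>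

type_synonym state = "real \<times> real \<times> real"

definition vel :: "state \<Rightarrow> real" where "vel U = fst U"
definition dens :: "state \<Rightarrow> real" where "dens U = fst (snd U)"
definition width :: "state \<Rightarrow> real" where "width U = snd (snd U)"

definition pressure :: "real \<Rightarrow> real \<Rightarrow> real" where
  "pressure \<gamma> \<rho> = \<rho> powr \<gamma>"

definition physical :: "state \<Rightarrow> bool" where
  "physical U \<longleftrightarrow> 0 \<le> vel U \<and> 0 \<le> dens U \<and> 0 < width U"

definition plane_point :: "state \<Rightarrow> real \<times> real" where
  "plane_point U = (vel U, dens U)"

definition D1 :: "real \<Rightarrow> (real \<times> real) set" where
  "D1 \<gamma> = {(u, \<rho>). 0 < u \<and> 0 < \<rho> \<and> u < \<gamma> * \<rho> powr \<gamma>}"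

definition D2 :: "real \<Rightarrow> (real \<times> real) set" where
  "D2 \<gamma> = {(u, \<rho>). 0 < u \<and> 0 < \<rho> \<and> u > \<gamma> * \<rho> powr \<gamma>}"

definition Gamma_plus :: "real \<Rightarrow> (real \<times> real) set" where
  "Gamma_plus \<gamma> = {(u, \<rho>). 0 < u \<and> 0 < \<rho> \<and> u = \<gamma> * \<rho> powr \<gamma>}"

definition lambda1 :: "real \<Rightarrow> state \<Rightarrow> real" where
  "lambda1 \<gamma> U = vel U - \<gamma> * dens U powr \<gamma>"


section \<open>Elementary waves\<close>

text \<open>In all wave relations the right state \<open>Uj\<close> is the first argument and the left
  state \<open>Ui\<close> the second, as in \<open>R(U\<^sub>j, U\<^sub>i)\<close>.\<close>

definition is_rarefaction :: "real \<Rightarrow> state \<Rightarrow> state \<Rightarrow> bool" where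
  "is_rarefaction \<gamma> Uj Ui \<longleftrightarrow> physical Ui \<and> physical Uj \<and> width Uj = width Ui \<and>
     vel Uj + dens Uj powr \<gamma> = vel Ui + dens Ui powr \<gamma> \<and>
     dens Uj < dens Ui \<and> vel Uj > vel Ui"

definition is_shock :: "real \<Rightarrow> state \<Rightarrow> state \<Rightarrow> bool" where
  "is_shock \<gamma> Uj Ui \<longleftrightarrow> physical Ui \<and> physical Uj \<and> width Uj = width Ui \<and>
     vel Uj + dens Uj powr \<gamma> = vel Ui + dens Ui powr \<gamma> \<and>
     dens Uj > dens Ui \<and> vel Uj < vel Ui"

definition shock_speed :: "real \<Rightarrow> state \<Rightarrow> state \<Rightarrow> real" where
  "shock_speed \<gamma> Uj Ui =
     vel Uj + dens Ui * (dens Ui powr \<gamma> - dens Uj powr \<gamma>) / (dens Uj - dens Ui)"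

definition rarefaction_curve :: "real \<Rightarrow> state \<Rightarrow> state set" where
  "rarefaction_curve \<gamma> Ui = {Uj. is_rarefaction \<gamma> Uj Ui}"

definition shock_curve :: "real \<Rightarrow> state \<Rightarrow> state set" where
  "shock_curve \<gamma> Ui = {Uj. is_shock \<gamma> Uj Ui}"

definition zero_speed_shock :: "real \<Rightarrow> state \<Rightarrow> state \<Rightarrow> bool" where
  "zero_speed_shock \<gamma> Uj Ui \<longleftrightarrow> Uj \<in> shock_curve \<gamma> Ui \<and> shock_speed \<gamma> Uj Ui = 0"

definition is_contact :: "state \<Rightarrow> state \<Rightarrow> bool" where
  "is_contact Uj Ui \<longleftrightarrow> physical Ui \<and> physical Uj \<and> width Uj = width Ui \<and> vel Uj = vel Ui"

definition stationary_invariant :: "real \<Rightarrow> real \<times> real \<Rightarrow> real" where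
  "stationary_invariant \<gamma> = (\<lambda>(u, \<rho>).
     u powr (\<gamma> / (1 + \<gamma>)) * (\<rho> powr \<gamma> + \<gamma> / (1 + 2 * \<gamma>) * u))"

text \<open>The part of the stationary curve through \<open>Ui\<close> with densities between those of
  \<open>Ui\<close> and \<open>Uj\<close>.\<close>

definition stationary_arc :: "real \<Rightarrow> state \<Rightarrow> state \<Rightarrow> (real \<times> real) set" where
  "stationary_arc \<gamma> Uj Ui = {(u, \<rho>). 0 \<le> u \<and> 0 \<le> \<rho> \<and> \<rho> \<in> closed_segment (dens Ui) (dens Uj) \<and>
     stationary_invariant \<gamma> (u, \<rho>) = stationary_invariant \<gamma> (plane_point Ui)}"

text \<open>The last conjunct is the global entropy condition.\<close>

definition is_stationary :: "real \<Rightarrow> state \<Rightarrow> state \<Rightarrow> bool" where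
  "is_stationary \<gamma> Uj Ui \<longleftrightarrow> physical Ui \<and> physical Uj \<and>
     width Ui * dens Ui * vel Ui = width Uj * dens Uj * vel Uj \<and>
     stationary_invariant \<gamma> (plane_point Ui) = stationary_invariant \<gamma> (plane_point Uj) \<and>
     (stationary_arc \<gamma> Uj Ui \<subseteq> closure (D1 \<gamma>) \<or> stationary_arc \<gamma> Uj Ui \<subseteq> closure (D2 \<gamma>))"

definition is_vacuum :: "state \<Rightarrow> state \<Rightarrow> bool" where
  "is_vacuum Uj Ui \<longleftrightarrow> physical Ui \<and> physical Uj \<and> width Uj = width Ui \<and>
     dens Ui = 0 \<and> dens Uj = 0 \<and> vel Ui < vel Uj"

datatype wave =
    Rarefaction state state
  | Shock state state
  | Contact state state
  | Stationary state state
  | Vacuum state state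

fun right_state :: "wave \<Rightarrow> state" where
  "right_state (Rarefaction Uj Ui) = Uj"
| "right_state (Shock Uj Ui) = Uj"
| "right_state (Contact Uj Ui) = Uj"
| "right_state (Stationary Uj Ui) = Uj"
| "right_state (Vacuum Uj Ui) = Uj"

fun left_state :: "wave \<Rightarrow> state" where
  "left_state (Rarefaction Uj Ui) = Ui"
| "left_state (Shock Uj Ui) = Ui"
| "left_state (Contact Uj Ui) = Ui"
| "left_state (Stationary Uj Ui) = Ui"
| "left_state (Vacuum Uj Ui) = Ui"

fun admissible :: "real \<Rightarrow> wave \<Rightarrow> bool" where
  "admissible \<gamma> (Rarefaction Uj Ui) = is_rarefaction \<gamma> Uj Ui"
| "admissible \<gamma> (Shock Uj Ui) = is_shock \<gamma> Uj Ui"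
| "admissible \<gamma> (Contact Uj Ui) = is_contact Uj Ui"
| "admissible \<gamma> (Stationary Uj Ui) = is_stationary \<gamma> Uj Ui"
| "admissible \<gamma> (Vacuum Uj Ui) = is_vacuum Uj Ui"

text \<open>In the variable \<open>\<xi> = x / t\<close> a wave occupies the interval between its left and its right
  speed, which coincide for a discontinuity.\<close>

fun left_speed :: "real \<Rightarrow> wave \<Rightarrow> real" where
  "left_speed \<gamma> (Rarefaction Uj Ui) = lambda1 \<gamma> Ui"
| "left_speed \<gamma> (Shock Uj Ui) = shock_speed \<gamma> Uj Ui"
| "left_speed \<gamma> (Contact Uj Ui) = vel Ui"
| "left_speed \<gamma> (Stationary Uj Ui) = 0"
| "left_speed \<gamma> (Vacuum Uj Ui) = vel Ui"

fun right_speed :: "real \<Rightarrow> wave \<Rightarrow> real" where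
  "right_speed \<gamma> (Rarefaction Uj Ui) = lambda1 \<gamma> Uj"
| "right_speed \<gamma> (Shock Uj Ui) = shock_speed \<gamma> Uj Ui"
| "right_speed \<gamma> (Contact Uj Ui) = vel Uj"
| "right_speed \<gamma> (Stationary Uj Ui) = 0"
| "right_speed \<gamma> (Vacuum Uj Ui) = vel Uj"

text \<open>\<open>interior_state \<gamma> w \<xi> U\<close>: the state \<open>U\<close> may be taken at \<open>\<xi>\<close> strictly inside the wave
  \<open>w\<close>. Only rarefactions and vacuum regions have an interior; the velocity in a vacuum is
  left open.\<close>

fun interior_state :: "real \<Rightarrow> wave \<Rightarrow> real \<Rightarrow> state \<Rightarrow> bool" where
  "interior_state \<gamma> (Rarefaction Uj Ui) \<xi> U \<longleftrightarrow> physical U \<and> width U = width Ui \<and>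
     vel U + dens U powr \<gamma> = vel Ui + dens Ui powr \<gamma> \<and> \<xi> = vel U - \<gamma> * dens U powr \<gamma>"
| "interior_state \<gamma> (Vacuum Uj Ui) \<xi> U \<longleftrightarrow> physical U \<and> width U = width Ui \<and> dens U = 0"
| "interior_state \<gamma> (Shock Uj Ui) \<xi> U \<longleftrightarrow> False"
| "interior_state \<gamma> (Contact Uj Ui) \<xi> U \<longleftrightarrow> False"
| "interior_state \<gamma> (Stationary Uj Ui) \<xi> U \<longleftrightarrow> False"

definition trivial_wave :: "wave \<Rightarrow> bool" where
  "trivial_wave w \<longleftrightarrow> left_state w = right_state w"


section \<open>Self-similar solutions and their wave patterns\<close>

text \<open>\<open>composed_of \<gamma> Um Up V ws\<close>: the profile \<open>V\<close>, as a function of \<open>\<xi> = x / t\<close>, is the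
  composition from left to right of the waves \<open>ws\<close>, leading from \<open>Um\<close> to \<open>Up\<close>. Waves joining
  equal states are dropped before speeds are compared. Values of \<open>V\<close> at the finitely many
  wave boundaries are irrelevant.\<close>

definition composed_of :: "real \<Rightarrow> state \<Rightarrow> state \<Rightarrow> (real \<Rightarrow> state) \<Rightarrow> wave list \<Rightarrow> bool" where
  "composed_of \<gamma> Um Up V ws \<longleftrightarrow>
     ws \<noteq> [] \<and> left_state (hd ws) = Um \<and> right_state (last ws) = Up \<and>
     successively (\<lambda>w w'. right_state w = left_state w') ws \<and>
     (let vs = filter (\<lambda>w. \<not> trivial_wave w) ws in
        vs \<noteq> [] \<and>
        (\<forall>w\<in>set vs. admissible \<gamma> w \<and> left_speed \<gamma> w \<le> right_speed \<gamma> w) \<and>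
        successively (\<lambda>w w'. right_speed \<gamma> w \<le> left_speed \<gamma> w') vs \<and>
        (\<forall>\<xi><left_speed \<gamma> (hd vs). V \<xi> = Um) \<and>
        (\<forall>\<xi>>right_speed \<gamma> (last vs). V \<xi> = Up) \<and>
        successively (\<lambda>w w'. \<forall>\<xi>. right_speed \<gamma> w < \<xi> \<and> \<xi> < left_speed \<gamma> w' \<longrightarrow>
                        V \<xi> = right_state w) vs \<and>
        (\<forall>w\<in>set vs. \<forall>\<xi>. left_speed \<gamma> w < \<xi> \<and> \<xi> < right_speed \<gamma> w \<longrightarrow>
                        interior_state \<gamma> w \<xi> (V \<xi>)))"

definition classical_solution_at :: "real \<Rightarrow> (real \<Rightarrow> real \<Rightarrow> state) \<Rightarrow> real \<Rightarrow> real \<Rightarrow> bool" where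
  "classical_solution_at \<gamma> U x t \<longleftrightarrow> (\<exists>m\<^sub>t m\<^sub>x q\<^sub>t q\<^sub>x a\<^sub>t a\<^sub>x.
     ((\<lambda>s. width (U x s) * dens (U x s)) has_real_derivative m\<^sub>t) (at t) \<and>
     ((\<lambda>y. width (U y t) * dens (U y t) * vel (U y t)) has_real_derivative m\<^sub>x) (at x) \<and>
     ((\<lambda>s. width (U x s) * dens (U x s) * (vel (U x s) + pressure \<gamma> (dens (U x s))))
        has_real_derivative q\<^sub>t) (at t) \<and>
     ((\<lambda>y. width (U y t) * dens (U y t) * vel (U y t) * (vel (U y t) + pressure \<gamma> (dens (U y t))))
        has_real_derivative q\<^sub>x) (at x) \<and>
     ((\<lambda>s. width (U x s)) has_real_derivative a\<^sub>t) (at t) \<and>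
     ((\<lambda>y. width (U y t)) has_real_derivative a\<^sub>x) (at x) \<and>
     m\<^sub>t + m\<^sub>x = 0 \<and>
     q\<^sub>t + q\<^sub>x = dens (U x t) * vel (U x t) * pressure \<gamma> (dens (U x t)) * a\<^sub>x \<and>
     a\<^sub>t = 0)"

text \<open>Jump conditions across a discontinuity of speed \<open>\<sigma> \<noteq> 0\<close>. The third equation
  \<open>a\<^sub>t = 0\<close> forces equal widths, so the nonconservative product vanishes there.\<close>

definition rankine_hugoniot :: "real \<Rightarrow> real \<Rightarrow> state \<Rightarrow> state \<Rightarrow> bool" where
  "rankine_hugoniot \<gamma> \<sigma> Ur Ul \<longleftrightarrow>
     width Ur = width Ul \<and>
     \<sigma> * (width Ur * dens Ur - width Ul * dens Ul) =
       width Ur * dens Ur * vel Ur - width Ul * dens Ul * vel Ul \<and>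
     \<sigma> * (width Ur * dens Ur * (vel Ur + pressure \<gamma> (dens Ur))
          - width Ul * dens Ul * (vel Ul + pressure \<gamma> (dens Ul))) =
       width Ur * dens Ur * vel Ur * (vel Ur + pressure \<gamma> (dens Ur))
       - width Ul * dens Ul * vel Ul * (vel Ul + pressure \<gamma> (dens Ul))"

text \<open>At \<open>x = 0\<close> the width jumps and the product \<open>\<rho> u p a\<^sub>x\<close> has no meaning as a distribution;
  there the two traces must be joined by finitely many elementary waves of speed zero.\<close>

definition zero_speed_step :: "real \<Rightarrow> state \<Rightarrow> state \<Rightarrow> bool" where
  "zero_speed_step \<gamma> Ul Ur \<longleftrightarrow> (\<exists>w. admissible \<gamma> w \<and> left_state w = Ul \<and> right_state w = Ur \<and>
     left_speed \<gamma> w = 0 \<and> right_speed \<gamma> w = 0)"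

definition self_similar_solution :: "real \<Rightarrow> state \<Rightarrow> state \<Rightarrow> (real \<Rightarrow> state) \<Rightarrow> bool" where
  "self_similar_solution \<gamma> Um Up V \<longleftrightarrow>
     (\<forall>x<0. ((\<lambda>t. V (x / t)) \<longlongrightarrow> Um) (at_right 0)) \<and>
     (\<forall>x>0. ((\<lambda>t. V (x / t)) \<longlongrightarrow> Up) (at_right 0)) \<and>
     (\<exists>E. finite E \<and> 0 \<in> E \<and>
        (\<forall>x t. t > 0 \<and> x / t \<notin> E \<longrightarrow>
           physical (V (x / t)) \<and> classical_solution_at \<gamma> (\<lambda>y s. V (y / s)) x t) \<and>
        (\<forall>\<sigma>\<in>E. \<exists>Ul Ur. (V \<longlongrightarrow> Ul) (at_left \<sigma>) \<and> (V \<longlongrightarrow> Ur) (at_right \<sigma>) \<and>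
           (if \<sigma> = 0 then (zero_speed_step \<gamma>)\<^sup>*\<^sup>* Ul Ur else rankine_hugoniot \<gamma> \<sigma> Ur Ul)))"

definition solved_by :: "real \<Rightarrow> state \<Rightarrow> state \<Rightarrow> wave list \<Rightarrow> bool" where
  "solved_by \<gamma> Um Up ws \<longleftrightarrow>
     (\<exists>V. self_similar_solution \<gamma> Um Up V \<and> composed_of \<gamma> Um Up V ws)"


section \<open>Auxiliary notions for the construction\<close>

definition is_the :: "('a \<Rightarrow> bool) \<Rightarrow> 'a \<Rightarrow> bool" where
  "is_the P x \<longleftrightarrow> P x \<and> (\<forall>y. P y \<longrightarrow> y = x)"

text \<open>\<open>joined_curve \<gamma> a A\<close>: the curve of states \<open>U\<^sub>0\<^sup>* \<in> D\<^sub>1\<close> of width \<open>a\<close> joined by a stationary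
  wave to states \<open>U\<^sub>0 \<in> A\<close>, recorded as pairs \<open>(U\<^sub>0, U\<^sub>0\<^sup>*)\<close>.\<close>

definition joined_curve :: "real \<Rightarrow> real \<Rightarrow> state set \<Rightarrow> (state \<times> state) set" where
  "joined_curve \<gamma> a A = {(U0, U0s). U0 \<in> A \<and> width U0s = a \<and> plane_point U0s \<in> D1 \<gamma> \<and>
     is_stationary \<gamma> U0s U0}"

end

theory Submission
  imports Defs "HOL-Real_Asymp.Real_Asymp"
begin

text \<open>Two observations carry the proof.

  First, a list of admissible waves whose speeds are ordered from left to right always is a
  solution (\<open>solved_by_admissible_waves\<close>): glue the rarefaction fans, the vacuum and the constant
  states along the axis \<open>\<xi> = x / t\<close>. Several discontinuities may share a speed; for a nonzero speed
  the Rankine--Hugoniot conditions are transitive, so the total jump is correct, and at speed zero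
  a chain of elementary waves is exactly what is asked for. What is left is to find the
  intermediate states, to prove them unique, and to compare speeds.

  Second, all wave relations become one-dimensional in the coordinates flux \<open>m = \<rho> u\<close> and
  Mach number \<open>s = u / \<rho>\<^sup>\<gamma>\<close>. There \<open>D\<^sub>1\<close>, \<open>\<Gamma>\<^sub>+\<close>, \<open>D\<^sub>2\<close> read \<open>s < \<gamma>\<close>, \<open>s = \<gamma>\<close>, \<open>s > \<gamma>\<close>; with
  \<open>\<alpha> = \<gamma> / (1 + \<gamma>)\<close> and \<open>\<delta> = \<alpha> (1 + \<alpha>)\<close> the quantity conserved by shocks and rarefactions is
  \<open>u + \<rho>\<^sup>\<gamma> = m\<^sup>\<alpha> \<chi>(s)\<close>, and the invariant of a stationary wave is \<open>m\<^sup>\<delta> \<psi>(s)\<close>. Both \<open>\<chi>\<close> and \<open>\<psi>\<close> have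
  the form \<open>s\<^sup>-\<^sup>\<theta> (1 + b s)\<close> of a valley with its bottom at the sonic value \<open>s = \<gamma>\<close>. A stationary
  wave multiplies \<open>\<psi>\<close> by \<open>(a\<^sub>j / a\<^sub>i)\<^sup>\<delta>\<close>, and the entropy condition keeps \<open>s\<close> on one slope of the
  valley (\<open>is_stationary_iff\<close>), so widening the road always determines a unique state on each
  slope. A shock of speed zero keeps \<open>m\<close> and \<open>\<chi>\<close> and changes the slope (\<open>zero_speed_shock_iff\<close>).

  Two points need more. The velocity reached by a stationary wave from a subsonic state of a shock
  or rarefaction curve increases with the Mach number of that state
  (\<open>stationary_image_increasing\<close>), and by the intermediate value theorem takes all values in
  the expected range (\<open>stationary_image_onto\<close>); this settles the patterns in which a stationary wave
  in \<open>D\<^sub>1\<close> follows a single shock or rarefaction. For the patterns with three discontinuities of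
  speed zero one has to see that a zero-speed shock followed by the widening of the road leads to a
  smaller velocity than the widening followed by such a shock (\<open>stationary_after_shock_slower\<close>).
  This holds because \<open>ln \<psi> - \<delta> ln \<chi>\<close> increases through the sonic value (\<open>Psi_Chi_increasing\<close>),
  its derivative being a positive multiple of \<open>(s - \<gamma>)\<^sup>2\<close>.\<close>


section \<open>Ordered waves form a self-similar solution\<close>

text \<open>In a vacuum the velocity is free; \<open>u = \<xi>\<close> joins it continuously to both end states, so
  that a vacuum, like a rarefaction, causes no jump.\<close>
fun wave_interior :: "real \<Rightarrow> wave \<Rightarrow> real \<Rightarrow> state" where
  "wave_interior \<gamma> (Rarefaction Uj Ui) \<xi> =
     ((\<gamma> * (vel Ui + dens Ui powr \<gamma>) + \<xi>) / (1 + \<gamma>),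
      ((vel Ui + dens Ui powr \<gamma> - \<xi>) / (1 + \<gamma>)) powr (1 / \<gamma>), width Ui)"
| "wave_interior \<gamma> (Vacuum Uj Ui) \<xi> = (\<xi>, 0, width Ui)"
| "wave_interior \<gamma> (Shock Uj Ui) \<xi> = Ui"
| "wave_interior \<gamma> (Contact Uj Ui) \<xi> = Ui"
| "wave_interior \<gamma> (Stationary Uj Ui) \<xi> = Ui"

fun profile :: "real \<Rightarrow> state \<Rightarrow> wave list \<Rightarrow> real \<Rightarrow> state" where
  "profile \<gamma> U [] \<xi> = U"
| "profile \<gamma> U (w # ws) \<xi> =
     (if \<xi> \<le> left_speed \<gamma> w then U
      else if \<xi> < right_speed \<gamma> w then wave_interior \<gamma> w \<xi>
      else profile \<gamma> (right_state w) ws \<xi>)"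

fun wave_path :: "real \<Rightarrow> state \<Rightarrow> wave list \<Rightarrow> state \<Rightarrow> bool" where
  "wave_path \<gamma> U [] U' \<longleftrightarrow> U = U'"
| "wave_path \<gamma> U (w # ws) U' \<longleftrightarrow> left_state w = U \<and> admissible \<gamma> w \<and>
     (\<forall>w'\<in>set ws. right_speed \<gamma> w \<le> left_speed \<gamma> w') \<and> wave_path \<gamma> (right_state w) ws U'"

lemma powr_powr_inverse:
  fixes x g :: real
  assumes "0 \<le> x" "0 < g"
  shows "(x powr g) powr (1 / g) = x" "(x powr (1 / g)) powr g = x"
  using assms by (simp_all add: powr_powr)

lemma admissible_speeds:
  assumes "0 < \<gamma>" "admissible \<gamma> w"
  shows "left_speed \<gamma> w \<le> right_speed \<gamma> w"
    and "left_speed \<gamma> w = right_speed \<gamma> w \<or> (\<exists>Uj Ui. w = Rarefaction Uj Ui \<or> w = Vacuum Uj Ui)"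
proof -
  have *: "lambda1 \<gamma> Ui \<le> lambda1 \<gamma> Uj" if "is_rarefaction \<gamma> Uj Ui" for Ui Uj
  proof -
    have "dens Uj powr \<gamma> \<le> dens Ui powr \<gamma>"
      using that assms(1) by (intro powr_mono2) (auto simp: is_rarefaction_def physical_def)
    hence "\<gamma> * dens Uj powr \<gamma> \<le> \<gamma> * dens Ui powr \<gamma>" using assms(1) by simp
    thus ?thesis using that by (simp add: is_rarefaction_def lambda1_def)
  qed
  show "left_speed \<gamma> w \<le> right_speed \<gamma> w"
    using assms * by (cases w) (auto simp: is_contact_def is_vacuum_def)
  show "left_speed \<gamma> w = right_speed \<gamma> w \<or> (\<exists>Uj Ui. w = Rarefaction Uj Ui \<or> w = Vacuum Uj Ui)"
    using assms by (cases w) (auto simp: is_contact_def)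
qed

lemma admissible_physical:
  assumes "admissible \<gamma> w"
  shows "physical (left_state w)" "physical (right_state w)"
  using assms by (cases w; auto simp: is_rarefaction_def is_shock_def is_contact_def
      is_stationary_def is_vacuum_def)+

lemma wave_interior_ends:
  assumes "0 < \<gamma>" "admissible \<gamma> w" "left_speed \<gamma> w < right_speed \<gamma> w"
  shows "wave_interior \<gamma> w (left_speed \<gamma> w) = left_state w"
    and "wave_interior \<gamma> w (right_speed \<gamma> w) = right_state w"
proof -
  have *: "((\<gamma> * (vel U + dens U powr \<gamma>) + lambda1 \<gamma> U) / (1 + \<gamma>),
      ((vel U + dens U powr \<gamma> - lambda1 \<gamma> U) / (1 + \<gamma>)) powr (1 / \<gamma>), width U) = U"
    if "0 \<le> dens U" for U
  proof -
    have "(vel U + dens U powr \<gamma> - lambda1 \<gamma> U) / (1 + \<gamma>) = dens U powr \<gamma>"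
      using assms(1) by (simp add: lambda1_def field_simps)
    moreover have "(\<gamma> * (vel U + dens U powr \<gamma>) + lambda1 \<gamma> U) / (1 + \<gamma>) = vel U"
      using assms(1) by (simp add: lambda1_def field_simps)
    ultimately show ?thesis using that assms(1)
      by (simp add: powr_powr_inverse) (simp add: vel_def dens_def width_def)
  qed
  have v: "(vel U, 0, width U) = U" if "dens U = 0" for U
    using that by (cases U) (auto simp: vel_def dens_def width_def)
  consider Uj Ui where "w = Rarefaction Uj Ui" | Uj Ui where "w = Vacuum Uj Ui"
    using admissible_speeds[OF assms(1,2)] assms(3) by auto
  hence "wave_interior \<gamma> w (left_speed \<gamma> w) = left_state w \<and>
    wave_interior \<gamma> w (right_speed \<gamma> w) = right_state w"
  proof cases
    case 1
    hence r: "is_rarefaction \<gamma> Uj Ui" using assms by simp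
    have i: "0 \<le> dens Ui" "0 \<le> dens Uj" using r by (auto simp: is_rarefaction_def physical_def)
    have "vel Ui + dens Ui powr \<gamma> = vel Uj + dens Uj powr \<gamma>" "width Ui = width Uj"
      using r by (auto simp: is_rarefaction_def)
    with *[OF i(1)] *[OF i(2)] 1 show ?thesis by simp
  next
    case 2
    hence r: "is_vacuum Uj Ui" using assms by simp
    thus ?thesis using v[of Ui] v[of Uj] 2 by (auto simp: is_vacuum_def)
  qed
  thus "wave_interior \<gamma> w (left_speed \<gamma> w) = left_state w" "wave_interior \<gamma> w (right_speed \<gamma> w) = right_state w"
    by auto
qed

lemma rarefaction_interior_positive:
  assumes "0 < \<gamma>" "is_rarefaction \<gamma> Uj Ui" "\<xi> \<le> lambda1 \<gamma> Uj"
  shows "0 \<le> vel Ui + dens Ui powr \<gamma> - \<xi>"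
    and "\<xi> < lambda1 \<gamma> Uj \<Longrightarrow> 0 < vel Ui + dens Ui powr \<gamma> - \<xi>"
proof -
  have e: "vel Ui + dens Ui powr \<gamma> = lambda1 \<gamma> Uj + (1 + \<gamma>) * dens Uj powr \<gamma>"
    using assms by (auto simp: is_rarefaction_def lambda1_def algebra_simps)
  have "0 \<le> (1 + \<gamma>) * dens Uj powr \<gamma>" using assms by simp
  thus "0 \<le> vel Ui + dens Ui powr \<gamma> - \<xi>"
    and "\<xi> < lambda1 \<gamma> Uj \<Longrightarrow> 0 < vel Ui + dens Ui powr \<gamma> - \<xi>"
    using e assms(3) by linarith+
qed

lemma wave_interior_continuous_on:
  assumes "0 < \<gamma>" "admissible \<gamma> w"
  shows "continuous_on {left_speed \<gamma> w..right_speed \<gamma> w} (wave_interior \<gamma> w)"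
proof (cases w)
  case (Rarefaction Uj Ui)
  have "continuous_on {lambda1 \<gamma> Ui..lambda1 \<gamma> Uj} (\<lambda>\<xi>. ((vel Ui + dens Ui powr \<gamma> - \<xi>) / (1 + \<gamma>)) powr (1 / \<gamma>))"
    using assms Rarefaction rarefaction_interior_positive[OF assms(1), of Uj Ui]
    by (intro continuous_on_powr' continuous_intros) auto
  moreover have "continuous_on {lambda1 \<gamma> Ui..lambda1 \<gamma> Uj} (\<lambda>\<xi>. (\<gamma> * (vel Ui + dens Ui powr \<gamma>) + \<xi>) / (1 + \<gamma>))"
    using assms by (intro continuous_intros) auto
  ultimately show ?thesis unfolding Rarefaction left_speed.simps right_speed.simps wave_interior.simps
    by (intro continuous_on_Pair continuous_on_const)
next
  case (Vacuum Uj Ui)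
  have "continuous_on {vel Ui..vel Uj} (\<lambda>\<xi>. (\<xi>, 0::real, width Ui))"
    by (intro continuous_intros)
  thus ?thesis using Vacuum by (simp cong: continuous_on_cong)
qed auto

lemma wave_interior_interior_state:
  assumes "0 < \<gamma>" "admissible \<gamma> w" "left_speed \<gamma> w < \<xi>" "\<xi> < right_speed \<gamma> w"
  shows "interior_state \<gamma> w \<xi> (wave_interior \<gamma> w \<xi>)" "physical (wave_interior \<gamma> w \<xi>)"
proof -
  consider Uj Ui where "w = Rarefaction Uj Ui" | Uj Ui where "w = Vacuum Uj Ui"
    using admissible_speeds[OF assms(1,2)] assms(3,4) by auto
  hence "interior_state \<gamma> w \<xi> (wave_interior \<gamma> w \<xi>) \<and> physical (wave_interior \<gamma> w \<xi>)"
  proof cases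
    case 1
    hence r: "is_rarefaction \<gamma> Uj Ui" and l: "lambda1 \<gamma> Ui < \<xi>" "\<xi> < lambda1 \<gamma> Uj"
      using assms by auto
    define W where "W = vel Ui + dens Ui powr \<gamma>"
    have p: "0 < W - \<xi>" using rarefaction_interior_positive(2)[OF assms(1) r] l
      by (simp add: W_def)
    have c: "0 \<le> (W - \<xi>) / (1 + \<gamma>)" using p assms(1) by simp
    have v: "\<gamma> * W + \<xi> \<ge> (1 + \<gamma>) * vel Ui"
      using l(1) by (simp add: W_def lambda1_def algebra_simps)
    have "0 \<le> vel Ui" "0 < width Ui" using r by (auto simp: is_rarefaction_def physical_def)
    moreover have "0 \<le> (1 + \<gamma>) * vel Ui" using assms(1) \<open>0 \<le> vel Ui\<close> by simp
    ultimately have "0 \<le> \<gamma> * W + \<xi>" using v by linarith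
    hence "physical ((\<gamma> * W + \<xi>) / (1 + \<gamma>), ((W - \<xi>) / (1 + \<gamma>)) powr (1 / \<gamma>), width Ui)"
      using \<open>0 < width Ui\<close> assms(1) by (simp add: physical_def vel_def dens_def width_def)
    moreover have n: "1 + \<gamma> \<noteq> 0" using assms(1) by simp
    moreover have "(\<gamma> * W + \<xi>) / (1 + \<gamma>) + (W - \<xi>) / (1 + \<gamma>) = W"
      "(\<gamma> * W + \<xi>) / (1 + \<gamma>) - \<gamma> * ((W - \<xi>) / (1 + \<gamma>)) = \<xi>"
      using n by (simp_all add: add_divide_distrib[symmetric] diff_divide_distrib[symmetric] nonzero_divide_eq_eq algebra_simps)
    ultimately show ?thesis using assms(1) c
      unfolding 1 interior_state.simps wave_interior.simps W_def[symmetric]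
      by (simp add: powr_powr_inverse vel_def dens_def width_def)
  next
    case 2
    hence r: "is_vacuum Uj Ui" and l: "vel Ui < \<xi>" using assms by auto
    thus ?thesis using 2
      by (auto simp: is_vacuum_def physical_def vel_def dens_def width_def)
  qed
  thus "interior_state \<gamma> w \<xi> (wave_interior \<gamma> w \<xi>)" "physical (wave_interior \<gamma> w \<xi>)" by auto
qed

lemma profile_left:
  "(\<And>w. w \<in> set ws \<Longrightarrow> \<xi> < left_speed \<gamma> w) \<Longrightarrow> profile \<gamma> U ws \<xi> = U"
  by (cases ws) (auto simp: less_imp_le)

lemma profile_right:
  assumes "0 < \<gamma>" "wave_path \<gamma> U ws U'" "\<And>w. w \<in> set ws \<Longrightarrow> right_speed \<gamma> w < \<xi>"
  shows "profile \<gamma> U ws \<xi> = U'"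
  using assms(2,3)
proof (induction ws arbitrary: U)
  case (Cons w ws)
  have "left_speed \<gamma> w \<le> right_speed \<gamma> w" using Cons.prems admissible_speeds[OF assms(1)] by auto
  moreover have "right_speed \<gamma> w < \<xi>" using Cons.prems(2)[of w] by simp
  moreover have "profile \<gamma> (right_state w) ws \<xi> = U'"
    using Cons.prems by (intro Cons.IH) auto
  ultimately show ?case by simp
qed auto

text \<open>For \<open>\<sigma> = 0\<close> this is \<^const>\<open>zero_speed_step\<close>.\<close>
definition jump :: "real \<Rightarrow> real \<Rightarrow> state \<Rightarrow> state \<Rightarrow> bool" where
  "jump \<gamma> \<sigma> Ul Ur \<longleftrightarrow> (\<exists>w. admissible \<gamma> w \<and> left_state w = Ul \<and> right_state w = Ur \<and>
     left_speed \<gamma> w = \<sigma> \<and> right_speed \<gamma> w = \<sigma>)"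

text \<open>Waves that share the speed \<open>\<sigma>\<close> contribute one jump each, whence the reflexive transitive
  closure. If \<open>\<sigma>\<close> is at most the right speed of the first wave, the rest of the profile is still
  constant to the left of \<open>\<sigma>\<close>, and so its left trace is the right state of that wave.\<close>
lemma profile_traces:
  assumes "0 < \<gamma>" "wave_path \<gamma> U ws U'"
  shows "\<exists>Ul Ur. (profile \<gamma> U ws \<longlongrightarrow> Ul) (at_left \<sigma>) \<and> (profile \<gamma> U ws \<longlongrightarrow> Ur) (at_right \<sigma>) \<and>
     (jump \<gamma> \<sigma>)\<^sup>*\<^sup>* Ul Ur"
  using assms(2)
proof (induction ws arbitrary: U)
  case Nil
  have "profile \<gamma> U [] = (\<lambda>_. U)" by auto
  thus ?case by (metis rtranclp.rtrancl_refl tendsto_const)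
next
  case (Cons w ws)
  let ?l = "left_speed \<gamma> w" and ?r = "right_speed \<gamma> w" and ?R = "right_state w"
  let ?V = "profile \<gamma> U (w # ws)" and ?V' = "profile \<gamma> ?R ws"
  have adm: "admissible \<gamma> w" and lw: "left_state w = U"
    and le: "\<And>w'. w' \<in> set ws \<Longrightarrow> ?r \<le> left_speed \<gamma> w'"
    and path: "wave_path \<gamma> ?R ws U'" using Cons.prems by auto
  have lr: "?l \<le> ?r" using admissible_speeds[OF assms(1) adm] by simp
  obtain Ul Ur where IH: "(?V' \<longlongrightarrow> Ul) (at_left \<sigma>)" "(?V' \<longlongrightarrow> Ur) (at_right \<sigma>)" "(jump \<gamma> \<sigma>)\<^sup>*\<^sup>* Ul Ur"
    using Cons.IH[OF path] by blast
  have cont: "continuous_on {?l..?r} (wave_interior \<gamma> w)" by (rule wave_interior_continuous_on[OF assms(1) adm])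
  have wave_interior_left: "(wave_interior \<gamma> w \<longlongrightarrow> wave_interior \<gamma> w \<sigma>) (at_left \<sigma>)" if "?l < \<sigma>" "\<sigma> \<le> ?r"
    by (rule continuous_on_Icc_at_leftD[OF continuous_on_subset[OF cont]]) (use that in auto)
  have wave_interior_right: "(wave_interior \<gamma> w \<longlongrightarrow> wave_interior \<gamma> w \<sigma>) (at_right \<sigma>)" if "?l \<le> \<sigma>" "\<sigma> < ?r"
    by (rule continuous_on_Icc_at_rightD[OF continuous_on_subset[OF cont]]) (use that in auto)
  have L_U: "(?V \<longlongrightarrow> U) (at_left \<sigma>)" if "\<sigma> \<le> ?l"
    by (rule tendsto_eventually, rule eventually_mono[OF eventually_at_left_real[of "\<sigma> - 1"]])
       (use that in auto)
  have R_U: "(?V \<longlongrightarrow> U) (at_right \<sigma>)" if "\<sigma> < ?l"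
    by (rule tendsto_eventually, rule eventually_mono[OF eventually_at_right_real[OF that]]) auto
  have L_in: "(?V \<longlongrightarrow> wave_interior \<gamma> w \<sigma>) (at_left \<sigma>)" if "?l < \<sigma>" "\<sigma> \<le> ?r"
    by (rule Lim_transform_eventually[OF wave_interior_left[OF that]],
        rule eventually_mono[OF eventually_at_left_real[OF that(1)]]) (use that in auto)
  have R_in: "(?V \<longlongrightarrow> wave_interior \<gamma> w \<sigma>) (at_right \<sigma>)" if "?l \<le> \<sigma>" "\<sigma> < ?r"
    by (rule Lim_transform_eventually[OF wave_interior_right[OF that]],
        rule eventually_mono[OF eventually_at_right_real[OF that(2)]]) (use that in auto)
  have L_t: "(?V \<longlongrightarrow> Ul) (at_left \<sigma>)" if "?r < \<sigma>"
    by (rule Lim_transform_eventually[OF IH(1)],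
        rule eventually_mono[OF eventually_at_left_real[OF that]]) (use lr in auto)
  have R_t: "(?V \<longlongrightarrow> Ur) (at_right \<sigma>)" if "?r \<le> \<sigma>"
    by (rule Lim_transform_eventually[OF IH(2)],
        rule eventually_mono[OF eventually_at_right_real[of \<sigma> "\<sigma> + 1"]]) (use that lr in auto)
  have Ul: "Ul = ?R" if "\<sigma> \<le> ?r"
  proof -
    have "?V' \<xi> = ?R" if "\<xi> < \<sigma>" for \<xi>
      by (rule profile_left) (use le \<open>\<sigma> \<le> ?r\<close> that in force)
    hence "(?V' \<longlongrightarrow> ?R) (at_left \<sigma>)"
      by (intro tendsto_eventually eventually_mono[OF eventually_at_left_real[of "\<sigma> - 1"]]) auto
    thus ?thesis using IH(1) tendsto_unique[OF trivial_limit_at_left_real] by blast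
  qed
  consider "\<sigma> < ?l" | "\<sigma> = ?l" "?l < ?r" | "?l < \<sigma>" "\<sigma> < ?r" | "\<sigma> = ?r" "?l < ?r"
    | "\<sigma> = ?l" "?l = ?r" | "?r < \<sigma>" using lr by linarith
  thus ?case
  proof cases
    case 1 thus ?thesis using L_U R_U by (intro exI[of _ U]) (auto simp del: profile.simps)
  next
    case 2
    hence "wave_interior \<gamma> w \<sigma> = U" using wave_interior_ends(1)[OF assms(1) adm] lw by simp
    thus ?thesis using 2 L_U R_in by (intro exI[of _ U]) (auto simp del: profile.simps)
  next
    case 3 thus ?thesis using L_in R_in by (intro exI[of _ "wave_interior \<gamma> w \<sigma>"]) (auto simp del: profile.simps)
  next
    case 4
    hence "wave_interior \<gamma> w \<sigma> = Ul" using wave_interior_ends(2)[OF assms(1) adm] Ul by simp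
    thus ?thesis using 4 L_in R_t IH(3) by (intro exI[of _ Ul] exI[of _ Ur]) (auto simp del: profile.simps)
  next
    case 5
    hence "jump \<gamma> \<sigma> U Ul" unfolding jump_def using adm lw Ul by (intro exI[of _ w]) (auto simp del: profile.simps)
    thus ?thesis using 5 L_U R_t IH(3)
      by (intro exI[of _ U] exI[of _ Ur]) (auto simp del: profile.simps intro: converse_rtranclp_into_rtranclp)
  next
    case 6 thus ?thesis using L_t R_t lr IH(3) by (intro exI[of _ Ul] exI[of _ Ur]) (auto simp del: profile.simps)
  qed
qed

text \<open>Jump conditions at a common speed add up, so any number of discontinuities travelling
  together satisfies them as one. Across a shock \<open>u + \<rho>\<^sup>\<gamma>\<close> is constant, which makes the second
  condition a multiple of the first.\<close>
lemma rankine_hugoniot_jumps: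
  assumes "0 < \<gamma>" "\<sigma> \<noteq> 0" "(jump \<gamma> \<sigma>)\<^sup>*\<^sup>* Ul Ur"
  shows "rankine_hugoniot \<gamma> \<sigma> Ur Ul"
  using assms(3)
proof (induction rule: rtranclp_induct)
  case base
  show ?case by (simp add: rankine_hugoniot_def)
next
  case (step V W)
  obtain w where w: "admissible \<gamma> w" "left_state w = V" "right_state w = W"
    "left_speed \<gamma> w = \<sigma>" "right_speed \<gamma> w = \<sigma>" using step.hyps(2) by (auto simp: jump_def)
  have "rankine_hugoniot \<gamma> \<sigma> W V"
  proof (cases w)
    case (Rarefaction Uj Ui)
    have r: "is_rarefaction \<gamma> Uj Ui" using w Rarefaction by simp
    hence "dens Uj powr \<gamma> < dens Ui powr \<gamma>"
      using assms(1) by (intro powr_less_mono2) (auto simp: is_rarefaction_def physical_def)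
    hence "\<gamma> * dens Uj powr \<gamma> < \<gamma> * dens Ui powr \<gamma>" using assms(1) by simp
    thus ?thesis using w Rarefaction r by (auto simp: lambda1_def is_rarefaction_def)
  next
    case (Shock Uj Ui)
    have s: "is_shock \<gamma> W V" "\<sigma> = shock_speed \<gamma> W V" using w Shock by auto
    define q where "q = vel V + dens V powr \<gamma>"
    have q: "vel W + dens W powr \<gamma> = q" using s by (simp add: is_shock_def q_def)
    have d: "dens W - dens V \<noteq> 0" "width W = width V" using s by (auto simp: is_shock_def)
    have "\<sigma> * (dens W - dens V) = vel W * (dens W - dens V) + dens V * (dens V powr \<gamma> - dens W powr \<gamma>)"
      using s(2) d by (simp add: shock_speed_def field_simps)
    also have "dens V powr \<gamma> - dens W powr \<gamma> = vel W - vel V" using q by (simp add: q_def)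
    finally have e: "\<sigma> * (dens W - dens V) = dens W * vel W - dens V * vel V"
      by (simp add: algebra_simps)
    have m: "\<sigma> * (width W * dens W - width V * dens V) = width W * dens W * vel W - width V * dens V * vel V"
      using arg_cong[OF e, of "\<lambda>z. width V * z"] d by (simp add: algebra_simps)
    show ?thesis
      unfolding rankine_hugoniot_def pressure_def q q_def[symmetric]
      using m arg_cong[OF m, of "\<lambda>z. z * q"] d by (simp add: algebra_simps)
  next
    case (Contact Uj Ui)
    thus ?thesis using w by (auto simp: is_contact_def rankine_hugoniot_def algebra_simps)
  next
    case (Stationary Uj Ui)
    thus ?thesis using w assms(2) by auto
  next
    case (Vacuum Uj Ui)
    thus ?thesis using w by (auto simp: is_vacuum_def)
  qed
  thus ?case using step.IH unfolding rankine_hugoniot_def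
    by (auto simp: algebra_simps)
qed

lemma classical_solution_at_cong:
  assumes "\<forall>\<^sub>F \<xi> in nhds (x / t). V \<xi> = W \<xi>" "0 < t"
    and sol: "classical_solution_at \<gamma> (\<lambda>y s. W (y / s)) x t"
  shows "classical_solution_at \<gamma> (\<lambda>y s. V (y / s)) x t"
proof -
  have t: "filterlim (\<lambda>s. x / s) (nhds (x / t)) (nhds t)"
    using assms(2) by (intro tendsto_intros filterlim_ident) auto
  have x: "filterlim (\<lambda>y. y / t) (nhds (x / t)) (nhds x)"
    using assms(2) by (intro tendsto_intros filterlim_ident) auto
  have ev_t: "\<forall>\<^sub>F s in nhds t. V (x / s) = W (x / s)"
    using eventually_compose_filterlim[OF assms(1) t] .
  have ev_x: "\<forall>\<^sub>F y in nhds x. V (y / t) = W (y / t)"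
    using eventually_compose_filterlim[OF assms(1) x] .
  have dt: "((\<lambda>s. f (V (x / s))) has_real_derivative d) (at t)"
    if d: "((\<lambda>s. f (W (x / s))) has_real_derivative d) (at t)" for f d
  proof -
    have "\<forall>\<^sub>F s in nhds t. f (V (x / s)) = f (W (x / s))"
      using ev_t by eventually_elim simp
    from DERIV_cong_ev[OF refl this refl, of d] d show ?thesis by blast
  qed
  have dx: "((\<lambda>y. f (V (y / t))) has_real_derivative d) (at x)"
    if d: "((\<lambda>y. f (W (y / t))) has_real_derivative d) (at x)" for f d
  proof -
    have "\<forall>\<^sub>F y in nhds x. f (V (y / t)) = f (W (y / t))"
      using ev_x by eventually_elim simp
    from DERIV_cong_ev[OF refl this refl, of d] d show ?thesis by blast
  qed
  have e: "V (x / t) = W (x / t)" using assms(1) by (rule eventually_nhds_x_imp_x)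
  from sol[unfolded classical_solution_at_def] obtain mt mx qt qx wt ax where
    d: "((\<lambda>s. width (W (x / s)) * dens (W (x / s))) has_real_derivative mt) (at t)"
     "((\<lambda>y. width (W (y / t)) * dens (W (y / t)) * vel (W (y / t))) has_real_derivative mx) (at x)"
     "((\<lambda>s. width (W (x / s)) * dens (W (x / s)) * (vel (W (x / s)) + pressure \<gamma> (dens (W (x / s)))))
        has_real_derivative qt) (at t)"
     "((\<lambda>y. width (W (y / t)) * dens (W (y / t)) * vel (W (y / t)) * (vel (W (y / t)) + pressure \<gamma> (dens (W (y / t)))))
        has_real_derivative qx) (at x)"
     "((\<lambda>s. width (W (x / s))) has_real_derivative wt) (at t)"
     "((\<lambda>y. width (W (y / t))) has_real_derivative ax) (at x)"
    and eqs: "mt + mx = 0"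
     "qt + qx = dens (W (x / t)) * vel (W (x / t)) * pressure \<gamma> (dens (W (x / t))) * ax" "wt = 0"
    by (elim exE conjE) (rule that)
  show ?thesis unfolding classical_solution_at_def e
    by (rule exI[of _ mt], rule exI[of _ mx], rule exI[of _ qt], rule exI[of _ qx],
        rule exI[of _ wt], rule exI[of _ ax], intro conjI eqs)
       (rule dt[of "\<lambda>U. width U * dens U", OF d(1)] dx[of "\<lambda>U. width U * dens U * vel U", OF d(2)]
          dt[of "\<lambda>U. width U * dens U * (vel U + pressure \<gamma> (dens U))", OF d(3)]
          dx[of "\<lambda>U. width U * dens U * vel U * (vel U + pressure \<gamma> (dens U))", OF d(4)]
          dt[of width, OF d(5)] dx[of width, OF d(6)])+
qed

lemma classical_solution_at_const: "classical_solution_at \<gamma> (\<lambda>y s. U) x t"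
  unfolding classical_solution_at_def by (intro exI[of _ 0] conjI) simp_all

lemma classical_solution_at_vacuum:
  "classical_solution_at \<gamma> (\<lambda>y s. (y / s, 0, a)) x t"
  unfolding classical_solution_at_def vel_def dens_def width_def
  by (intro exI[of _ 0] conjI) simp_all

text \<open>Inside a fan \<open>u + \<rho>\<^sup>\<gamma> = W\<close>, so the momentum equation is \<open>W\<close> times the mass equation, and
  the latter reduces to \<open>\<rho>' (u - \<xi>) = - \<rho> / (1 + \<gamma>)\<close> with \<open>u - \<xi> = \<gamma> \<rho>\<^sup>\<gamma>\<close>.\<close>
lemma classical_solution_at_rarefaction:
  assumes g: "0 < \<gamma>" and t: "0 < t" and p: "0 < W - x / t"
  shows "classical_solution_at \<gamma>
     (\<lambda>y s. ((\<gamma> * W + y / s) / (1 + \<gamma>), ((W - y / s) / (1 + \<gamma>)) powr (1 / \<gamma>), a)) x t"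
proof -
  define r where "r \<xi> = ((W - \<xi>) / (1 + \<gamma>)) powr (1 / \<gamma>)" for \<xi>
  define u where "u \<xi> = (\<gamma> * W + \<xi>) / (1 + \<gamma>)" for \<xi>
  define \<xi> where "\<xi> = x / t"
  define P where "P = (W - \<xi>) / (1 + \<gamma>)"
  define r' where "r' = - (r \<xi> / (\<gamma> * (1 + \<gamma>) * P))"
  have P: "0 < P" using p g by (simp add: P_def \<xi>_def)
  have dr: "(r has_real_derivative r') (at \<xi>)"
  proof -
    have "((\<lambda>\<xi>. (W - \<xi>) / (1 + \<gamma>)) has_real_derivative - 1 / (1 + \<gamma>)) (at \<xi>)"
      by (intro DERIV_cdivide) (auto intro!: derivative_eq_intros)
    from DERIV_fun_powr[OF this, of "1 / \<gamma>"] P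
    have "(r has_real_derivative 1 / \<gamma> * P powr (1 / \<gamma> - 1) * (- 1 / (1 + \<gamma>))) (at \<xi>)"
      by (simp add: r_def[abs_def] P_def)
    moreover have "P powr (1 / \<gamma> - 1) = r \<xi> / P" using P by (simp add: powr_diff r_def P_def[symmetric])
    moreover have "1 / \<gamma> * (r \<xi> / P) * (- 1 / (1 + \<gamma>)) = r'" by (simp add: r'_def)
    ultimately show ?thesis by simp
  qed
  have du: "(u has_real_derivative 1 / (1 + \<gamma>)) (at \<xi>)"
    unfolding u_def by (intro DERIV_cdivide) (auto intro!: derivative_eq_intros)
  have cons: "r' * (u \<xi> - \<xi>) + r \<xi> / (1 + \<gamma>) = 0"
  proof -
    have "u \<xi> - \<xi> = \<gamma> * P" using g by (simp add: u_def P_def field_simps)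
    moreover have "r' * (\<gamma> * P) = - (r \<xi> / (1 + \<gamma>))" using P g by (simp add: r'_def)
    ultimately show ?thesis by simp
  qed
  have sum: "\<forall>\<^sub>F z in nhds \<xi>. u z + pressure \<gamma> (r z) = W"
  proof -
    have "\<forall>\<^sub>F z in nhds \<xi>. z < W"
      using p order_tendstoD(2)[OF filterlim_ident, of \<xi> W] by (simp add: \<xi>_def)
    thus ?thesis
    proof eventually_elim
      case (elim z)
      hence "pressure \<gamma> (r z) = (W - z) / (1 + \<gamma>)"
        using g by (simp add: pressure_def r_def powr_powr_inverse)
      thus ?case using g by (simp add: u_def field_simps)
    qed
  qed
  have dw: "((\<lambda>z. u z + pressure \<gamma> (r z)) has_real_derivative 0) (at \<xi>)"
    using DERIV_cong_ev[OF refl sum refl, of 0] by simp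
  have w: "u \<xi> + pressure \<gamma> (r \<xi>) = W" using eventually_nhds_x_imp_x[OF sum] .
  have ct: "((\<lambda>s. x / s) has_real_derivative - \<xi> / t) (at t)"
    using t by (auto intro!: derivative_eq_intros simp: \<xi>_def field_simps power2_eq_square)
  have cx: "((\<lambda>y. y / t) has_real_derivative 1 / t) (at x)"
    using t by (auto intro!: derivative_eq_intros)
  have T: "((\<lambda>s. f (x / s)) has_real_derivative f' * (- \<xi> / t)) (at t)"
    if "(f has_real_derivative f') (at \<xi>)" for f f'
    using DERIV_chain2[of f f' "\<lambda>s. x / s" t, OF _ ct] that by (simp add: \<xi>_def)
  have X: "((\<lambda>y. f (y / t)) has_real_derivative f' * (1 / t)) (at x)"
    if "(f has_real_derivative f') (at \<xi>)" for f f'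
    using DERIV_chain2[of f f' "\<lambda>y. y / t" x, OF _ cx] that by (simp add: \<xi>_def)
  have d1: "((\<lambda>z. a * r z) has_real_derivative a * r') (at \<xi>)"
    using dr by (auto intro!: derivative_eq_intros)
  have d2: "((\<lambda>z. a * r z * u z) has_real_derivative a * (r' * u \<xi> + r \<xi> / (1 + \<gamma>))) (at \<xi>)"
    using dr du by (auto intro!: derivative_eq_intros simp: algebra_simps)
  have d3: "((\<lambda>z. a * r z * (u z + pressure \<gamma> (r z))) has_real_derivative a * r' * W) (at \<xi>)"
    using DERIV_mult[OF d1 dw] w by simp
  have d4: "((\<lambda>z. a * r z * u z * (u z + pressure \<gamma> (r z))) has_real_derivative
      a * (r' * u \<xi> + r \<xi> / (1 + \<gamma>)) * W) (at \<xi>)"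
    using DERIV_mult[OF d2 dw] w by simp
  have k: "r' * u \<xi> + r \<xi> / (1 + \<gamma>) = r' * \<xi>" using cons by (simp add: algebra_simps)
  have z: "a * r' * (- \<xi> / t) + a * (r' * u \<xi> + r \<xi> / (1 + \<gamma>)) * (1 / t) = 0"
    unfolding k by (simp add: field_simps)
  have z': "a * r' * W * (- \<xi> / t) + a * (r' * u \<xi> + r \<xi> / (1 + \<gamma>)) * W * (1 / t) = 0"
    unfolding k by (simp add: field_simps)
  show ?thesis
    unfolding classical_solution_at_def vel_def dens_def width_def fst_conv snd_conv
      r_def[symmetric] u_def[symmetric]
    by (rule exI[of _ "a * r' * (- \<xi> / t)"],
        rule exI[of _ "a * (r' * u \<xi> + r \<xi> / (1 + \<gamma>)) * (1 / t)"],
        rule exI[of _ "a * r' * W * (- \<xi> / t)"],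
        rule exI[of _ "a * (r' * u \<xi> + r \<xi> / (1 + \<gamma>)) * W * (1 / t)"], rule exI[of _ 0], rule exI[of _ 0])
       (use T[OF d1] X[OF d2] T[OF d3] X[OF d4] z z' in simp)
qed

lemma profile_classical:
  assumes "0 < \<gamma>" "0 < t" "wave_path \<gamma> U ws U'" "physical U"
    and "x / t \<notin> left_speed \<gamma> ` set ws \<union> right_speed \<gamma> ` set ws"
  shows "physical (profile \<gamma> U ws (x / t)) \<and>
    classical_solution_at \<gamma> (\<lambda>y s. profile \<gamma> U ws (y / s)) x t"
  using assms(3-5)
proof (induction ws arbitrary: U)
  case Nil
  thus ?case by (simp add: classical_solution_at_const)
next
  case (Cons w ws)
  let ?l = "left_speed \<gamma> w" and ?r = "right_speed \<gamma> w"
  have adm: "admissible \<gamma> w" using Cons.prems by auto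
  have lr: "?l \<le> ?r" using admissible_speeds[OF assms(1) adm] by simp
  have ev: "\<forall>\<^sub>F \<xi> in nhds (x / t). \<xi> \<in> S" if "open S" "x / t \<in> S" for S
    using that by (simp add: eventually_nhds_in_open)
  consider "x / t < ?l" | "?l < x / t" "x / t < ?r" | "?r < x / t"
    using Cons.prems(3) by fastforce
  thus ?case
  proof cases
    case 1
    have "\<forall>\<^sub>F \<xi> in nhds (x / t). profile \<gamma> U (w # ws) \<xi> = U"
      by (rule eventually_mono[OF ev[of "{..< ?l}"]]) (use 1 in auto)
    from classical_solution_at_cong[OF this assms(2) classical_solution_at_const]
    show ?thesis using 1 Cons.prems(2) by simp
  next
    case 2
    have e: "\<forall>\<^sub>F \<xi> in nhds (x / t). profile \<gamma> U (w # ws) \<xi> = wave_interior \<gamma> w \<xi>"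
      by (rule eventually_mono[OF ev[of "{?l <..< ?r}"]]) (use 2 in auto)
    consider Uj Ui where "w = Rarefaction Uj Ui" | Uj Ui where "w = Vacuum Uj Ui"
      using admissible_speeds[OF assms(1) adm] 2 by auto
    hence "classical_solution_at \<gamma> (\<lambda>y s. wave_interior \<gamma> w (y / s)) x t"
    proof cases
      case *: 1
      thus ?thesis using adm 2
        classical_solution_at_rarefaction[OF assms(1,2)] rarefaction_interior_positive(2)[OF assms(1), of Uj Ui]
        by simp
    next
      case *: 2
      thus ?thesis by (simp add: classical_solution_at_vacuum)
    qed
    from classical_solution_at_cong[OF e assms(2) this] wave_interior_interior_state[OF assms(1) adm 2]
    show ?thesis using 2 by simp
  next
    case 3
    have e: "\<forall>\<^sub>F \<xi> in nhds (x / t). profile \<gamma> U (w # ws) \<xi> = profile \<gamma> (right_state w) ws \<xi>"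
      by (rule eventually_mono[OF ev[of "{?r <..}"]]) (use 3 lr in auto)
    have IH: "physical (profile \<gamma> (right_state w) ws (x / t)) \<and>
       classical_solution_at \<gamma> (\<lambda>y s. profile \<gamma> (right_state w) ws (y / s)) x t"
      by (rule Cons.IH) (use Cons.prems admissible_physical[OF adm] in auto)
    from classical_solution_at_cong[OF e assms(2) conjunct2[OF IH]] IH
    show ?thesis using 3 lr by simp
  qed
qed

lemma wave_path_admissible:
  "wave_path \<gamma> U ws U' \<Longrightarrow> w \<in> set ws \<Longrightarrow> admissible \<gamma> w"
proof (induction ws arbitrary: U)
  case (Cons v ws)
  thus ?case using Cons.IH[of "right_state v"] by auto
qed simp

lemma profile_skip:
  assumes "0 < \<gamma>" "wave_path \<gamma> U (w # ws) U'" "right_speed \<gamma> w < \<xi>"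
  shows "profile \<gamma> U (w # ws) \<xi> = profile \<gamma> (right_state w) ws \<xi>"
  using assms admissible_speeds(1)[of \<gamma> w] by auto

lemma profile_between:
  assumes "0 < \<gamma>" "wave_path \<gamma> U ws U'"
  shows "successively (\<lambda>w w'. \<forall>\<xi>. right_speed \<gamma> w < \<xi> \<and> \<xi> < left_speed \<gamma> w' \<longrightarrow>
                        profile \<gamma> U ws \<xi> = right_state w) ws"
  using assms(2)
proof (induction ws arbitrary: U)
  case (Cons w ws)
  note skip = profile_skip[OF assms(1) Cons.prems]
  have later: "right_speed \<gamma> w \<le> right_speed \<gamma> v" if "v \<in> set ws" for v
  proof -
    have "admissible \<gamma> v" using Cons.prems(1) that wave_path_admissible[of \<gamma> U "w # ws" U' v] by simp
    hence "left_speed \<gamma> v \<le> right_speed \<gamma> v" by (rule admissible_speeds(1)[OF assms(1)])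
    moreover have "right_speed \<gamma> w \<le> left_speed \<gamma> v" using Cons.prems that by simp
    ultimately show ?thesis by simp
  qed
  have "successively (\<lambda>v w'. \<forall>\<xi>. right_speed \<gamma> v < \<xi> \<and> \<xi> < left_speed \<gamma> w' \<longrightarrow>
           profile \<gamma> U (w # ws) \<xi> = right_state v) ws"
  proof (rule successively_mono)
    show "successively (\<lambda>v w'. \<forall>\<xi>. right_speed \<gamma> v < \<xi> \<and> \<xi> < left_speed \<gamma> w' \<longrightarrow>
           profile \<gamma> (right_state w) ws \<xi> = right_state v) ws"
      by (rule Cons.IH) (use Cons.prems in simp)
    fix v w' assume "v \<in> set ws" and 
      v: "\<forall>\<xi>. right_speed \<gamma> v < \<xi> \<and> \<xi> < left_speed \<gamma> w' \<longrightarrow>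
           profile \<gamma> (right_state w) ws \<xi> = right_state v"
    have "right_speed \<gamma> w \<le> right_speed \<gamma> v" using later[OF \<open>v \<in> set ws\<close>] .
    thus "\<forall>\<xi>. right_speed \<gamma> v < \<xi> \<and> \<xi> < left_speed \<gamma> w' \<longrightarrow>
           profile \<gamma> U (w # ws) \<xi> = right_state v"
      using v skip by (metis le_less_trans)
  qed
  moreover have "\<forall>\<xi>. right_speed \<gamma> w < \<xi> \<and> \<xi> < left_speed \<gamma> (hd ws) \<longrightarrow>
           profile \<gamma> U (w # ws) \<xi> = right_state w" if "ws \<noteq> []"
  proof (intro allI impI)
    fix \<xi> assume "right_speed \<gamma> w < \<xi> \<and> \<xi> < left_speed \<gamma> (hd ws)"
    moreover from this have "profile \<gamma> (right_state w) ws \<xi> = right_state w"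
      using that by (cases ws) auto
    ultimately show "profile \<gamma> U (w # ws) \<xi> = right_state w" using skip by metis
  qed
  ultimately show ?case by (auto simp: successively_Cons simp del: profile.simps)
qed auto

lemma profile_inside:
  assumes "0 < \<gamma>" "wave_path \<gamma> U ws U'" "w \<in> set ws" "left_speed \<gamma> w < \<xi>" "\<xi> < right_speed \<gamma> w"
  shows "interior_state \<gamma> w \<xi> (profile \<gamma> U ws \<xi>)"
  using assms(2-3)
proof (induction ws arbitrary: U)
  case (Cons v ws)
  show ?case
  proof (cases "w = v")
    case True
    thus ?thesis using Cons.prems wave_interior_interior_state(1)[OF assms(1) _ assms(4,5)] assms(4,5) by auto
  next
    case False
    hence "w \<in> set ws" using Cons.prems by simp
    thus ?thesis using Cons profile_skip[OF assms(1) Cons.prems(1)] assms(4) 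
      by (metis less_le_trans not_le order_less_imp_le wave_path.simps(2))
  qed
qed auto

lemma wave_path_self_similar:
  assumes "0 < \<gamma>" "physical U" "wave_path \<gamma> U ws U'"
  shows "self_similar_solution \<gamma> U U' (profile \<gamma> U ws)"
proof -
  let ?V = "profile \<gamma> U ws"
  let ?E = "left_speed \<gamma> ` set ws \<union> right_speed \<gamma> ` set ws"
  let ?E0 = "insert 0 ?E"
  have fin: "finite ?E0" by simp
  have left: "?V \<xi> = U" if "\<xi> < Min ?E0" for \<xi>
    using that by (intro profile_left) (simp add: Min_gr_iff)
  have right: "?V \<xi> = U'" if "Max ?E0 < \<xi>" for \<xi>
    using that by (intro profile_right[OF assms(1,3)]) (simp add: Max_less_iff)
  have l0: "\<forall>x<0. ((\<lambda>t. ?V (x / t)) \<longlongrightarrow> U) (at_right 0)"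
  proof (intro allI impI)
    fix x :: real assume "x < 0"
    hence "filterlim (\<lambda>t. x / t) at_bot (at_right 0)"
      by real_asymp
    hence "\<forall>\<^sub>F t in at_right 0. x / t < Min ?E0" unfolding filterlim_at_bot_dense by blast
    thus "((\<lambda>t. ?V (x / t)) \<longlongrightarrow> U) (at_right 0)"
      by (intro tendsto_eventually) (elim eventually_mono, rule left)
  qed
  have r0: "\<forall>x>0. ((\<lambda>t. ?V (x / t)) \<longlongrightarrow> U') (at_right 0)"
  proof (intro allI impI)
    fix x :: real assume "0 < x"
    hence "filterlim (\<lambda>t. x / t) at_top (at_right 0)"
      by real_asymp
    hence "\<forall>\<^sub>F t in at_right 0. Max ?E0 < x / t" unfolding filterlim_at_top_dense by blast
    thus "((\<lambda>t. ?V (x / t)) \<longlongrightarrow> U') (at_right 0)"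
      by (intro tendsto_eventually) (elim eventually_mono, rule right)
  qed
  have jumps: "\<exists>Ul Ur. (?V \<longlongrightarrow> Ul) (at_left \<sigma>) \<and> (?V \<longlongrightarrow> Ur) (at_right \<sigma>) \<and>
           (if \<sigma> = 0 then (zero_speed_step \<gamma>)\<^sup>*\<^sup>* Ul Ur else rankine_hugoniot \<gamma> \<sigma> Ur Ul)" for \<sigma>
  proof -
    have "zero_speed_step \<gamma> = jump \<gamma> 0" by (simp add: fun_eq_iff zero_speed_step_def jump_def)
    moreover obtain Ul Ur where "(?V \<longlongrightarrow> Ul) (at_left \<sigma>)" "(?V \<longlongrightarrow> Ur) (at_right \<sigma>)"
        "(jump \<gamma> \<sigma>)\<^sup>*\<^sup>* Ul Ur"
      using profile_traces[OF assms(1,3), of \<sigma>] by blast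
    ultimately show ?thesis using rankine_hugoniot_jumps[OF assms(1), of \<sigma> Ul Ur]
      by (intro exI[of _ Ul] exI[of _ Ur]) auto
  qed
  show ?thesis unfolding self_similar_solution_def
    using l0 r0 jumps profile_classical[OF assms(1) _ assms(3,2)] fin
    by (intro conjI exI[of _ ?E0]) auto
qed

lemma wave_pathI:
  assumes "0 < \<gamma>" "successively (\<lambda>w w'. right_state w = left_state w') ws"
    "\<forall>w\<in>set ws. admissible \<gamma> w" "successively (\<lambda>w w'. right_speed \<gamma> w \<le> left_speed \<gamma> w') ws"
    "ws \<noteq> []"
  shows "wave_path \<gamma> (left_state (hd ws)) ws (right_state (last ws))"
  using assms(2-5)
proof (induction ws)
  case (Cons w ws)
  show ?case
  proof (cases "ws = []")
    case False
    hence IH: "wave_path \<gamma> (left_state (hd ws)) ws (right_state (last ws))"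
      using Cons by (auto simp: successively_Cons)
    have e: "left_state (hd ws) = right_state w" "right_speed \<gamma> w \<le> left_speed \<gamma> (hd ws)"
      using Cons.prems False by (auto simp: successively_Cons)
    have "left_speed \<gamma> (hd ws) \<le> left_speed \<gamma> v" if v: "v \<in> set ws" for v
    proof (cases "v = hd ws")
      case False
      then obtain h t where h: "ws = h # t" "v \<in> set t" using v by (cases ws) auto
      hence "left_speed \<gamma> h \<le> right_speed \<gamma> h" "right_speed \<gamma> h \<le> left_speed \<gamma> v"
        using IH admissible_speeds(1)[OF assms(1)] by auto
      thus ?thesis using h by simp
    qed simp
    thus ?thesis using IH e Cons.prems False by force
  qed (use Cons in simp)
qed simp

lemma successively_drop_trivial:
  "successively (\<lambda>w w'. right_state w = left_state w') ws \<Longrightarrow>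
   ws \<noteq> [] \<Longrightarrow>
   (let vs = filter (\<lambda>w. \<not> trivial_wave w) ws in
     if vs = [] then left_state (hd ws) = right_state (last ws)
     else left_state (hd vs) = left_state (hd ws) \<and> right_state (last vs) = right_state (last ws) \<and>
       successively (\<lambda>w w'. right_state w = left_state w') vs)"
proof (induction ws)
  case (Cons w ws)
  thus ?case
    by (cases "ws = []") (auto simp: successively_Cons trivial_wave_def Let_def split: if_splits)
qed simp

text \<open>Only the nontrivial waves \<open>vs\<close> enter the profile; dropping the trivial ones does not
  break the chain of states.\<close>
lemma solved_by_ordered_waves:
  assumes g: "0 < \<gamma>" and U: "physical U"
    and ends: "ws \<noteq> []" "left_state (hd ws) = U" "right_state (last ws) = U'"
    and chain: "successively (\<lambda>w w'. right_state w = left_state w') ws"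
    and vs: "filter (\<lambda>w. \<not> trivial_wave w) ws = vs" "vs \<noteq> []"
    and adm: "\<forall>w\<in>set vs. admissible \<gamma> w"
    and ordered: "successively (\<lambda>w w'. right_speed \<gamma> w \<le> left_speed \<gamma> w') vs"
  shows "solved_by \<gamma> U U' ws"
proof -
  have v: "left_state (hd vs) = U" "right_state (last vs) = U'"
    "successively (\<lambda>w w'. right_state w = left_state w') vs"
    using successively_drop_trivial[OF chain ends(1)] vs ends by (auto simp: Let_def)
  have path: "wave_path \<gamma> U vs U'"
    using wave_pathI[OF g v(3) adm ordered vs(2)] v by simp
  have speeds: "left_speed \<gamma> w \<le> right_speed \<gamma> w" if "w \<in> set vs" for w
    using that adm admissible_speeds(1)[OF g] by blast
  have l: "\<forall>\<xi><left_speed \<gamma> (hd vs). profile \<gamma> U vs \<xi> = U"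
    using vs(2) by (cases vs) auto
  have last: "right_speed \<gamma> w \<le> right_speed \<gamma> (last vs)" if "w \<in> set vs" for w
    using path that speeds
  proof (induction vs arbitrary: U)
    case (Cons v vs)
    show ?case
    proof (cases "w = v")
      case True
      have "right_speed \<gamma> v \<le> right_speed \<gamma> (last vs)" if "vs \<noteq> []"
        using Cons.prems that last_in_set[OF that] by (meson list.set_intros(2) order_trans wave_path.simps(2))
      thus ?thesis using True by simp
    next
      case False
      hence "w \<in> set vs" "vs \<noteq> []" using Cons.prems by auto
      moreover have "wave_path \<gamma> (right_state v) vs U'" using Cons.prems by simp
      ultimately show ?thesis using Cons.IH Cons.prems(3) by simp
    qed
  qed simp
  have r: "\<forall>\<xi>>right_speed \<gamma> (last vs). profile \<gamma> U vs \<xi> = U'"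
    using last profile_right[OF g path] by (meson le_less_trans)
  have "composed_of \<gamma> U U' (profile \<gamma> U vs) ws"
    unfolding composed_of_def vs(1) Let_def
    using ends chain vs(2) adm speeds ordered l r profile_between[OF g path] profile_inside[OF g path]
    by auto
  thus ?thesis unfolding solved_by_def using wave_path_self_similar[OF g U path] by blast
qed

lemma wave_path_sorted:
  "wave_path \<gamma> U ws U' \<Longrightarrow> sorted_wrt (\<lambda>w w'. right_speed \<gamma> w \<le> left_speed \<gamma> w') ws"
proof (induction ws arbitrary: U)
  case (Cons v ws)
  thus ?case using Cons.IH[of "right_state v"] by simp
qed simp

lemma solved_by_admissible_waves:
  assumes g: "0 < \<gamma>"
    and ends: "ws \<noteq> []" "left_state (hd ws) = U" "right_state (last ws) = U'"
    and chain: "successively (\<lambda>w w'. right_state w = left_state w') ws"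
    and adm: "\<forall>w\<in>set ws. admissible \<gamma> w"
    and ordered: "successively (\<lambda>w w'. right_speed \<gamma> w \<le> left_speed \<gamma> w') ws"
    and nontrivial: "\<exists>w\<in>set ws. \<not> trivial_wave w"
  shows "solved_by \<gamma> U U' ws"
proof (rule solved_by_ordered_waves[OF g _ ends chain refl])
  show "physical U" using ends adm admissible_physical(1)[of \<gamma> "hd ws"] by force
  show "filter (\<lambda>w. \<not> trivial_wave w) ws \<noteq> []" using nontrivial by (simp add: filter_empty_conv)
  show "\<forall>w\<in>set (filter (\<lambda>w. \<not> trivial_wave w) ws). admissible \<gamma> w" using adm by simp
  show "successively (\<lambda>w w'. right_speed \<gamma> w \<le> left_speed \<gamma> w') (filter (\<lambda>w. \<not> trivial_wave w) ws)"
    by (intro successively_if_sorted_wrt sorted_wrt_filter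
        wave_path_sorted[OF wave_pathI[OF g chain adm ordered ends(1)]])
qed

section \<open>The valley functions\<close>
definition valley :: "real \<Rightarrow> real \<Rightarrow> real \<Rightarrow> real" where
  "valley b \<theta> s = s powr (- \<theta>) * (1 + b * s)"

text \<open>The last condition says that the minimum of \<^term>\<open>valley b \<theta>\<close> is at \<open>g\<close>.\<close>
definition valley_at :: "real \<Rightarrow> real \<Rightarrow> real \<Rightarrow> bool" where
  "valley_at g b \<theta> \<longleftrightarrow> 0 < g \<and> 0 < b \<and> 0 < \<theta> \<and> \<theta> < 1 \<and> b * (1 - \<theta>) * g = \<theta>"

lemma valley_deriv:
  assumes "0 < s"
  shows "(valley b \<theta> has_real_derivative s powr (- \<theta> - 1) * (b * (1 - \<theta>) * s - \<theta>)) (at s)"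
proof -
  have "((\<lambda>s. s powr (- \<theta>)) has_real_derivative - \<theta> * s powr (- \<theta> - 1)) (at s)"
    by (rule has_real_derivative_powr[OF assms])
  moreover have "((\<lambda>s. 1 + b * s) has_real_derivative b) (at s)"
    by (auto intro!: derivative_eq_intros)
  ultimately
  have "(valley b \<theta> has_real_derivative - \<theta> * s powr (- \<theta> - 1) * (1 + b * s) + b * s powr (- \<theta>)) (at s)"
    unfolding valley_def[abs_def] by (rule DERIV_mult)
  moreover have "s powr (- \<theta>) = s powr (- \<theta> - 1) * s"
    using assms by (simp add: powr_diff)
  ultimately show ?thesis by (simp add: algebra_simps)
qed

lemma valley_pos: "0 < b \<Longrightarrow> 0 < s \<Longrightarrow> 0 < valley b \<theta> s"
  by (simp add: valley_def add_pos_pos)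

lemma valley_continuous_on: "S \<subseteq> {0<..} \<Longrightarrow> continuous_on S (valley b \<theta>)"
  using valley_deriv DERIV_isCont by (intro continuous_at_imp_continuous_on) blast

lemma valley_slope:
  assumes "valley_at g b \<theta>"
  shows "b * (1 - \<theta>) * s - \<theta> = b * (1 - \<theta>) * (s - g)" "0 < b * (1 - \<theta>)"
  using assms by (auto simp: valley_at_def right_diff_distrib)

lemma valley_decreasing:
  assumes "valley_at g b \<theta>" "0 < x" "x < y" "y \<le> g"
  shows "valley b \<theta> y < valley b \<theta> x"
proof (rule DERIV_neg_imp_decreasing_open[OF assms(3)])
  fix s assume s: "x < s" "s < y"
  have "s powr (- \<theta> - 1) * (b * (1 - \<theta>) * s - \<theta>) < 0"
    unfolding valley_slope(1)[OF assms(1)] using s assms valley_slope(2)[OF assms(1)]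
    by (intro mult_pos_neg) auto
  thus "\<exists>d. (valley b \<theta> has_real_derivative d) (at s) \<and> d < 0"
    using valley_deriv[of s b \<theta>] s assms by auto
qed (use assms in \<open>auto intro: valley_continuous_on\<close>)

lemma valley_increasing:
  assumes "valley_at g b \<theta>" "g \<le> x" "x < y"
  shows "valley b \<theta> x < valley b \<theta> y"
proof (rule DERIV_pos_imp_increasing_open[OF assms(3)])
  have "0 < g" using assms by (simp add: valley_at_def)
  fix s assume s: "x < s" "s < y"
  have "s powr (- \<theta> - 1) * (b * (1 - \<theta>) * s - \<theta>) > 0"
    unfolding valley_slope(1)[OF assms(1)] using s assms valley_slope(2)[OF assms(1)] \<open>0 < g\<close>
    by (intro mult_pos_pos[OF _ mult_pos_pos]) auto
  thus "\<exists>d. (valley b \<theta> has_real_derivative d) (at s) \<and> d > 0"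
    using valley_deriv[of s b \<theta>] s assms \<open>0 < g\<close> by auto
qed (use assms in \<open>auto simp: valley_at_def intro!: valley_continuous_on\<close>)

lemma valley_less_iff_left:
  assumes "valley_at g b \<theta>" "0 < x" "x \<le> g" "0 < y" "y \<le> g"
  shows "valley b \<theta> x < valley b \<theta> y \<longleftrightarrow> y < x"
  using valley_decreasing[OF assms(1), of x y] valley_decreasing[OF assms(1), of y x] assms
  by (cases x y rule: linorder_cases) auto

lemma valley_less_iff_right:
  assumes "valley_at g b \<theta>" "g \<le> x" "g \<le> y"
  shows "valley b \<theta> x < valley b \<theta> y \<longleftrightarrow> x < y"
  using valley_increasing[OF assms(1), of x y] valley_increasing[OF assms(1), of y x] assms
  by (cases x y rule: linorder_cases) auto

lemma valley_inj:
  assumes "valley_at g b \<theta>" "0 < x" "0 < y" "x \<le> g \<and> y \<le> g \<or> g \<le> x \<and> g \<le> y"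
    "valley b \<theta> x = valley b \<theta> y"
  shows "x = y"
  using assms(4)
proof
  assume "x \<le> g \<and> y \<le> g"
  thus ?thesis using valley_less_iff_left[OF assms(1), of x y] valley_less_iff_left[OF assms(1), of y x] assms by auto
next
  assume "g \<le> x \<and> g \<le> y"
  thus ?thesis using valley_less_iff_right[OF assms(1), of x y] valley_less_iff_right[OF assms(1), of y x] assms by auto
qed

lemma valley_min:
  assumes "valley_at g b \<theta>" "0 < s" "s \<noteq> g"
  shows "valley b \<theta> g < valley b \<theta> s"
  using valley_decreasing[OF assms(1), of s g] valley_increasing[OF assms(1), of g s] assms(2,3)
  by (cases "s < g") auto

lemma valley_onto_left:
  assumes v: "valley_at g b \<theta>" and c: "valley b \<theta> g \<le> c"
  obtains s where "0 < s" "s \<le> g" "valley b \<theta> s = c"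
proof -
  have b: "0 < g" "0 < b" "0 < \<theta>" using v by (auto simp: valley_at_def)
  have c0: "0 < c" using c valley_pos[OF b(2,1), of \<theta>] by simp
  define a where "a = min g (c powr (- 1 / \<theta>))"
  have a: "0 < a" "a \<le> g" using b c0 by (auto simp: a_def)
  have "c = (c powr (- 1 / \<theta>)) powr (- \<theta>)" using b c0 by (simp add: powr_powr)
  also have "\<dots> \<le> a powr (- \<theta>)" using a b by (intro powr_mono2') (auto simp: a_def)
  also have "\<dots> * 1 \<le> valley b \<theta> a" unfolding valley_def using a b by (intro mult_left_mono) auto
  finally have "c \<le> valley b \<theta> a" by simp
  from IVT2'[OF c this a(2)] valley_continuous_on[of "{a..g}"] a(1)
  obtain s where "a \<le> s" "s \<le> g" "valley b \<theta> s = c" by force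
  thus thesis using that[of s] a by auto
qed

lemma valley_onto_right:
  assumes v: "valley_at g b \<theta>" and c: "valley b \<theta> g \<le> c"
  obtains s where "g \<le> s" "valley b \<theta> s = c"
proof -
  have b: "0 < g" "0 < b" "0 < \<theta>" "\<theta> < 1" using v by (auto simp: valley_at_def)
  have c0: "0 < c" using c valley_pos[OF b(2,1), of \<theta>] by simp
  define a where "a = max g ((c / b) powr (1 / (1 - \<theta>)))"
  have a: "0 < a" "g \<le> a" using b by (auto simp: a_def)
  have "c / b = ((c / b) powr (1 / (1 - \<theta>))) powr (1 - \<theta>)" using b c0 by (simp add: powr_powr)
  also have "\<dots> \<le> a powr (1 - \<theta>)" using a b by (intro powr_mono2) (auto simp: a_def)
  finally have "c \<le> b * a powr (1 - \<theta>)" using b by (simp add: field_simps)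
  also have "\<dots> = a powr (- \<theta>) * (b * a)" using a by (simp add: powr_diff powr_minus field_simps)
  also have "\<dots> \<le> valley b \<theta> a" unfolding valley_def using a by (intro mult_left_mono) auto
  finally have "c \<le> valley b \<theta> a" by simp
  from IVT'[OF c this a(2)] valley_continuous_on[of "{g..a}"] b(1)
  obtain s where "g \<le> s" "s \<le> a" "valley b \<theta> s = c" by force
  thus thesis using that[of s] by auto
qed

section \<open>The two profiles of the Mach number\<close>
definition expo :: "real \<Rightarrow> real" where "expo g = g / (1 + g)"

text \<open>\<^const>\<open>valley\<close> with these parameters is the factor next to a power of the flux in the
  stationary invariant (\<open>invariant_flux_mach\<close>), and \<open>Chi\<close> below the one in \<open>u + \<rho>\<^sup>\<gamma>\<close>
  (\<open>head_flux_mach\<close>).\<close>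
definition Psi :: "real \<Rightarrow> real \<Rightarrow> real" where
  "Psi g = valley (g / (1 + 2 * g)) ((expo g)\<^sup>2)"

definition Chi :: "real \<Rightarrow> real \<Rightarrow> real" where
  "Chi g = valley 1 (expo g)"

lemma expo_bounds: "0 < g \<Longrightarrow> 0 < expo g" "0 < g \<Longrightarrow> expo g < 1" 
  "0 < g \<Longrightarrow> 1 - expo g = 1 / (1 + g)" "0 < g \<Longrightarrow> (1 + g) * expo g = g"
  by (auto simp: expo_def field_simps)

lemma Chi_valley_at: "0 < g \<Longrightarrow> valley_at g 1 (expo g)"
  by (simp add: valley_at_def expo_bounds) (simp add: expo_def)

lemma Psi_valley_at:
  assumes "0 < g" shows "valley_at g (g / (1 + 2 * g)) ((expo g)\<^sup>2)"
proof -
  have "(expo g)\<^sup>2 < 1" using expo_bounds[OF assms] by (simp add: power_less_one_iff abs_square_less_1)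
  moreover have "g / (1 + 2 * g) * (1 - (expo g)\<^sup>2) * g = (expo g)\<^sup>2"
  proof -
    have "1 - (expo g)\<^sup>2 = (1 + 2 * g) / (1 + g)\<^sup>2"
    proof -
      have "1 + g \<noteq> 0" using assms by simp
      hence "((1 + g)\<^sup>2 - g\<^sup>2) / (1 + g)\<^sup>2 = 1 - (expo g)\<^sup>2"
        by (simp add: expo_def power_divide diff_divide_distrib)
      moreover have "(1 + g)\<^sup>2 - g\<^sup>2 = 1 + 2 * g" by (simp add: power2_eq_square algebra_simps)
      ultimately show ?thesis by simp
    qed
    thus ?thesis using assms by (simp add: expo_def power_divide) (simp add: power2_eq_square)
  qed
  ultimately show ?thesis using assms expo_bounds[OF assms] by (simp add: valley_at_def)
qed

lemma Psi_pos: "0 < g \<Longrightarrow> 0 < s \<Longrightarrow> 0 < Psi g s"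
  unfolding Psi_def by (rule valley_pos) auto

lemma Chi_pos: "0 < s \<Longrightarrow> 0 < Chi g s"
  unfolding Chi_def by (rule valley_pos) auto

text \<open>The exponent of the flux in the stationary invariant, \<open>g (1 + 2 g) / (1 + g)\<^sup>2\<close>.\<close>
definition flux_power :: "real \<Rightarrow> real" where "flux_power g = expo g * (1 + expo g)"

text \<open>The factor is the ratio of the logarithmic derivatives of \<^const>\<open>Psi\<close> and
  \<^const>\<open>Chi\<close> at the sonic value, so that the derivative of the difference has a double zero there;
  it equals \<open>g (s - g)\<^sup>2 / ((1 + g)\<^sup>3 s (1 + \<beta> s) (1 + s))\<close>.\<close>
lemma Psi_Chi_increasing:
  assumes g: "0 < g" and xy: "0 < x" "x < y" and side: "y \<le> g \<or> g \<le> x"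
  shows "ln (Psi g x) - flux_power g * ln (Chi g x) < ln (Psi g y) - flux_power g * ln (Chi g y)"
proof -
  define \<alpha> where "\<alpha> = expo g"
  define \<beta> where "\<beta> = g / (1 + 2 * g)"
  define H where "H s = ln (1 + \<beta> * s) - flux_power g * ln (1 + s) + \<alpha> ^ 3 * ln s" for s
  have \<beta>: "0 < \<beta>" using g by (simp add: \<beta>_def)
  have H: "ln (Psi g s) - flux_power g * ln (Chi g s) = H s" if "0 < s" for s
  proof -
    have P: "ln (Psi g s) = ln (1 + \<beta> * s) - \<alpha>\<^sup>2 * ln s"
      using that \<beta> by (simp add: Psi_def valley_def \<alpha>_def[symmetric] \<beta>_def[symmetric] ln_mult_pos ln_powr add_pos_pos)
    have C: "ln (Chi g s) = ln (1 + s) - \<alpha> * ln s"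
      using that by (simp add: Chi_def valley_def \<alpha>_def[symmetric] ln_mult_pos ln_powr)
    show ?thesis unfolding P C H_def flux_power_def \<alpha>_def[symmetric]
      by (simp add: algebra_simps power2_eq_square power3_eq_cube)
  qed
  have d: "(H has_real_derivative g * (s - g)\<^sup>2 / ((1 + g) ^ 3 * s * (1 + \<beta> * s) * (1 + s))) (at s)"
    if s: "0 < s" for s
  proof -
    have "1 + \<beta> * s > 0" using s \<beta> by (simp add: add_pos_pos)
    hence "(H has_real_derivative \<beta> / (1 + \<beta> * s) - flux_power g * (1 / (1 + s)) + \<alpha> ^ 3 * (1 / s)) (at s)"
      unfolding H_def[abs_def] using s by (auto intro!: derivative_eq_intros)
    moreover have "\<beta> / (1 + \<beta> * s) - flux_power g * (1 / (1 + s)) + \<alpha> ^ 3 * (1 / s) =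
       (\<beta> * s * (1 + s) - flux_power g * s * (1 + \<beta> * s) + \<alpha> ^ 3 * (1 + s) * (1 + \<beta> * s)) / (s * (1 + \<beta> * s) * (1 + s))"
      using s \<open>1 + \<beta> * s > 0\<close> by (simp add: divide_simps) (simp add: algebra_simps)
    moreover have "\<beta> * s * (1 + s) - flux_power g * s * (1 + \<beta> * s) + \<alpha> ^ 3 * (1 + s) * (1 + \<beta> * s) =
       g * (s - g)\<^sup>2 / (1 + g) ^ 3"
    proof -
      have pos: "1 + g \<noteq> 0" "1 + 2 * g \<noteq> 0" using g by auto
      have \<alpha>h: "\<alpha> * (1 + g) = g" and \<beta>k: "\<beta> * (1 + 2 * g) = g"
        using pos by (auto simp: \<alpha>_def \<beta>_def expo_def)
      let ?P = "\<beta> * s * (1 + s) - \<alpha> * (1 + \<alpha>) * s * (1 + \<beta> * s) + \<alpha> ^ 3 * (1 + s) * (1 + \<beta> * s)"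
      have "(1 + 2 * g) * (?P * (1 + g) ^ 3) = (\<beta> * (1 + 2 * g)) * s * (1 + s) * (1 + g) ^ 3
         - (\<alpha> * (1 + g)) * (1 + g + \<alpha> * (1 + g)) * (1 + g) * s * (1 + 2 * g + (\<beta> * (1 + 2 * g)) * s)
         + (\<alpha> * (1 + g)) ^ 3 * (1 + s) * (1 + 2 * g + (\<beta> * (1 + 2 * g)) * s)"
        by (simp add: algebra_simps power3_eq_cube)
      also have "\<dots> = (1 + 2 * g) * (g * (s - g)\<^sup>2)"
        unfolding \<alpha>h \<beta>k by (simp add: algebra_simps power2_eq_square power3_eq_cube)
      finally have "?P * (1 + g) ^ 3 = g * (s - g)\<^sup>2" using pos by simp
      thus ?thesis using pos by (simp add: flux_power_def \<alpha>_def[symmetric] nonzero_eq_divide_eq)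
    qed
    ultimately show ?thesis by (simp add: mult.assoc)
  qed
  have "H x < H y"
  proof (rule DERIV_pos_imp_increasing_open[OF xy(2)])
    fix s assume s: "x < s" "s < y"
    have "0 < g * (s - g)\<^sup>2 / ((1 + g) ^ 3 * s * (1 + \<beta> * s) * (1 + s))"
      using s xy side g \<beta> by (intro divide_pos_pos mult_pos_pos) (auto simp: add_pos_pos)
    thus "\<exists>d. (H has_real_derivative d) (at s) \<and> 0 < d" using d[of s] s xy by auto
  next
    show "continuous_on {x..y} H"
      using DERIV_isCont[OF d] xy by (intro continuous_at_imp_continuous_on) auto
  qed
  thus ?thesis using H xy by simp
qed

section \<open>Flux and Mach number as coordinates of a state\<close>
definition flux :: "state \<Rightarrow> real" where "flux U = dens U * vel U"
definition mach :: "real \<Rightarrow> state \<Rightarrow> real" where "mach g U = vel U / dens U powr g"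
definition head :: "real \<Rightarrow> state \<Rightarrow> real" where "head g U = vel U + dens U powr g"
definition positive :: "state \<Rightarrow> bool" where
  "positive U \<longleftrightarrow> 0 < vel U \<and> 0 < dens U \<and> 0 < width U"
definition of_flux_mach :: "real \<Rightarrow> real \<Rightarrow> real \<Rightarrow> real \<Rightarrow> state" where
  "of_flux_mach g a m s = (m powr expo g * s powr (1 / (1 + g)), (m / s) powr (1 / (1 + g)), a)"

lemma state_eqI: "vel U = vel V \<Longrightarrow> dens U = dens V \<Longrightarrow> width U = width V \<Longrightarrow> U = V"
  by (cases U, cases V) (simp add: vel_def dens_def width_def)

lemma positive_physical: "positive U \<Longrightarrow> physical U"
  by (simp add: positive_def physical_def)

lemma positive_pos: "positive U \<Longrightarrow> 0 < flux U" "positive U \<Longrightarrow> 0 < mach g U" "positive U \<Longrightarrow> 0 < head g U"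
  by (auto simp: positive_def flux_def mach_def head_def add_pos_pos)

lemma dens_flux_mach:
  assumes "0 < g" "positive U"
  shows "dens U = (flux U / mach g U) powr (1 / (1 + g))"
proof -
  have "flux U / mach g U = dens U * dens U powr g"
    using assms by (simp add: flux_def mach_def positive_def)
  also have "\<dots> = dens U powr (1 + g)" using assms by (simp add: powr_add positive_def)
  finally show ?thesis using assms by (simp add: powr_powr positive_def)
qed

lemma vel_flux_mach:
  assumes "0 < g" "positive U"
  shows "vel U = flux U powr expo g * mach g U powr (1 / (1 + g))"
proof -
  have "flux U powr expo g * mach g U powr (1 / (1 + g)) =
     (dens U powr expo g * vel U powr expo g) * (vel U powr (1 / (1 + g)) * dens U powr (- expo g))"
    using assms by (simp add: flux_def mach_def positive_def powr_mult powr_divide powr_powr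
        powr_minus_divide expo_def)
  also have "\<dots> = vel U powr (expo g + 1 / (1 + g))"
    using assms by (simp add: positive_def powr_add powr_minus)
  also have "expo g + 1 / (1 + g) = 1" using expo_bounds(3)[OF assms(1)] by simp
  finally show ?thesis using assms by (simp add: positive_def)
qed

lemma pressure_flux_mach:
  assumes "0 < g" "positive U"
  shows "dens U powr g = (flux U / mach g U) powr expo g"
proof -
  have "dens U powr g = ((flux U / mach g U) powr (1 / (1 + g))) powr g"
    using dens_flux_mach[OF assms] by simp
  thus ?thesis by (simp add: powr_powr expo_def)
qed

lemma head_flux_mach:
  assumes "0 < g" "positive U"
  shows "head g U = flux U powr expo g * Chi g (mach g U)"
proof -
  have "head g U = dens U powr g * (1 + mach g U)"
    using assms by (simp add: head_def mach_def positive_def field_simps)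
  also have "\<dots> = (flux U / mach g U) powr expo g * (1 + mach g U)"
    using pressure_flux_mach[OF assms] by simp
  finally show ?thesis using positive_pos[OF assms(2)]
    by (simp add: Chi_def valley_def powr_divide powr_minus field_simps)
qed

lemma invariant_flux_mach:
  assumes "0 < g" "positive U"
  shows "stationary_invariant g (plane_point U) = flux U powr flux_power g * Psi g (mach g U)"
proof -
  define \<alpha> where "\<alpha> = expo g"
  have "(1 + g) * \<alpha> = g" using expo_bounds(4)[OF assms(1)] by (simp add: \<alpha>_def)
  hence "\<alpha> + g * \<alpha> = g" by (simp add: algebra_simps)
  moreover have "g * \<alpha>\<^sup>2 + \<alpha> * (1 + \<alpha>) = \<alpha> + (\<alpha> + g * \<alpha>) * \<alpha>"
    by (simp add: algebra_simps power2_eq_square)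
  ultimately have a2: "g * \<alpha>\<^sup>2 + \<alpha> * (1 + \<alpha>) = g" by simp
  have a: "\<alpha> + \<alpha>\<^sup>2 = flux_power g" "g * \<alpha>\<^sup>2 + flux_power g = g"
    using a2 by (simp_all add: flux_power_def \<alpha>_def[symmetric] algebra_simps power2_eq_square)
  have p: "0 < vel U" "0 < dens U" using assms by (auto simp: positive_def)
  have "stationary_invariant g (plane_point U) =
     vel U powr \<alpha> * dens U powr g * (1 + g / (1 + 2 * g) * mach g U)"
  proof -
    have "dens U powr g * mach g U = vel U" using p by (simp add: mach_def)
    hence "dens U powr g + g / (1 + 2 * g) * vel U = dens U powr g * (1 + g / (1 + 2 * g) * mach g U)"
      by (simp add: distrib_left mult.left_commute)
    thus ?thesis by (simp add: stationary_invariant_def plane_point_def \<alpha>_def expo_def mult.assoc)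
  qed
  moreover have "flux U powr flux_power g * mach g U powr (- \<alpha>\<^sup>2) = vel U powr \<alpha> * dens U powr g"
  proof -
    have m: "mach g U powr (- \<alpha>\<^sup>2) = vel U powr (- \<alpha>\<^sup>2) * dens U powr (g * \<alpha>\<^sup>2)"
      using p by (simp add: mach_def powr_divide powr_powr powr_minus) (simp add: divide_inverse mult.commute)
    have v: "vel U powr flux_power g * vel U powr (- \<alpha>\<^sup>2) = vel U powr \<alpha>"
      by (simp add: powr_add[symmetric] a(1)[symmetric])
    have d: "dens U powr (g * \<alpha>\<^sup>2) * dens U powr flux_power g = dens U powr g"
      by (simp add: powr_add[symmetric] a(2))
    have "flux U powr flux_power g * mach g U powr (- \<alpha>\<^sup>2) =
      (vel U powr flux_power g * vel U powr (- \<alpha>\<^sup>2)) * (dens U powr (g * \<alpha>\<^sup>2) * dens U powr flux_power g)"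
      unfolding flux_def m powr_mult by (simp only: mult_ac)
    thus ?thesis unfolding v d .
  qed
  ultimately show ?thesis by (simp add: Psi_def valley_def \<alpha>_def[symmetric] mult.assoc[symmetric])
qed

lemma of_flux_mach:
  assumes "0 < g" "0 < a" "0 < m" "0 < s"
  shows "positive (of_flux_mach g a m s)" "flux (of_flux_mach g a m s) = m"
    "mach g (of_flux_mach g a m s) = s" "width (of_flux_mach g a m s) = a"
proof -
  let ?U = "of_flux_mach g a m s"
  have e: "vel ?U = m powr expo g * s powr (1 / (1 + g))" "dens ?U = (m / s) powr (1 / (1 + g))"
     "width ?U = a" by (auto simp: of_flux_mach_def vel_def dens_def width_def)
  show "positive ?U" "width ?U = a" using assms e by (auto simp: positive_def)
  have s: "expo g + 1 / (1 + g) = 1" using expo_bounds(3)[OF assms(1)] by simp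
  have "flux ?U = m powr (1 / (1 + g)) * m powr expo g"
    using assms by (simp add: flux_def e powr_divide)
  also have "\<dots> = m" using assms s by (simp add: powr_add[symmetric] add.commute)
  finally show "flux ?U = m" .
  have "dens ?U powr g = (m / s) powr expo g" by (simp add: e powr_powr expo_def)
  hence "mach g ?U = s powr (1 / (1 + g)) * s powr expo g"
    using assms by (simp add: mach_def e powr_divide)
  also have "\<dots> = s" using assms s by (simp add: powr_add[symmetric] add.commute)
  finally show "mach g ?U = s" .
qed

lemma positive_state_eqI:
  assumes "0 < g" "positive U" "positive V" "width U = width V" "flux U = flux V" "mach g U = mach g V"
  shows "U = V"
  using assms vel_flux_mach[OF assms(1)] dens_flux_mach[OF assms(1)] by (intro state_eqI) metis+

lemma regions_mach:
  assumes "0 < width U"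
  shows "plane_point U \<in> D1 g \<longleftrightarrow> positive U \<and> mach g U < g"
    "plane_point U \<in> D2 g \<longleftrightarrow> positive U \<and> g < mach g U"
    "plane_point U \<in> Gamma_plus g \<longleftrightarrow> positive U \<and> mach g U = g"
  using assms by (auto simp: D1_def D2_def Gamma_plus_def plane_point_def positive_def mach_def field_simps)


section \<open>Stationary waves\<close>
lemma closure_D1_below:
  assumes "0 < g" "(u, \<rho>) \<in> closure (D1 g)"
  shows "u \<le> g * \<rho> powr g"
proof -
  obtain z where z: "\<forall>n. z n \<in> D1 g" "z \<longlonglongrightarrow> (u, \<rho>)"
    using assms(2) by (auto simp: closure_sequential)
  have u: "(\<lambda>n. fst (z n)) \<longlonglongrightarrow> u" and r: "(\<lambda>n. snd (z n)) \<longlonglongrightarrow> \<rho>"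
    using tendsto_fst[OF z(2)] tendsto_snd[OF z(2)] by auto
  have D: "0 < snd (z n)" "fst (z n) \<le> g * snd (z n) powr g" for n
    using z(1)[rule_format, of n] by (auto simp: D1_def)
  have "(\<lambda>n. g * snd (z n) powr g) \<longlonglongrightarrow> g * \<rho> powr g"
    by (intro tendsto_mult_left tendsto_powr'[OF r tendsto_const])
       (use assms(1) D in \<open>auto intro: less_imp_le always_eventually\<close>)
  from LIMSEQ_le[OF u this] D show "u \<le> g * \<rho> powr g" by auto
qed

lemma closure_D2_above:
  assumes "0 < g" "(u, \<rho>) \<in> closure (D2 g)"
  shows "g * \<rho> powr g \<le> u"
proof -
  obtain z where z: "\<forall>n. z n \<in> D2 g" "z \<longlonglongrightarrow> (u, \<rho>)"
    using assms(2) by (auto simp: closure_sequential)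
  have u: "(\<lambda>n. fst (z n)) \<longlonglongrightarrow> u" and r: "(\<lambda>n. snd (z n)) \<longlonglongrightarrow> \<rho>"
    using tendsto_fst[OF z(2)] tendsto_snd[OF z(2)] by auto
  have D: "0 < snd (z n)" "g * snd (z n) powr g \<le> fst (z n)" for n
    using z(1)[rule_format, of n] by (auto simp: D2_def)
  have "(\<lambda>n. g * snd (z n) powr g) \<longlonglongrightarrow> g * \<rho> powr g"
    by (intro tendsto_mult_left tendsto_powr'[OF r tendsto_const])
       (use assms(1) D in \<open>auto intro: less_imp_le always_eventually\<close>)
  from LIMSEQ_le[OF this u] D show ?thesis by auto
qed

lemma below_in_closure_D1:
  assumes "0 < g" "0 < u" "0 < \<rho>" "u \<le> g * \<rho> powr g"
  shows "(u, \<rho>) \<in> closure (D1 g)"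
  unfolding closure_sequential
proof (intro exI conjI allI)
  fix n
  have "\<rho> powr g < (\<rho> + 1 / real (Suc n)) powr g" using assms by (intro powr_less_mono2) auto
  hence "g * \<rho> powr g < g * (\<rho> + 1 / real (Suc n)) powr g" using assms(1) by simp
  hence "u < g * (\<rho> + 1 / real (Suc n)) powr g" using assms(4) by linarith
  thus "(u, \<rho> + 1 / real (Suc n)) \<in> D1 g" using assms by (auto simp: D1_def intro: add_pos_pos)
next
  have "(\<lambda>n. \<rho> + 1 / real (Suc n)) \<longlonglongrightarrow> \<rho> + 0"
    by (intro tendsto_add tendsto_const LIMSEQ_Suc[OF lim_1_over_n])
  thus "(\<lambda>n. (u, \<rho> + 1 / real (Suc n))) \<longlonglongrightarrow> (u, \<rho>)" by (intro tendsto_Pair) auto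
qed

lemma above_in_closure_D2:
  assumes "0 < g" "0 < u" "0 < \<rho>" "g * \<rho> powr g \<le> u"
  shows "(u, \<rho>) \<in> closure (D2 g)"
  unfolding closure_sequential
proof (intro exI conjI allI)
  fix n
  have "0 < 1 / real (Suc n)" by simp
  hence "g * \<rho> powr g < u + 1 / real (Suc n)" using assms(4) by linarith
  thus "(u + 1 / real (Suc n), \<rho>) \<in> D2 g" using assms by (auto simp: D2_def intro: add_pos_pos)
next
  have "(\<lambda>n. u + 1 / real (Suc n)) \<longlonglongrightarrow> u + 0"
    by (intro tendsto_add tendsto_const LIMSEQ_Suc[OF lim_1_over_n])
  thus "(\<lambda>n. (u + 1 / real (Suc n), \<rho>)) \<longlonglongrightarrow> (u, \<rho>)" by (intro tendsto_Pair) auto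
qed

lemma stationary_invariant_less:
  assumes "0 < g" "0 \<le> u" "u < u'" "0 < \<rho>" "\<rho> \<le> \<rho>'"
  shows "stationary_invariant g (u, \<rho>) < stationary_invariant g (u', \<rho>')"
proof -
  have "u powr (g / (1 + g)) < u' powr (g / (1 + g))" using assms by (intro powr_less_mono2) auto
  moreover have "\<rho> powr g + g / (1 + 2 * g) * u \<le> \<rho>' powr g + g / (1 + 2 * g) * u'"
    using assms by (intro add_mono powr_mono2 mult_left_mono) auto
  moreover have "0 < \<rho> powr g + g / (1 + 2 * g) * u" using assms by (intro add_pos_nonneg) auto
  ultimately show ?thesis unfolding stationary_invariant_def
    by (auto intro!: mult_less_le_imp_less)
qed

lemma mach_le_iff:
  assumes "positive U"
  shows "mach g U \<le> g \<longleftrightarrow> vel U \<le> g * dens U powr g" "g \<le> mach g U \<longleftrightarrow> g * dens U powr g \<le> vel U"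
  using assms by (auto simp: mach_def positive_def field_simps)

text \<open>The invariant increases in \<open>u\<close> and in \<open>\<rho>\<close>, so along its level curve \<open>u\<close> decreases as \<open>\<rho>\<close>
  grows. A point of the arc on the wrong side of \<open>\<Gamma>\<^sub>+\<close> would exceed in both variables (for \<open>D\<^sub>1\<close>), or
  stay below in both (for \<open>D\<^sub>2\<close>), one of the end points.\<close>
lemma stationary_arc_side:
  assumes g: "0 < g" and pos: "positive U" "positive V"
    and inv: "stationary_invariant g (plane_point U) = stationary_invariant g (plane_point V)"
  shows "stationary_arc g V U \<subseteq> closure (D1 g) \<longleftrightarrow> mach g U \<le> g \<and> mach g V \<le> g"
    "stationary_arc g V U \<subseteq> closure (D2 g) \<longleftrightarrow> g \<le> mach g U \<and> g \<le> mach g V"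
proof -
  have p: "0 < vel U" "0 < dens U" "0 < vel V" "0 < dens V" using pos by (auto simp: positive_def)
  have ends: "(vel U, dens U) \<in> stationary_arc g V U" "(vel V, dens V) \<in> stationary_arc g V U"
    using p inv by (auto simp: stationary_arc_def plane_point_def)
  have arc: "0 < \<rho>" "0 < u" "min (dens U) (dens V) \<le> \<rho>" "\<rho> \<le> max (dens U) (dens V)"
    "stationary_invariant g (u, \<rho>) = stationary_invariant g (vel U, dens U)"
    "stationary_invariant g (u, \<rho>) = stationary_invariant g (vel V, dens V)"
    if "(u, \<rho>) \<in> stationary_arc g V U" for u \<rho>
  proof -
    show r: "min (dens U) (dens V) \<le> \<rho>" "\<rho> \<le> max (dens U) (dens V)"
      using that by (auto simp: stationary_arc_def closed_segment_eq_real_ivl split: if_splits)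
    thus r0: "0 < \<rho>" using p by auto
    show i: "stationary_invariant g (u, \<rho>) = stationary_invariant g (vel U, dens U)"
      "stationary_invariant g (u, \<rho>) = stationary_invariant g (vel V, dens V)"
      using that inv by (auto simp: stationary_arc_def plane_point_def)
    have "0 < stationary_invariant g (vel U, dens U)"
      unfolding stationary_invariant_def using g p by (auto intro!: mult_pos_pos add_pos_pos)
    hence "u \<noteq> 0" using i(1) g by (auto simp: stationary_invariant_def)
    thus "0 < u" using that by (auto simp: stationary_arc_def)
  qed
  have below: "u \<le> g * \<rho> powr g"
    if a: "(u, \<rho>) \<in> stationary_arc g V U" and W: "W \<in> {U, V}" "dens W \<le> \<rho>" "mach g W \<le> g" for u \<rho> W
  proof (rule ccontr)
    assume n: "\<not> u \<le> g * \<rho> powr g"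
    have "vel W \<le> g * dens W powr g" using W pos by (auto simp: mach_le_iff)
    also have "\<dots> \<le> g * \<rho> powr g" using g W p by (intro mult_left_mono powr_mono2) auto
    finally have "stationary_invariant g (vel W, dens W) < stationary_invariant g (u, \<rho>)"
      using n W p g by (intro stationary_invariant_less) auto
    thus False using arc[OF a] W by auto
  qed
  have above: "g * \<rho> powr g \<le> u"
    if a: "(u, \<rho>) \<in> stationary_arc g V U" and W: "W \<in> {U, V}" "\<rho> \<le> dens W" "g \<le> mach g W" for u \<rho> W
  proof (rule ccontr)
    assume n: "\<not> g * \<rho> powr g \<le> u"
    have "g * \<rho> powr g \<le> g * dens W powr g" using g W arc(1)[OF a] by (intro mult_left_mono powr_mono2) auto
    also have "\<dots> \<le> vel W" using W pos by (auto simp: mach_le_iff)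
    finally have "stationary_invariant g (u, \<rho>) < stationary_invariant g (vel W, dens W)"
      using n W p g arc[OF a] by (intro stationary_invariant_less) auto
    thus False using arc[OF a] W by auto
  qed
  show "stationary_arc g V U \<subseteq> closure (D1 g) \<longleftrightarrow> mach g U \<le> g \<and> mach g V \<le> g"
  proof
    assume "stationary_arc g V U \<subseteq> closure (D1 g)"
    thus "mach g U \<le> g \<and> mach g V \<le> g"
      using ends closure_D1_below[OF g] pos by (auto simp: mach_le_iff)
  next
    assume m: "mach g U \<le> g \<and> mach g V \<le> g"
    show "stationary_arc g V U \<subseteq> closure (D1 g)"
    proof clarify
      fix u \<rho> assume a: "(u, \<rho>) \<in> stationary_arc g V U"
      have "u \<le> g * \<rho> powr g"
        using arc(3)[OF a] below[OF a, of U] below[OF a, of V] m by (auto simp: min_le_iff_disj)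
      thus "(u, \<rho>) \<in> closure (D1 g)" using arc[OF a] g by (intro below_in_closure_D1)
    qed
  qed
  show "stationary_arc g V U \<subseteq> closure (D2 g) \<longleftrightarrow> g \<le> mach g U \<and> g \<le> mach g V"
  proof
    assume "stationary_arc g V U \<subseteq> closure (D2 g)"
    thus "g \<le> mach g U \<and> g \<le> mach g V"
      using ends closure_D2_above[OF g] pos by (auto simp: mach_le_iff)
  next
    assume m: "g \<le> mach g U \<and> g \<le> mach g V"
    show "stationary_arc g V U \<subseteq> closure (D2 g)"
    proof clarify
      fix u \<rho> assume a: "(u, \<rho>) \<in> stationary_arc g V U"
      have "g * \<rho> powr g \<le> u"
        using arc(4)[OF a] above[OF a, of U] above[OF a, of V] m by (auto simp: le_max_iff_disj)
      thus "(u, \<rho>) \<in> closure (D2 g)" using arc[OF a] g by (intro above_in_closure_D2)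
    qed
  qed
qed

lemma is_stationary_iff:
  assumes g: "0 < g" and U: "positive U"
  shows "is_stationary g V U \<longleftrightarrow> positive V \<and> width U * flux U = width V * flux V \<and>
     Psi g (mach g V) = (width V / width U) powr flux_power g * Psi g (mach g U) \<and>
     (mach g U \<le> g \<and> mach g V \<le> g \<or> g \<le> mach g U \<and> g \<le> mach g V)"
proof -
  have V: "positive V" if "is_stationary g V U"
  proof -
    have "width U * dens U * vel U = width V * dens V * vel V" "physical V"
      using that by (auto simp: is_stationary_def)
    moreover have "0 < width U * dens U * vel U" using U by (simp add: positive_def)
    ultimately show ?thesis
      by (auto simp: positive_def physical_def zero_less_mult_iff order.strict_iff_order)
  qed
  have inv: "stationary_invariant g (plane_point U) = stationary_invariant g (plane_point V) \<longleftrightarrow>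
     Psi g (mach g V) = (width V / width U) powr flux_power g * Psi g (mach g U)"
    if V: "positive V" and m: "width U * flux U = width V * flux V"
  proof -
    have w: "0 < width U" "0 < width V" "0 < flux V" using U V positive_pos by (auto simp: positive_def)
    have f: "flux U = width V / width U * flux V" using m w by (simp add: field_simps)
    have "flux U powr flux_power g = (width V / width U) powr flux_power g * flux V powr flux_power g"
      unfolding f by (rule powr_mult)
    thus ?thesis using w unfolding invariant_flux_mach[OF g U] invariant_flux_mach[OF g V] by auto
  qed
  show ?thesis
  proof (cases "positive V \<and> width U * flux U = width V * flux V")
    case True
    hence p: "physical U" "physical V" and m: "width U * dens U * vel U = width V * dens V * vel V"
      using U by (simp_all add: positive_physical flux_def mult.assoc)
    show ?thesis
    proof (cases "stationary_invariant g (plane_point U) = stationary_invariant g (plane_point V)")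
      case i: True
      show ?thesis
        using stationary_arc_side[OF g U _ i] inv True p m i by (simp add: is_stationary_def)
    next
      case False
      thus ?thesis using inv True by (simp add: is_stationary_def)
    qed
  next
    case False
    hence "\<not> is_stationary g V U" using V by (auto simp: is_stationary_def flux_def mult.assoc)
    thus ?thesis using False by blast
  qed
qed


lemma stationary_facts:
  assumes "0 < g" "positive U" "is_stationary g V U"
  shows "positive V" "flux V = width U / width V * flux U"
    "Psi g (mach g V) = (width V / width U) powr flux_power g * Psi g (mach g U)"
    "mach g U < g \<Longrightarrow> mach g V \<le> g" "g < mach g U \<Longrightarrow> g \<le> mach g V"
  using assms unfolding is_stationary_iff[OF assms(1,2)]
  by (auto simp: positive_def field_simps)

lemma powr_base_less_iff:
  fixes c x y :: real
  assumes "0 < c" "0 < x" "0 < y"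
  shows "x powr c < y powr c \<longleftrightarrow> x < y" "x powr c = y powr c \<longleftrightarrow> x = y"
proof -
  have *: "a < b \<Longrightarrow> a powr c < b powr c" if "0 < a" "0 < b" for a b :: real
    using that assms(1) by (intro powr_less_mono2) auto
  show "x powr c < y powr c \<longleftrightarrow> x < y" "x powr c = y powr c \<longleftrightarrow> x = y"
    using *[OF assms(2,3)] *[OF assms(3,2)] by (cases x y rule: linorder_cases; simp)+
qed

lemma flux_power_pos: "0 < g \<Longrightarrow> 0 < flux_power g"
  using expo_bounds(1)[of g] by (simp add: flux_power_def add_pos_pos)

text \<open>Widening raises \<^const>\<open>Psi\<close> strictly above its minimum, which is attained at the sonic
  value only.\<close>
lemma stationary_off_sonic:
  assumes g: "0 < g" and U: "positive U" and st: "is_stationary g V U"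
    and w: "width U < width V \<or> width U = width V \<and> mach g U \<noteq> g"
  shows "mach g V \<noteq> g"
proof
  assume V: "mach g V = g"
  have wU: "0 < width U" "0 < mach g U" using U positive_pos by (auto simp: positive_def)
  let ?k = "(width V / width U) powr flux_power g"
  have e: "Psi g g = ?k * Psi g (mach g U)" using stationary_facts(3)[OF g U st] V by simp
  have m: "Psi g g \<le> Psi g (mach g U)" "mach g U \<noteq> g \<Longrightarrow> Psi g g < Psi g (mach g U)"
    using valley_min[OF Psi_valley_at[OF g], of "mach g U"] wU unfolding Psi_def by force+
  from w show False
  proof
    assume "width U < width V"
    hence "1 < ?k" using wU flux_power_pos[OF g] by (intro gr_one_powr) auto
    moreover have "0 < Psi g (mach g U)" using Psi_pos[OF g wU(2)] .
    ultimately have "1 * Psi g (mach g U) < ?k * Psi g (mach g U)" by (intro mult_strict_right_mono)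
    thus False using e m by simp
  next
    assume "width U = width V \<and> mach g U \<noteq> g"
    thus False using e m wU by simp
  qed
qed

lemma stationary_unique:
  assumes "0 < g" "positive U" "is_stationary g V U" "is_stationary g W U" "width V = width W"
    and "mach g V \<le> g \<and> mach g W \<le> g \<or> g \<le> mach g V \<and> g \<le> mach g W"
  shows "W = V"
proof (rule positive_state_eqI[OF assms(1)])
  note V = stationary_facts[OF assms(1-3)] and W = stationary_facts[OF assms(1,2,4)]
  show "positive W" "positive V" "width W = width V" using V(1) W(1) assms(5) by auto
  show "flux W = flux V" unfolding V(2) W(2) assms(5) ..
  show "mach g W = mach g V"
  proof (rule valley_inj[OF Psi_valley_at[OF assms(1)]])
    show "0 < mach g W" "0 < mach g V" using V(1) W(1) by (simp_all add: positive_pos)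
    show "mach g W \<le> g \<and> mach g V \<le> g \<or> g \<le> mach g W \<and> g \<le> mach g V" using assms(6) by blast
    have "Psi g (mach g W) = Psi g (mach g V)" unfolding V(3) W(3) assms(5) ..
    thus "valley (g / (1 + 2 * g)) ((expo g)\<^sup>2) (mach g W) = valley (g / (1 + 2 * g)) ((expo g)\<^sup>2) (mach g V)"
      by (simp add: Psi_def)
  qed
qed

lemma stationary_exists:
  assumes g: "0 < g" and U: "positive U" and a: "width U \<le> a"
  shows "mach g U \<le> g \<Longrightarrow> \<exists>V. is_stationary g V U \<and> width V = a \<and> mach g V \<le> g"
    and "g \<le> mach g U \<Longrightarrow> \<exists>V. is_stationary g V U \<and> width V = a \<and> g \<le> mach g V"
proof -
  let ?c = "(a / width U) powr flux_power g * Psi g (mach g U)"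
  have p: "0 < width U" "0 < mach g U" "0 < flux U" using U positive_pos by (auto simp: positive_def)
  have a0: "0 < a" using p a by simp
  have "Psi g g \<le> Psi g (mach g U)"
    using valley_min[OF Psi_valley_at[OF g] p(2)] by (cases "mach g U = g") (auto simp: Psi_def)
  also have "1 * Psi g (mach g U) \<le> ?c"
    using p a flux_power_pos[OF g] Psi_pos[OF g p(2)] by (intro mult_right_mono ge_one_powr_ge_zero) auto
  finally have c: "Psi g g \<le> ?c" by simp
  define V where "V s = of_flux_mach g a (width U / a * flux U) s" for s
  have V: "positive (V s)" "flux (V s) = width U / a * flux U" "mach g (V s) = s" "width (V s) = a"
    if "0 < s" for s
    using of_flux_mach[OF g a0 _ that] p a0 by (auto simp: V_def)
  show "\<exists>V. is_stationary g V U \<and> width V = a \<and> mach g V \<le> g" if "mach g U \<le> g"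
  proof -
    obtain s where "0 < s" "s \<le> g" "Psi g s = ?c"
      using valley_onto_left[OF Psi_valley_at[OF g]] c unfolding Psi_def by blast
    thus ?thesis using V[of s] that a0 by (intro exI[of _ "V s"]) (auto simp: is_stationary_iff[OF g U])
  qed
  show "\<exists>V. is_stationary g V U \<and> width V = a \<and> g \<le> mach g V" if "g \<le> mach g U"
  proof -
    obtain s where "g \<le> s" "Psi g s = ?c"
      using valley_onto_right[OF Psi_valley_at[OF g]] c unfolding Psi_def by blast
    thus ?thesis using V[of s] that a0 g by (intro exI[of _ "V s"]) (auto simp: is_stationary_iff[OF g U])
  qed
qed

section \<open>Shocks and rarefactions\<close>
lemma head_mach:
  assumes "positive U"
  shows "head g U = dens U powr g * (1 + mach g U)" "vel U = head g U * (mach g U / (1 + mach g U))"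
proof -
  show h: "head g U = dens U powr g * (1 + mach g U)"
    using assms by (simp add: head_def mach_def positive_def field_simps)
  have "1 + mach g U \<noteq> 0" using positive_pos(2)[OF assms, of g] by simp
  thus "vel U = head g U * (mach g U / (1 + mach g U))"
    unfolding h using assms by (simp add: mach_def positive_def)
qed

lemma same_head_order:
  assumes g: "0 < g" and pos: "positive U" "positive V" and h: "head g U = head g V"
  shows "vel U < vel V \<longleftrightarrow> mach g U < mach g V" "dens V < dens U \<longleftrightarrow> mach g U < mach g V"
proof -
  have p: "0 < vel U" "0 < dens U" "0 < vel V" "0 < dens V" using pos by (auto simp: positive_def)
  have d: "dens V < dens U \<longleftrightarrow> dens V powr g < dens U powr g"
    using powr_base_less_iff(1)[OF g p(4,2)] by simp
  have v: "vel U < vel V \<longleftrightarrow> dens V powr g < dens U powr g" using h by (auto simp: head_def)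
  have "vel U < vel V \<longleftrightarrow> mach g U < mach g V"
  proof
    assume "vel U < vel V"
    thus "mach g U < mach g V" using p v unfolding mach_def by (intro frac_less2) auto
  next
    assume m: "mach g U < mach g V"
    show "vel U < vel V"
    proof (rule ccontr)
      assume "\<not> vel U < vel V"
      hence "vel V \<le> vel U" "dens U powr g \<le> dens V powr g" using h by (auto simp: head_def)
      hence "mach g V \<le> mach g U" using p unfolding mach_def by (intro frac_le) auto
      thus False using m by simp
    qed
  qed
  thus "vel U < vel V \<longleftrightarrow> mach g U < mach g V" "dens V < dens U \<longleftrightarrow> mach g U < mach g V"
    using d v by auto
qed

lemma same_head_eqI:
  assumes "0 < g" "0 \<le> dens U" "0 \<le> dens V" "head g U = head g V" "vel U = vel V" "width U = width V"
  shows "U = V"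
proof (rule state_eqI)
  have "dens U powr g = dens V powr g" using assms by (simp add: head_def)
  thus "dens U = dens V" using powr_powr_inverse(1)[of _ g] assms by metis
qed (use assms in auto)

lemma same_head_flux:
  assumes "0 < g" "positive U" "positive V" "head g U = head g V"
  shows "flux U < flux V \<longleftrightarrow> Chi g (mach g V) < Chi g (mach g U)"
    "flux U = flux V \<longleftrightarrow> Chi g (mach g V) = Chi g (mach g U)"
proof -
  have p: "0 < flux U" "0 < flux V" "0 < Chi g (mach g U)" "0 < Chi g (mach g V)"
    using assms positive_pos Chi_pos by auto
  have e: "flux U powr expo g * Chi g (mach g U) = flux V powr expo g * Chi g (mach g V)"
    using assms head_flux_mach by metis
  note mono = powr_base_less_iff(1)[OF expo_bounds(1)[OF assms(1)] p(1,2)]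
    and inj = powr_base_less_iff(2)[OF expo_bounds(1)[OF assms(1)] p(1,2)]
  have q: "0 < flux U powr expo g" "0 < flux V powr expo g" using p by auto
  have "flux U powr expo g < flux V powr expo g \<longleftrightarrow> Chi g (mach g V) < Chi g (mach g U)"
    using e p q mult_strict_mono[of "flux U powr expo g" "flux V powr expo g" "Chi g (mach g U)" "Chi g (mach g V)"]
      mult_mono[of "flux V powr expo g" "flux U powr expo g" "Chi g (mach g V)" "Chi g (mach g U)"]
    by (smt (verit) mult_le_cancel_left_pos mult_less_cancel_right_pos)
  thus "flux U < flux V \<longleftrightarrow> Chi g (mach g V) < Chi g (mach g U)" using mono by simp
  have "flux U powr expo g = flux V powr expo g \<longleftrightarrow> Chi g (mach g V) = Chi g (mach g U)"
    using e p q by (metis mult_cancel_left mult_cancel_right less_irrefl)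
  thus "flux U = flux V \<longleftrightarrow> Chi g (mach g V) = Chi g (mach g U)" using inj by simp
qed

lemma curve_state_exists:
  assumes "0 < g" "0 < v" "v < h" "0 < a"
  obtains U where "positive U" "vel U = v" "head g U = h" "width U = a"
proof
  let ?U = "(v, (h - v) powr (1 / g), a)"
  have e: "vel ?U = v" "dens ?U = (h - v) powr (1 / g)" "width ?U = a"
    by (auto simp: vel_def dens_def width_def)
  show "positive ?U" "vel ?U = v" "head g ?U = h" "width ?U = a"
    using assms by (auto simp: e head_def positive_def powr_powr_inverse)
qed

lemma is_shock_iff:
  assumes "0 < g" "positive U" "positive V"
  shows "is_shock g V U \<longleftrightarrow> width V = width U \<and> head g V = head g U \<and> mach g V < mach g U"
proof (cases "head g V = head g U")
  case True
  thus ?thesis using same_head_order[OF assms(1,3,2) True] assms(2,3)[THEN positive_physical]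
    by (simp add: is_shock_def head_def)
qed (simp add: is_shock_def head_def)

lemma is_rarefaction_iff:
  assumes "0 < g" "positive U" "positive V"
  shows "is_rarefaction g V U \<longleftrightarrow> width V = width U \<and> head g V = head g U \<and> mach g U < mach g V"
proof (cases "head g U = head g V")
  case True
  thus ?thesis using same_head_order[OF assms True] assms(2,3)[THEN positive_physical]
    by (simp add: is_rarefaction_def head_def)
qed (simp add: is_rarefaction_def head_def)

lemma shock_speed_flux:
  assumes "is_shock g V U"
  shows "shock_speed g V U = (flux V - flux U) / (dens V - dens U)"
proof -
  have d: "dens V - dens U > 0" and h: "vel V + dens V powr g = vel U + dens U powr g"
    using assms by (auto simp: is_shock_def)
  have "dens U powr g - dens V powr g = vel V - vel U" using h by simp
  hence "shock_speed g V U = (vel V * (dens V - dens U) + dens U * (vel V - vel U)) / (dens V - dens U)"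
    using d unfolding shock_speed_def by (simp add: add_divide_distrib)
  thus ?thesis by (simp add: flux_def algebra_simps)
qed

lemma shock_speed_sign:
  assumes "is_shock g V U"
  shows "shock_speed g V U = 0 \<longleftrightarrow> flux V = flux U" "0 \<le> shock_speed g V U \<longleftrightarrow> flux U \<le> flux V"
    "shock_speed g V U \<le> 0 \<longleftrightarrow> flux V \<le> flux U" 
proof -
  have "0 < dens V - dens U" using assms by (simp add: is_shock_def)
  thus "shock_speed g V U = 0 \<longleftrightarrow> flux V = flux U" "0 \<le> shock_speed g V U \<longleftrightarrow> flux U \<le> flux V"
    "shock_speed g V U \<le> 0 \<longleftrightarrow> flux V \<le> flux U"
    unfolding shock_speed_flux[OF assms] by (simp_all add: zero_le_divide_iff divide_le_0_iff)
qed

lemma shock_speed_le_vel: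
  assumes "0 < g" "is_shock g V U"
  shows "shock_speed g V U \<le> vel V"
proof -
  have "dens U powr g \<le> dens V powr g" using assms by (intro powr_mono2) (auto simp: is_shock_def physical_def)
  hence "dens U * (dens U powr g - dens V powr g) / (dens V - dens U) \<le> 0"
    using assms by (intro divide_nonpos_pos mult_nonneg_nonpos) (auto simp: is_shock_def physical_def)
  thus ?thesis by (simp add: shock_speed_def)
qed

text \<open>The speed of a shock is the difference quotient of flux and density, so it vanishes when
  the flux is kept; as \<open>u + \<rho>\<^sup>\<gamma>\<close> is kept too, so is \<^const>\<open>Chi\<close> of the Mach number.\<close>
lemma zero_speed_shock_iff:
  assumes g: "0 < g" and U: "positive U"
  shows "zero_speed_shock g V U \<longleftrightarrow> positive V \<and> width V = width U \<and> flux V = flux U \<and>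
    Chi g (mach g V) = Chi g (mach g U) \<and> mach g V < mach g U"
proof
  assume "zero_speed_shock g V U"
  hence s: "is_shock g V U" "shock_speed g V U = 0" by (auto simp: zero_speed_shock_def shock_curve_def)
  hence f: "flux V = flux U" using shock_speed_sign by blast
  hence "0 < dens V * vel V" using positive_pos(1)[OF U] by (simp add: flux_def)
  hence V: "positive V" using s(1) U
    by (auto simp: positive_def is_shock_def physical_def zero_less_mult_iff)
  thus "positive V \<and> width V = width U \<and> flux V = flux U \<and>
    Chi g (mach g V) = Chi g (mach g U) \<and> mach g V < mach g U"
    using s(1) f is_shock_iff[OF g U V] same_head_flux(2)[OF g V U] by auto
next
  assume a: "positive V \<and> width V = width U \<and> flux V = flux U \<and>
    Chi g (mach g V) = Chi g (mach g U) \<and> mach g V < mach g U"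
  hence "head g V = head g U" using head_flux_mach[OF g] U by metis
  hence "is_shock g V U" using a is_shock_iff[OF g U] by auto
  thus "zero_speed_shock g V U" using a shock_speed_sign(1)
    by (auto simp: zero_speed_shock_def shock_curve_def)
qed

lemma zero_speed_shock_exists:
  assumes g: "0 < g" and U: "positive U" and m: "g < mach g U"
  obtains V where "is_the (\<lambda>V. zero_speed_shock g V U) V" "positive V" "mach g V < g"
proof -
  note v = Chi_valley_at[OF g]
  have c: "Chi g g < Chi g (mach g U)" using valley_min[OF v, of "mach g U"] m g by (simp add: Chi_def)
  then obtain s where s: "0 < s" "s \<le> g" "Chi g s = Chi g (mach g U)"
    using valley_onto_left[OF v, of "Chi g (mach g U)"] by (auto simp: Chi_def)
  hence sg: "s < g" using c by (cases "s = g") auto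
  define V where "V = of_flux_mach g (width U) (flux U) s"
  have V: "positive V" "flux V = flux U" "mach g V = s" "width V = width U"
    unfolding V_def using of_flux_mach[OF g _ _ s(1)] U positive_pos(1)[OF U] by (auto simp: positive_def)
  have z: "zero_speed_shock g V U" using zero_speed_shock_iff[OF g U] V s sg m by auto
  have uniq: "W = V" if "zero_speed_shock g W U" for W
  proof (rule positive_state_eqI[OF g])
    have W: "positive W" "width W = width U" "flux W = flux U" "Chi g (mach g W) = Chi g (mach g U)" 
      "mach g W < mach g U" using that zero_speed_shock_iff[OF g U] by auto
    have "mach g W \<le> g"
    proof (rule ccontr)
      assume "\<not> mach g W \<le> g"
      thus False using valley_increasing[OF v, of "mach g W" "mach g U"] W by (simp add: Chi_def)
    qed
    thus "mach g W = mach g V"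
      using valley_inj[OF v, of "mach g W" s] W V s positive_pos by (auto simp: Chi_def)
    show "positive W" "positive V" "width W = width V" "flux W = flux V" using V W by auto
  qed
  have "is_the (\<lambda>V. zero_speed_shock g V U) V" unfolding is_the_def using z uniq by blast
  thus thesis using that V(1,3) sg by blast
qed

section \<open>Stationary waves combined with shocks\<close>

text \<open>\<open>A\<close> comes from the shock first and \<open>B\<close> from the widening first. Their fluxes agree, so
  their velocities are ordered as their Mach numbers, hence inversely to \<^const>\<open>Psi\<close>. A zero-speed
  shock keeps \<^const>\<open>Chi\<close>, so by \<open>Psi_Chi_increasing\<close> it multiplies \<^const>\<open>Psi\<close> by a factor that
  gets smaller as the Mach number in front of it grows, and that number is larger for \<open>V\<close> than for
  \<open>U\<close>. With \<open>Ut = U\<close> sonic this also covers the degenerate shock at \<open>\<Gamma>\<^sub>+\<close>.\<close>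
lemma stationary_after_shock_slower:
  assumes g: "0 < g" and U: "positive U" and m: "g \<le> mach g U"
    and Ut: "positive Ut" "mach g Ut \<le> g" "width Ut = width U" "flux Ut = flux U" "Chi g (mach g Ut) = Chi g (mach g U)"
    and A: "is_stationary g A Ut" "mach g A \<le> g" "width A = a" "width U < a"
    and V: "is_stationary g V U" "g < mach g V" "width V = a"
    and B: "zero_speed_shock g B V" "mach g B < g"
  shows "vel A < vel B"
proof -
  let ?k = "(a / width U) powr flux_power g"
  have w: "0 < width U" using U by (simp add: positive_def)
  have k: "1 < ?k" using w A(4) flux_power_pos[OF g] by (intro gr_one_powr) auto
  note fA = stationary_facts[OF g Ut(1) A(1)] and fV = stationary_facts[OF g U V(1)]
  have fB: "positive B" "width B = width V" "flux B = flux V" "Chi g (mach g B) = Chi g (mach g V)"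
    using B(1) zero_speed_shock_iff[OF g fV(1)] by auto
  have pos: "0 < mach g U" "0 < mach g Ut" "0 < mach g A" "0 < mach g V" "0 < mach g B"
    using U Ut(1) fA(1) fV(1) fB(1) by (simp_all add: positive_pos)
  have PV: "Psi g (mach g V) = ?k * Psi g (mach g U)" using fV(3) V by simp
  have PA: "Psi g (mach g A) = ?k * Psi g (mach g Ut)" using fA(3) A Ut by simp
  have "1 * Psi g (mach g U) < ?k * Psi g (mach g U)"
    using k Psi_pos[OF g pos(1)] by (intro mult_strict_right_mono)
  hence UV: "mach g U < mach g V"
    using valley_less_iff_right[OF Psi_valley_at[OF g] m, of "mach g V"] PV V(2) by (simp add: Psi_def)
  have "Chi g (mach g U) < Chi g (mach g V)"
    using valley_increasing[OF Chi_valley_at[OF g] m UV] by (simp add: Chi_def)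
  hence "Chi g (mach g Ut) < Chi g (mach g B)" using Ut fB by simp
  hence BU: "mach g B < mach g Ut"
    using valley_less_iff_left[OF Chi_valley_at[OF g], of "mach g Ut" "mach g B"] pos Ut B by (simp add: Chi_def)
  have "ln (Psi g (mach g U)) - flux_power g * ln (Chi g (mach g U)) <
      ln (Psi g (mach g V)) - flux_power g * ln (Chi g (mach g V))"
    using Psi_Chi_increasing[OF g pos(1) UV] m by simp
  moreover have "ln (Psi g (mach g B)) - flux_power g * ln (Chi g (mach g B)) <
      ln (Psi g (mach g Ut)) - flux_power g * ln (Chi g (mach g Ut))"
    using Psi_Chi_increasing[OF g pos(5) BU] Ut by simp
  ultimately have "ln (Psi g (mach g B)) + ln (Psi g (mach g U)) < ln (Psi g (mach g Ut)) + ln (Psi g (mach g V))"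
    using Ut(5) fB(4) by simp
  moreover have "ln (Psi g (mach g V)) = ln ?k + ln (Psi g (mach g U))"
    unfolding PV using k Psi_pos[OF g pos(1)] by (intro ln_mult_pos) auto
  moreover have "ln (Psi g (mach g A)) = ln ?k + ln (Psi g (mach g Ut))"
    unfolding PA using k Psi_pos[OF g pos(2)] by (intro ln_mult_pos) auto
  ultimately have "ln (Psi g (mach g B)) < ln (Psi g (mach g A))" by simp
  hence "Psi g (mach g B) < Psi g (mach g A)" using Psi_pos[OF g] pos by simp
  hence AB: "mach g A < mach g B"
    using valley_less_iff_left[OF Psi_valley_at[OF g], of "mach g B" "mach g A"] pos A B by (simp add: Psi_def)
  have "flux A = flux B" using fA(2) fV(2) fB(3) Ut A V by simp
  moreover have "mach g A powr (1 / (1 + g)) < mach g B powr (1 / (1 + g))"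
    using AB pos g by (intro powr_less_mono2) auto
  moreover have "0 < flux B powr expo g" using positive_pos(1)[OF fB(1)] by simp
  ultimately show ?thesis
    unfolding vel_flux_mach[OF g fA(1)] vel_flux_mach[OF g fB(1)] by simp
qed

text \<open>The velocity behind the stationary wave is a product of powers of its flux and Mach
  number. On the subsonic part of a curve with fixed \<open>u + \<rho>\<^sup>\<gamma>\<close> both grow with the Mach number in
  front of the wave.\<close>
lemma stationary_image_increasing:
  assumes g: "0 < g" and U: "positive U" "positive U'" "width U = width U'" "head g U = head g U'"
    and m: "mach g U < mach g U'" "mach g U' \<le> g"
    and V: "is_stationary g V U" "is_stationary g V' U'" "width V = width V'"
      "mach g V \<le> g" "mach g V' \<le> g"
  shows "vel V < vel V'"
proof -
  note f = stationary_facts[OF g U(1) V(1)] and f' = stationary_facts[OF g U(2) V(2)]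
  have w: "0 < width U" "0 < width V'" using U(1) f'(1) by (simp_all add: positive_def)
  have pos: "0 < mach g U" "0 < mach g U'" "0 < mach g V" "0 < mach g V'" "0 < flux U" 
    using U(1,2) f(1) f'(1) by (simp_all add: positive_pos)
  have "Psi g (mach g U') < Psi g (mach g U)"
    using valley_decreasing[OF Psi_valley_at[OF g] pos(1) m] by (simp add: Psi_def)
  hence "Psi g (mach g V') < Psi g (mach g V)"
    unfolding f(3) f'(3) U(3) V(3) using w U(3) by simp
  hence VV: "mach g V < mach g V'"
    using valley_less_iff_left[OF Psi_valley_at[OF g], of "mach g V'" "mach g V"] pos V by (simp add: Psi_def)
  have "Chi g (mach g U') < Chi g (mach g U)"
    using valley_decreasing[OF Chi_valley_at[OF g] pos(1) m] by (simp add: Chi_def)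
  hence "flux U < flux U'" using same_head_flux(1)[OF g U(1,2,4)] by simp
  hence "flux V < flux V'" unfolding f(2) f'(2) U(3) V(3) using w U(3) by (simp add: divide_strict_right_mono)
  moreover have "0 < flux V" by (rule positive_pos(1)[OF f(1)])
  ultimately show ?thesis
    unfolding vel_flux_mach[OF g f(1)] vel_flux_mach[OF g f'(1)]
    using VV pos g expo_bounds(1)[OF g] by (intro mult_strict_mono powr_less_mono2) auto
qed


text \<open>Prescribing the velocity \<open>v\<close> behind the wave determines the Mach number \<open>T s\<close> behind it as an
  explicit function of the Mach number \<open>s\<close> in front of it; the remaining equation \<open>F s = 0\<close> for the
  invariant is solved by the intermediate value theorem. At \<open>e\<close>, the Mach number of \<open>E\<close>, the
  velocity \<open>v\<close> is too small for the wave, so \<open>F e > 0\<close>; the lower end \<open>b\<close> is chosen with \<open>T b\<close>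
  sonic, where \<^const>\<open>Psi\<close> is minimal, so \<open>F b < 0\<close>.\<close>
lemma stationary_image_onto:
  assumes g: "0 < g" and E: "positive E" "mach g E \<le> g" and a: "width E < a"
    and V: "is_stationary g V E" "width V = a" "mach g V \<le> g"
    and v: "0 < v" "v < vel V"
  obtains U W where "positive U" "width U = width E" "head g U = head g E" "mach g U < mach g E"
    "is_stationary g W U" "width W = a" "mach g W < g" "vel W = v"
proof -
  note f = stationary_facts[OF g E(1) V(1)]
  define \<alpha> where "\<alpha> = expo g"
  define k where "k = (a / width E) powr flux_power g"
  define r where "r = width E / a"
  define h where "h = head g E"
  define T where "T s = (v * Chi g s / (r powr \<alpha> * h)) powr (1 + g)" for s
  define m where "m s = (h / Chi g s) powr (1 / \<alpha>)" for s
  define e where "e = mach g E"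
  have \<alpha>: "0 < \<alpha>" "\<alpha> < 1" "1 - \<alpha> = 1 / (1 + g)" using expo_bounds[OF g] by (auto simp: \<alpha>_def)
  have pos: "0 < width E" "0 < a" "0 < r" "0 < h" "0 < e" "0 < mach g V"
  proof -
    show w: "0 < width E" "0 < a" using E(1) a by (auto simp: positive_def)
    thus "0 < r" by (simp add: r_def)
    show "0 < h" "0 < e" "0 < mach g V" using E(1) f(1) by (simp_all add: h_def e_def positive_pos)
  qed
  have k: "1 \<le> k" unfolding k_def using pos a flux_power_pos[OF g] by (intro ge_one_powr_ge_zero) auto
  define q where "q = r powr \<alpha> * h"
  have q: "0 < q" using pos by (simp add: q_def)
  have Tpos: "0 < T s" if "0 < s" for s
    using Chi_pos[OF that, of g] v q by (simp add: T_def q_def[symmetric])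
  have T_iff: "T s < x \<longleftrightarrow> v * Chi g s < q * x powr (1 / (1 + g))"
     "T s = x \<longleftrightarrow> v * Chi g s = q * x powr (1 / (1 + g))" if "0 < s" "0 < x" for s x
  proof -
    have c: "0 < v * Chi g s / q" using Chi_pos[OF that(1), of g] v q by simp
    have x: "x = (x powr (1 / (1 + g))) powr (1 + g)" using that g by (simp add: powr_powr)
    have x0: "0 < x powr (1 / (1 + g))" using that by simp
    have "T s < x \<longleftrightarrow> v * Chi g s / q < x powr (1 / (1 + g))"
      unfolding T_def q_def[symmetric] by (subst x) (rule powr_base_less_iff(1)[OF _ c x0], use g in simp)
    thus "T s < x \<longleftrightarrow> v * Chi g s < q * x powr (1 / (1 + g))" using q by (simp add: pos_divide_less_eq mult.commute)
    have "T s = x \<longleftrightarrow> v * Chi g s / q = x powr (1 / (1 + g))"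
      unfolding T_def q_def[symmetric] by (subst x) (rule powr_base_less_iff(2)[OF _ c x0], use g in simp)
    thus "T s = x \<longleftrightarrow> v * Chi g s = q * x powr (1 / (1 + g))" using q by (simp add: nonzero_divide_eq_eq mult.commute)
  qed
  have hE: "h = flux E powr \<alpha> * Chi g e" using head_flux_mach[OF g E(1)] by (simp add: h_def \<alpha>_def e_def)
  have Chi_e: "0 < Chi g e" using Chi_pos[OF pos(5)] .
  have Te: "T e < mach g V"
  proof -
    have "flux V powr \<alpha> = r powr \<alpha> * flux E powr \<alpha>"
      unfolding f(2) V(2) r_def[symmetric] by (rule powr_mult)
    hence "vel V * Chi g e = q * mach g V powr (1 / (1 + g))"
      unfolding vel_flux_mach[OF g f(1)] \<alpha>_def[symmetric] q_def hE by simp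
    moreover have "v * Chi g e < vel V * Chi g e" using v Chi_e by simp
    ultimately show ?thesis using T_iff(1)[OF pos(5,6)] by simp
  qed
  define c where "c = q * g powr (1 / (1 + g)) / v"
  have "T e < g" using Te V by simp
  hence "Chi g e < c" using T_iff(1)[OF pos(5) g] v by (simp add: c_def pos_less_divide_eq mult.commute)
  moreover have "Chi g g \<le> Chi g e"
    using valley_min[OF Chi_valley_at[OF g] pos(5)] by (cases "e = g") (auto simp: Chi_def)
  ultimately obtain b where b: "0 < b" "b \<le> g" "Chi g b = c"
    using valley_onto_left[OF Chi_valley_at[OF g], of c] by (auto simp: Chi_def)
  have be: "b < e"
    using \<open>Chi g e < c\<close> b valley_less_iff_left[OF Chi_valley_at[OF g], of e b] pos E
    by (auto simp: Chi_def e_def)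
  have Tb: "T b = g" using T_iff(2)[OF b(1) g] b(3) v by (simp add: c_def)
  define F where "F s = Psi g (T s) - k * Psi g s" for s
  have "F b < 0"
  proof -
    have "Psi g g < Psi g b" using valley_min[OF Psi_valley_at[OF g] b(1)] be E by (auto simp: Psi_def e_def)
    also have "1 * Psi g b \<le> k * Psi g b" using k Psi_pos[OF g b(1)] by (intro mult_right_mono) auto
    finally show ?thesis by (simp add: F_def Tb)
  qed
  moreover have "0 < F e"
  proof -
    have "Psi g (mach g V) < Psi g (T e)"
      using valley_decreasing[OF Psi_valley_at[OF g] Tpos[OF pos(5)] Te V(3)] by (simp add: Psi_def)
    thus ?thesis using f(3) V by (simp add: F_def k_def e_def)
  qed
  moreover have "continuous_on {b..e} F"
  proof -
    have C: "continuous_on {b..e} (Chi g)" unfolding Chi_def using b by (intro valley_continuous_on) auto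
    have T: "continuous_on {b..e} T"
      unfolding T_def q_def[symmetric] using b q v Chi_pos[of _ g]
      by (intro continuous_on_powr continuous_intros C) (auto simp: less_imp_neq[symmetric] Chi_pos)
    have "continuous_on {b..e} (\<lambda>s. Psi g (T s))"
      unfolding Psi_def using b Tpos
      by (intro continuous_on_compose2[OF valley_continuous_on[of "{0<..}"] T]) auto
    moreover have "continuous_on {b..e} (Psi g)" unfolding Psi_def using b by (intro valley_continuous_on) auto
    ultimately show ?thesis unfolding F_def by (intro continuous_intros)
  qed
  ultimately obtain s where s: "b \<le> s" "s \<le> e" "F s = 0"
    using IVT'[of F b 0 e] be by auto
  have s': "b < s" "s < e" using s \<open>F b < 0\<close> \<open>0 < F e\<close> by (auto simp: order.strict_iff_order)
  have s0: "0 < s" using b s by simp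
  have Ts: "T s < g"
  proof -
    have "Chi g s < Chi g b" using valley_decreasing[OF Chi_valley_at[OF g] b(1) s'(1)] s E by (simp add: Chi_def e_def)
    hence "v * Chi g s < v * Chi g b" using v by simp
    also have "\<dots> = q * g powr (1 / (1 + g))" using T_iff(2)[OF b(1) g] Tb by simp
    finally show ?thesis using T_iff(1)[OF s0 g] by simp
  qed
  have ms: "0 < m s" using pos Chi_pos[OF s0, of g] by (simp add: m_def)
  define U where "U = of_flux_mach g (width E) (m s) s"
  define W where "W = of_flux_mach g a (r * m s) (T s)"
  have U: "positive U" "flux U = m s" "mach g U = s" "width U = width E"
    unfolding U_def using of_flux_mach[OF g pos(1) ms s0] by auto
  have W: "positive W" "flux W = r * m s" "mach g W = T s" "width W = a"
    unfolding W_def using of_flux_mach[OF g pos(2) _ Tpos[OF s0]] ms pos by auto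
  have ma: "m s powr \<alpha> * Chi g s = h"
    using \<alpha> pos Chi_pos[OF s0, of g] by (simp add: m_def powr_powr)
  show thesis
  proof (rule that[OF U(1,4)])
    show "head g U = head g E" using head_flux_mach[OF g U(1)] U ma by (simp add: \<alpha>_def h_def)
    show "mach g U < mach g E" using s' U by (simp add: e_def)
    show "width W = a" "mach g W < g" using W Ts by auto
    show "is_stationary g W U"
      unfolding is_stationary_iff[OF g U(1)]
      using U W Ts s E pos \<open>F s = 0\<close> by (auto simp: r_def F_def k_def e_def)
    have "vel W * Chi g s = v * Chi g s"
    proof -
      have "vel W * Chi g s = r powr \<alpha> * (m s powr \<alpha> * Chi g s) * T s powr (1 / (1 + g))"
        unfolding vel_flux_mach[OF g W(1)] W \<alpha>_def[symmetric] using powr_mult[of r "m s" \<alpha>] by simp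
      also have "\<dots> = v * Chi g s" unfolding ma using T_iff(2)[OF s0 Tpos[OF s0]] by (simp add: q_def)
      finally show ?thesis .
    qed
    thus "vel W = v" using Chi_pos[OF s0, of g] by simp
  qed
qed

section \<open>Wave patterns ending in a known state\<close>

text \<open>The part of a wave pattern at speeds \<open>\<xi> \<le> 0\<close>; in all cases of the theorem the remaining
  waves have nonnegative speeds.\<close>
definition leads_to :: "real \<Rightarrow> state \<Rightarrow> wave list \<Rightarrow> state \<Rightarrow> bool" where
  "leads_to g U ws V \<longleftrightarrow> ws \<noteq> [] \<and> left_state (hd ws) = U \<and> right_state (last ws) = V \<and>
     successively (\<lambda>w w'. right_state w = left_state w') ws \<and> (\<forall>w\<in>set ws. admissible g w) \<and>
     successively (\<lambda>w w'. right_speed g w \<le> left_speed g w') ws \<and>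
     right_speed g (last ws) \<le> 0 \<and> (\<exists>w\<in>set ws. \<not> trivial_wave w)"

lemma solved_by_append:
  assumes "0 < g" "leads_to g U ws V" "ws' \<noteq> []" "left_state (hd ws') = V" "right_state (last ws') = U'"
    "successively (\<lambda>w w'. right_state w = left_state w') ws'" "\<forall>w\<in>set ws'. admissible g w"
    "successively (\<lambda>w w'. right_speed g w \<le> left_speed g w') ws'" "0 \<le> left_speed g (hd ws')"
  shows "solved_by g U U' (ws @ ws')"
proof (rule solved_by_admissible_waves[OF assms(1)])
  have l: "ws \<noteq> []" "left_state (hd ws) = U" "right_state (last ws) = V"
     "successively (\<lambda>w w'. right_state w = left_state w') ws" "\<forall>w\<in>set ws. admissible g w"
     "successively (\<lambda>w w'. right_speed g w \<le> left_speed g w') ws"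
     "right_speed g (last ws) \<le> 0" "\<exists>w\<in>set ws. \<not> trivial_wave w"
    using assms(2) unfolding leads_to_def by blast+
  show "ws @ ws' \<noteq> []" "left_state (hd (ws @ ws')) = U" "right_state (last (ws @ ws')) = U'"
    using l(1,2) assms(3,5) by simp_all
  have "right_state (last ws) = left_state (hd ws')" using l(3) assms(4) by simp
  thus "successively (\<lambda>w w'. right_state w = left_state w') (ws @ ws')"
    unfolding successively_append_iff using l(4) assms(6) by blast
  have "right_speed g (last ws) \<le> left_speed g (hd ws')" using l(7) assms(9) by linarith
  thus "successively (\<lambda>w w'. right_speed g w \<le> left_speed g w') (ws @ ws')"
    unfolding successively_append_iff using l(6) assms(8) by blast
  show "\<forall>w\<in>set (ws @ ws'). admissible g w" unfolding set_append using l(5) assms(7) by blast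
  show "\<exists>w\<in>set (ws @ ws'). \<not> trivial_wave w" unfolding set_append using l(8) by blast
qed

lemma solved_by_contact:
  assumes "0 < g" "leads_to g U ws V" "physical V" "physical U'" "width V = width U'" "vel V = vel U'"
  shows "solved_by g U U' (ws @ [Contact U' V])"
  by (rule solved_by_append[OF assms(1,2)]) (use assms in \<open>auto simp: is_contact_def physical_def\<close>)

lemma is_theI: "P x \<Longrightarrow> (\<And>y. P y \<Longrightarrow> y = x) \<Longrightarrow> is_the P x"
  unfolding is_the_def by blast

lemma is_theD: "is_the P x \<Longrightarrow> P x"
  by (simp add: is_the_def)

lemma lambda1_sign:
  assumes "positive U"
  shows "lambda1 g U \<le> 0 \<longleftrightarrow> mach g U \<le> g" "0 \<le> lambda1 g U \<longleftrightarrow> g \<le> mach g U"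
  using mach_le_iff[OF assms] by (auto simp: lambda1_def)

text \<open>The flux, as a function of the state on the shock curve, exceeds its value at \<open>V\<close> until
  the zero-speed shock is reached, so these shocks move to the right.\<close>
lemma solved_by_supersonic_shock:
  assumes g: "0 < g" and ws: "leads_to g U ws V" and V: "positive V" "g < mach g V"
    and Vt: "zero_speed_shock g Vt V" "mach g Vt < g"
    and U': "physical U'" "width U' = width V" "vel Vt < vel U'" "vel U' < vel V"
  shows "\<exists>M. is_the (\<lambda>M. M \<in> shock_curve g V \<and> vel M = vel U') M \<and>
     solved_by g U U' (ws @ [Shock M V, Contact U' M])"
proof -
  have z: "positive Vt" "flux Vt = flux V" "Chi g (mach g Vt) = Chi g (mach g V)" "mach g Vt < mach g V"
    using Vt zero_speed_shock_iff[OF g V(1)] by auto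
  have hVt: "head g Vt = head g V"
    using Vt by (simp add: zero_speed_shock_def shock_curve_def is_shock_def head_def)
  have "0 < vel Vt" "vel V < head g V" using z V by (auto simp: positive_def head_def)
  then obtain M where M: "positive M" "vel M = vel U'" "head g M = head g V" "width M = width V"
    using curve_state_exists[OF g, of "vel U'" "head g V" "width V"] U' V by (auto simp: positive_def)
  have m: "mach g Vt < mach g M" "mach g M < mach g V"
    using same_head_order(1)[OF g z(1) M(1)] same_head_order(1)[OF g M(1) V(1)] M hVt U' by auto
  have sh: "is_shock g M V" using is_shock_iff[OF g V(1) M(1)] M m by simp
  \<comment> \<open>\<open>M\<close> lies between the two states of equal \<^const>\<open>Chi\<close>, on either slope of the valley\<close>
  have "Chi g (mach g M) < Chi g (mach g V)"
  proof (cases "mach g M \<le> g")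
    case True
    thus ?thesis using valley_decreasing[OF Chi_valley_at[OF g] _ m(1)] z positive_pos(2)[OF z(1)]
      by (simp add: Chi_def)
  next
    case False
    thus ?thesis using valley_increasing[OF Chi_valley_at[OF g] _ m(2)] by (simp add: Chi_def)
  qed
  hence "flux V < flux M" using same_head_flux(1)[OF g V(1) M(1)] M by simp
  hence s: "0 \<le> shock_speed g M V" using shock_speed_sign(2)[OF sh] by simp
  have uniq: "W = M" if "W \<in> shock_curve g V" "vel W = vel U'" for W
    by (rule same_head_eqI[OF g]) 
       (use that M V in \<open>simp_all add: shock_curve_def is_shock_def physical_def head_def positive_def\<close>)
  have "is_the (\<lambda>M. M \<in> shock_curve g V \<and> vel M = vel U') M"
    by (rule is_theI) (use sh M(2) in \<open>simp add: shock_curve_def\<close>, blast intro: uniq)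
  moreover have "solved_by g U U' (ws @ [Shock M V, Contact U' M])"
    by (rule solved_by_append[OF g ws])
       (use sh s M U' shock_speed_le_vel[OF g sh] positive_physical in \<open>auto simp: is_contact_def\<close>)
  ultimately show ?thesis by blast
qed

lemma solved_by_supersonic_rarefaction:
  assumes g: "0 < g" and ws: "leads_to g U ws V" and V: "positive V" "g < mach g V"
    and U': "physical U'" "width U' = width V" "vel V < vel U'" "vel U' < head g V"
  shows "\<exists>M. is_the (\<lambda>M. M \<in> rarefaction_curve g V \<and> vel M = vel U') M \<and>
     solved_by g U U' (ws @ [Rarefaction M V, Contact U' M])"
proof -
  obtain M where M: "positive M" "vel M = vel U'" "head g M = head g V" "width M = width V"
    using curve_state_exists[OF g, of "vel U'" "head g V" "width V"] U' V by (auto simp: positive_def)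
  have r: "is_rarefaction g M V"
    using is_rarefaction_iff[OF g V(1) M(1)] same_head_order(1)[OF g V(1) M(1)] M U' by simp
  have s: "0 \<le> lambda1 g V" using lambda1_sign[OF V(1), of g] V(2) by simp
  have l: "lambda1 g M \<le> vel M" using g by (simp add: lambda1_def)
  have uniq: "W = M" if "W \<in> rarefaction_curve g V" "vel W = vel U'" for W
    by (rule same_head_eqI[OF g]) 
       (use that M V in \<open>simp_all add: rarefaction_curve_def is_rarefaction_def physical_def head_def positive_def\<close>)
  have "is_the (\<lambda>M. M \<in> rarefaction_curve g V \<and> vel M = vel U') M"
    by (rule is_theI) (use r M(2) in \<open>simp add: rarefaction_curve_def\<close>, blast intro: uniq)
  moreover have "solved_by g U U' (ws @ [Rarefaction M V, Contact U' M])"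
    by (rule solved_by_append[OF g ws])
       (use r s l M U' positive_physical in \<open>auto simp: is_contact_def\<close>)
  ultimately show ?thesis by blast
qed

lemma solved_by_supersonic_vacuum:
  assumes g: "0 < g" and ws: "leads_to g U ws V" and V: "positive V" "g < mach g V"
    and U': "physical U'" "width U' = width V" "head g V < vel U'"
  shows "solved_by g U U' (ws @ [Rarefaction (head g V, 0, width V) V,
     Vacuum (vel U', 0, width V) (head g V, 0, width V), Contact U' (vel U', 0, width V)])"
proof -
  let ?B = "(head g V, 0, width V)" and ?M = "(vel U', 0, width V)"
  have e: "vel ?B = head g V" "dens ?B = 0" "width ?B = width V" "vel ?M = vel U'" "dens ?M = 0" "width ?M = width V"
    by (simp_all add: vel_def dens_def width_def)
  have p: "0 < vel V" "0 < dens V" "0 < width V" "0 < head g V" "vel V < head g V"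
    using V by (auto simp: positive_def head_def add_pos_pos)
  have r: "is_rarefaction g ?B V"
    using p positive_physical[OF V(1)] by (simp add: is_rarefaction_def physical_def e) (simp add: head_def)
  have v: "is_vacuum ?M ?B" using p U' by (simp add: is_vacuum_def physical_def e)
  have c: "is_contact U' ?M" using U' p by (simp add: is_contact_def physical_def e)
  have l: "lambda1 g ?B = head g V" by (simp add: lambda1_def e)
  have s: "0 \<le> lambda1 g V" using lambda1_sign[OF V(1), of g] V(2) by simp
  show ?thesis
    by (rule solved_by_append[OF g ws]) (use r v c s l e in auto)
qed

lemma stationary_refl: "0 < g \<Longrightarrow> positive U \<Longrightarrow> is_stationary g U U"
  using is_stationary_iff[of g U U] by (auto simp: positive_def)

lemma stationary_subsonic:
  assumes g: "0 < g" and U: "positive U" "mach g U < g" "width U \<le> a"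
  obtains V where "is_the (\<lambda>V. width V = a \<and> is_stationary g V U) V" "positive V" "mach g V < g"
proof -
  obtain V where V: "is_stationary g V U" "width V = a" "mach g V \<le> g"
    using stationary_exists(1)[OF g U(1,3)] U(2) by auto
  have "width U < width V \<or> width U = width V \<and> mach g U \<noteq> g" using U(2,3) V(2) by linarith
  hence "mach g V \<noteq> g" by (rule stationary_off_sonic[OF g U(1) V(1)])
  have uniq: "W = V" if "width W = a \<and> is_stationary g W U" for W
    by (rule stationary_unique[OF g U(1) V(1)])
       (use that stationary_facts(4)[OF g U(1) _ U(2)] V(2,3) in simp_all)
  have "is_the (\<lambda>V. width V = a \<and> is_stationary g V U) V"
    by (rule is_theI[OF _ uniq]) (use V in simp)
  thus thesis by (rule that) (use stationary_facts(1)[OF g U(1) V(1)] V(3) \<open>mach g V \<noteq> g\<close> in auto)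
qed

lemma stationary_supersonic:
  assumes g: "0 < g" and U: "positive U" "g < mach g U" "width U \<le> a"
  obtains V where "is_the (\<lambda>V. width V = a \<and> is_stationary g V U) V" "positive V" "g < mach g V"
proof -
  obtain V where V: "is_stationary g V U" "width V = a" "g \<le> mach g V"
    using stationary_exists(2)[OF g U(1,3)] U(2) by auto
  have "width U < width V \<or> width U = width V \<and> mach g U \<noteq> g" using U(2,3) V(2) by linarith
  hence "mach g V \<noteq> g" by (rule stationary_off_sonic[OF g U(1) V(1)])
  have uniq: "W = V" if "width W = a \<and> is_stationary g W U" for W
    by (rule stationary_unique[OF g U(1) V(1)])
       (use that stationary_facts(5)[OF g U(1) _ U(2)] V(2,3) in simp_all)
  have "is_the (\<lambda>V. width V = a \<and> is_stationary g V U) V"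
    by (rule is_theI[OF _ uniq]) (use V in simp)
  thus thesis by (rule that) (use stationary_facts(1)[OF g U(1) V(1)] V(3) \<open>mach g V \<noteq> g\<close> in auto)
qed

lemma same_head_mach_eqI:
  assumes "0 < g" "positive U" "positive V" "head g U = head g V" "mach g U = mach g V" "width U = width V"
  shows "U = V"
proof (rule same_head_eqI[OF assms(1)])
  show "vel U = vel V"
    unfolding head_mach(2)[OF assms(2), of g] head_mach(2)[OF assms(3), of g] assms(4,5) ..
qed (use assms in \<open>simp_all add: positive_def\<close>)

text \<open>A state on the shock curve may have velocity zero, but then it carries no flux and is not
  joined to any state in \<open>D\<^sub>1\<close>.\<close>
lemma joined_curve_positive:
  assumes g: "0 < g" and m: "(U, V) \<in> joined_curve g a A" and a: "0 < a"
  shows "positive U" "positive V" "mach g V < g" "mach g U \<le> g" "is_stationary g V U" "width V = a" "U \<in> A"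
proof -
  show st: "is_stationary g V U" and w: "width V = a" and "U \<in> A"
    using m by (auto simp: joined_curve_def)
  show V: "positive V" "mach g V < g" using m a regions_mach(1)[of V g] by (auto simp: joined_curve_def)
  have "width U * dens U * vel U = width V * dens V * vel V" "physical U"
    using st by (auto simp: is_stationary_def)
  moreover have "0 < width V * dens V * vel V" using V by (simp add: positive_def)
  ultimately show U: "positive U"
    by (auto simp: positive_def physical_def zero_less_mult_iff order.strict_iff_order)
  show "mach g U \<le> g" using st V(2) is_stationary_iff[OF g U] by auto
qed

lemma joined_curve_unique:
  assumes g: "0 < g" and a: "0 < a"
    and m: "(U, V) \<in> joined_curve g a A" "(U', V') \<in> joined_curve g a A"
    and h: "head g U = head g U'" "width U = width U'" and v: "vel V = vel V'"
  shows "U = U' \<and> V = V'"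
proof -
  note p = joined_curve_positive[OF g m(1) a] and p' = joined_curve_positive[OF g m(2) a]
  have "\<not> mach g U < mach g U'"
    using stationary_image_increasing[OF g p(1) p'(1) h(2,1) _ p'(4) p(5) p'(5)] p(3,6) p'(3,6) v by auto
  moreover have "\<not> mach g U' < mach g U"
    using stationary_image_increasing[OF g p'(1) p(1) h(2,1)[symmetric] _ p(4) p'(5) p(5)] p(3,6) p'(3,6) v by auto
  ultimately have U: "U = U'" using same_head_mach_eqI[OF g p(1) p'(1) h(1) _ h(2)] by simp
  have "V' = V"
    by (rule stationary_unique[OF g p(1) p(5)]) (use U p(3,6) p'(3,5,6) in auto)
  thus ?thesis using U by simp
qed

lemma joined_curve_is_the:
  assumes g: "0 < g" and a: "0 < a" and m: "(U, V) \<in> joined_curve g a A" and v: "vel V = v"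
    and A: "\<And>W. W \<in> A \<Longrightarrow> head g W = h \<and> width W = b"
  shows "is_the (\<lambda>(U0, U0s). (U0, U0s) \<in> joined_curve g a A \<and> vel U0s = v) (U, V)"
  unfolding is_the_def
proof (intro conjI allI impI)
  show "case (U, V) of (U0, U0s) \<Rightarrow> (U0, U0s) \<in> joined_curve g a A \<and> vel U0s = v" using m v by simp
  fix z assume z: "case z of (U0, U0s) \<Rightarrow> (U0, U0s) \<in> joined_curve g a A \<and> vel U0s = v"
  obtain U' V' where [simp]: "z = (U', V')" by (cases z)
  have z': "(U', V') \<in> joined_curve g a A" "vel V' = v" using z by auto
  have "U \<in> A" "U' \<in> A" using m z' by (auto simp: joined_curve_def)
  hence "U = U' \<and> V = V'" using joined_curve_unique[OF g a m z'(1)] A z' v by metis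
  thus "z = (U, V)" by simp
qed

text \<open>In \<open>D\<^sub>1\<close> the flux decreases along the shock curve.\<close>
lemma shock_speed_subsonic:
  assumes g: "0 < g" and U: "positive U" "mach g U \<le> g" and V: "is_shock g V U" "positive V"
  shows "shock_speed g V U \<le> 0"
proof -
  have s: "head g V = head g U" "mach g V < mach g U" using V is_shock_iff[OF g U(1) V(2)] by auto
  have "Chi g (mach g U) < Chi g (mach g V)"
    using valley_decreasing[OF Chi_valley_at[OF g] positive_pos(2)[OF V(2)] s(2) U(2)] by (simp add: Chi_def)
  hence "flux V < flux U" using same_head_flux(1)[OF g V(2) U(1) s(1)] by simp
  thus ?thesis using shock_speed_sign(3)[OF V(1)] by simp
qed

lemma leads_to_shock_stationary:
  assumes "is_shock g V U" "shock_speed g V U \<le> 0" "is_stationary g W V"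
  shows "leads_to g U [Shock V U, Stationary W V] W"
  using assms by (auto simp: leads_to_def trivial_wave_def is_shock_def)

lemma leads_to_rarefaction_stationary:
  assumes "is_rarefaction g V U" "lambda1 g V \<le> 0" "is_stationary g W V"
  shows "leads_to g U [Rarefaction V U, Stationary W V] W"
  using assms by (auto simp: leads_to_def trivial_wave_def is_rarefaction_def)

section \<open>The two cases of the Riemann problem\<close>
lemma riemann_solution_supersonic:
  fixes \<gamma> a0 a1 :: real and Um Up :: state
  assumes "0 < \<gamma>" and "0 < a0" and "a0 < a1"
    and "physical Um" and "width Um = a0"
    and "physical Up" and "width Up = a1"
    and "plane_point Um \<in> D2 \<gamma>"
  shows "\<exists>Ums Utm Utms Utmstar ubar Ubar.
        is_the (\<lambda>U. width U = a1 \<and> plane_point U \<in> D2 \<gamma> \<and> is_stationary \<gamma> U Um) Ums \<and>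
        is_the (\<lambda>U. zero_speed_shock \<gamma> U Um) Utm \<and> plane_point Utm \<in> D1 \<gamma> \<and>
        is_the (\<lambda>U. zero_speed_shock \<gamma> U Ums) Utms \<and> plane_point Utms \<in> D1 \<gamma> \<and>
        is_the (\<lambda>U. width U = a1 \<and> is_stationary \<gamma> U Utm) Utmstar \<and> plane_point Utmstar \<in> D1 \<gamma> \<and>
        ubar = vel Ums + dens Ums powr \<gamma> \<and>
        Ubar = (ubar, 0, a1) \<and>
        (vel Utms < vel Up \<and> vel Up < vel Ums \<longrightarrow>
           (\<exists>Um1. is_the (\<lambda>U. U \<in> shock_curve \<gamma> Ums \<and> vel U = vel Up) Um1 \<and>
              solved_by \<gamma> Um Up [Stationary Ums Um, Shock Um1 Ums, Contact Up Um1])) \<and>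
        (vel Ums < vel Up \<and> vel Up < ubar \<longrightarrow>
           (\<exists>Um2. is_the (\<lambda>U. U \<in> rarefaction_curve \<gamma> Ums \<and> vel U = vel Up) Um2 \<and>
              solved_by \<gamma> Um Up [Stationary Ums Um, Rarefaction Um2 Ums, Contact Up Um2])) \<and>
        (vel Up > ubar \<longrightarrow>
           (let M = (vel Up, 0, a1) in
              solved_by \<gamma> Um Up
                [Stationary Ums Um, Rarefaction Ubar Ums, Vacuum M Ubar, Contact Up M])) \<and>
        (0 < vel Up \<and> vel Up < vel Utmstar \<longrightarrow>
           (\<exists>Um3 Um3star.
              is_the (\<lambda>(U0, U0s).
                 (U0, U0s) \<in> joined_curve \<gamma> a1 {U \<in> shock_curve \<gamma> Um. dens U > dens Utm} \<and>
                 vel U0s = vel Up) (Um3, Um3star) \<and>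
              solved_by \<gamma> Um Up [Shock Um3 Um, Stationary Um3star Um3, Contact Up Um3star])) \<and>
        vel Utmstar < vel Utms \<and>
        (\<exists>U1 Ut1 U2 :: real \<Rightarrow> state.
           (\<forall>a\<in>{a0..a1}.
              is_the (\<lambda>U. width U = a \<and> is_stationary \<gamma> U Um) (U1 a) \<and>
              is_the (\<lambda>U. zero_speed_shock \<gamma> U (U1 a)) (Ut1 a) \<and> plane_point (Ut1 a) \<in> D1 \<gamma> \<and>
              is_the (\<lambda>U. width U = a1 \<and> is_stationary \<gamma> U (Ut1 a)) (U2 a)) \<and>
           (vel Utmstar < vel Up \<and> vel Up < vel Utms \<longrightarrow>
              (\<forall>a\<in>{a0..a1}. vel (U2 a) = vel Up \<longrightarrow>
                 solved_by \<gamma> Um Up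
                   [Stationary (U1 a) Um, Shock (Ut1 a) (U1 a), Stationary (U2 a) (Ut1 a),
                    Contact Up (U2 a)])))"
proof -
  note g = assms(1)
  have w: "0 < width Um" "width Um \<le> a1" and a1: "0 < a1" using assms by auto
  have Um: "positive Um" "\<gamma> < mach \<gamma> Um" using regions_mach(2)[OF w(1), of \<gamma>] assms(8) by auto
  obtain Ums where Ums: "is_the (\<lambda>V. width V = a1 \<and> is_stationary \<gamma> V Um) Ums" "positive Ums" "\<gamma> < mach \<gamma> Ums"
    using stationary_supersonic[OF g Um w(2)] by blast
  hence Ums': "width Ums = a1" "is_stationary \<gamma> Ums Um" by (auto dest: is_theD)
  obtain Utm where Utm: "is_the (\<lambda>V. zero_speed_shock \<gamma> V Um) Utm" "positive Utm" "mach \<gamma> Utm < \<gamma>"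
    using zero_speed_shock_exists[OF g Um] by blast
  obtain Utms where Utms: "is_the (\<lambda>V. zero_speed_shock \<gamma> V Ums) Utms" "positive Utms" "mach \<gamma> Utms < \<gamma>"
    using zero_speed_shock_exists[OF g Ums(2,3)] by blast
  have zUtm: "zero_speed_shock \<gamma> Utm Um" and zUtms: "zero_speed_shock \<gamma> Utms Ums"
    using Utm(1) Utms(1) by (auto dest: is_theD)
  have Utm': "width Utm = width Um" "flux Utm = flux Um" "Chi \<gamma> (mach \<gamma> Utm) = Chi \<gamma> (mach \<gamma> Um)"
      "mach \<gamma> Utm < mach \<gamma> Um"
    using zUtm zero_speed_shock_iff[OF g Um(1)] by auto
  have hUtm: "head \<gamma> Utm = head \<gamma> Um"
    using zUtm by (simp add: zero_speed_shock_def shock_curve_def is_shock_def head_def)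
  have wUtms: "width Utms = a1" using zUtms zero_speed_shock_iff[OF g Ums(2)] Ums' by auto
  have wUtm: "width Utm \<le> a1" using Utm' w by simp
  obtain Utmstar where Us: "is_the (\<lambda>V. width V = a1 \<and> is_stationary \<gamma> V Utm) Utmstar" "positive Utmstar"
      "mach \<gamma> Utmstar < \<gamma>"
    using stationary_subsonic[OF g Utm(2,3) wUtm] by blast
  hence Us': "width Utmstar = a1" "is_stationary \<gamma> Utmstar Utm" by (auto dest: is_theD)
  have pre: "leads_to \<gamma> Um [Stationary Ums Um] Ums"
    using Ums' assms by (auto simp: leads_to_def trivial_wave_def)
  have D1: "plane_point U \<in> D1 \<gamma>" if "positive U" "mach \<gamma> U < \<gamma>" for U
    using that regions_mach(1)[of U \<gamma>] by (simp add: positive_def)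
  have Up: "width Up = width Ums" using Ums' assms by simp

  \<comment> \<open>the states around the three discontinuities of speed zero, the
    shock standing where the width is \<open>a\<close>\<close>
  have "\<forall>a\<in>{a0..a1}. \<exists>V. is_the (\<lambda>U. width U = a \<and> is_stationary \<gamma> U Um) V \<and> positive V \<and> \<gamma> < mach \<gamma> V"
    using stationary_supersonic[OF g Um] assms(5) by (metis atLeastAtMost_iff)
  from bchoice[OF this] obtain U1 where U1:
    "\<And>a. a \<in> {a0..a1} \<Longrightarrow> is_the (\<lambda>U. width U = a \<and> is_stationary \<gamma> U Um) (U1 a)"
    "\<And>a. a \<in> {a0..a1} \<Longrightarrow> positive (U1 a)" "\<And>a. a \<in> {a0..a1} \<Longrightarrow> \<gamma> < mach \<gamma> (U1 a)" by blast
  have "\<forall>a\<in>{a0..a1}. \<exists>V. is_the (\<lambda>U. zero_speed_shock \<gamma> U (U1 a)) V \<and> positive V \<and> mach \<gamma> V < \<gamma>"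
    using zero_speed_shock_exists[OF g U1(2,3)] by metis
  from bchoice[OF this] obtain Ut1 where Ut1:
    "\<And>a. a \<in> {a0..a1} \<Longrightarrow> is_the (\<lambda>U. zero_speed_shock \<gamma> U (U1 a)) (Ut1 a)"
    "\<And>a. a \<in> {a0..a1} \<Longrightarrow> positive (Ut1 a)" "\<And>a. a \<in> {a0..a1} \<Longrightarrow> mach \<gamma> (Ut1 a) < \<gamma>" by blast
  have wU1: "width (U1 a) = a" "is_stationary \<gamma> (U1 a) Um" if "a \<in> {a0..a1}" for a
    using is_theD[OF U1(1)[OF that]] by auto
  have zUt1: "zero_speed_shock \<gamma> (Ut1 a) (U1 a)" if "a \<in> {a0..a1}" for a
    using is_theD[OF Ut1(1)[OF that]] .
  have wUt1: "width (Ut1 a) \<le> a1" if "a \<in> {a0..a1}" for a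
    using zUt1[OF that] zero_speed_shock_iff[OF g U1(2)[OF that]] wU1(1)[OF that] that by auto
  have "\<forall>a\<in>{a0..a1}. \<exists>V. is_the (\<lambda>U. width U = a1 \<and> is_stationary \<gamma> U (Ut1 a)) V \<and> positive V"
    using stationary_subsonic[OF g Ut1(2,3) wUt1] by metis
  from bchoice[OF this] obtain U2 where U2:
    "\<And>a. a \<in> {a0..a1} \<Longrightarrow> is_the (\<lambda>U. width U = a1 \<and> is_stationary \<gamma> U (Ut1 a)) (U2 a)"
    "\<And>a. a \<in> {a0..a1} \<Longrightarrow> positive (U2 a)" by blast
  have U2': "width (U2 a) = a1" "is_stationary \<gamma> (U2 a) (Ut1 a)" if "a \<in> {a0..a1}" for a
    using is_theD[OF U2(1)[OF that]] by auto

  show ?thesis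
  proof (rule exI[of _ Ums], rule exI[of _ Utm], rule exI[of _ Utms], rule exI[of _ Utmstar],
      rule exI[of _ "vel Ums + dens Ums powr \<gamma>"], rule exI[of _ "(vel Ums + dens Ums powr \<gamma>, 0, a1)"],
      intro conjI impI, goal_cases)
    case 1
    have "plane_point Ums \<in> D2 \<gamma>" using Ums regions_mach(2)[of Ums \<gamma>] by (simp add: positive_def)
    thus ?case using Ums(1) by (auto simp: is_the_def)
  next
    case 2 show ?case by (rule Utm(1))
  next
    case 3 show ?case by (rule D1[OF Utm(2,3)])
  next
    case 4 show ?case by (rule Utms(1))
  next
    case 5 show ?case by (rule D1[OF Utms(2,3)])
  next
    case 6 show ?case by (rule Us(1))
  next
    case 7 show ?case by (rule D1[OF Us(2,3)])
  next
    case 10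
    thus ?case
      using solved_by_supersonic_shock[OF g pre Ums(2,3) zUtms Utms(3) assms(6) Up] by simp
  next
    case 11
    thus ?case
      using solved_by_supersonic_rarefaction[OF g pre Ums(2,3) assms(6) Up] by (simp add: head_def)
  next
    case 12
    thus ?case
      using solved_by_supersonic_vacuum[OF g pre Ums(2,3) assms(6) Up] Ums' by (simp add: head_def Let_def)
  next
    case 13
    \<comment> \<open>shock in \<open>a = a0\<close>, then a stationary wave in \<open>D\<^sub>1\<close>;
      the zero-speed shock bounds the curve\<close>
    let ?A = "{U \<in> shock_curve \<gamma> Um. dens U > dens Utm}"
    have lt: "width Utm < a1" using Utm' assms by simp
    have v: "0 < vel Up" "vel Up < vel Utmstar" using 13 by auto
    obtain U W where U: "positive U" "width U = width Utm" "head \<gamma> U = head \<gamma> Utm" "mach \<gamma> U < mach \<gamma> Utm"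
      and W: "is_stationary \<gamma> W U" "width W = a1" "mach \<gamma> W < \<gamma>" "vel W = vel Up"
      using stationary_image_onto[OF g Utm(2) less_imp_le[OF Utm(3)] lt Us'(2,1) less_imp_le[OF Us(3)] v] by blast
    have sh: "is_shock \<gamma> U Um"
      using is_shock_iff[OF g Um(1) U(1)] U Utm' hUtm by simp
    have "dens Utm < dens U" using same_head_order(2)[OF g U(1) Utm(2) U(3)] U(4) by simp
    moreover have pW: "positive W" by (rule stationary_facts(1)[OF g U(1) W(1)])
    ultimately have K: "(U, W) \<in> joined_curve \<gamma> a1 ?A"
      using sh W D1[of W] by (simp add: joined_curve_def shock_curve_def)
    have "is_the (\<lambda>(U0, U0s). (U0, U0s) \<in> joined_curve \<gamma> a1 ?A \<and> vel U0s = vel Up) (U, W)"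
      by (rule joined_curve_is_the[OF g a1 K W(4), of "head \<gamma> Um" "width Um"])
         (auto simp: shock_curve_def is_shock_def head_def)
    moreover have "shock_speed \<gamma> U Um \<le> 0"
    proof -
      have "Chi \<gamma> (mach \<gamma> Utm) < Chi \<gamma> (mach \<gamma> U)"
        using valley_decreasing[OF Chi_valley_at[OF g] positive_pos(2)[OF U(1)] U(4)] Utm(3) by (simp add: Chi_def)
      hence "flux U < flux Utm" using same_head_flux(1)[OF g U(1) Utm(2) U(3)] by simp
      thus ?thesis using shock_speed_sign(3)[OF sh] Utm'(2) by simp
    qed
    hence "solved_by \<gamma> Um Up ([Shock U Um, Stationary W U] @ [Contact Up W])"
      using W pW assms(6,7)
      by (intro solved_by_contact[OF g leads_to_shock_stationary[OF sh _ W(1)]])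
         (auto simp: positive_physical)
    ultimately show ?case by (intro exI[of _ U] exI[of _ W]) simp
  next
    case 14
    show ?case
      by (rule stationary_after_shock_slower[OF g Um(1) less_imp_le[OF Um(2)] Utm(2) less_imp_le[OF Utm(3)]
            Utm'(1-3) Us'(2) less_imp_le[OF Us(3)] Us'(1) _ Ums'(2) Ums(3) Ums'(1) zUtms Utms(3)])
         (use assms in simp)
  next
    case 15
    show ?case
    proof (rule exI[of _ U1], rule exI[of _ Ut1], rule exI[of _ U2], intro conjI ballI impI)
      fix a assume a: "a \<in> {a0..a1}"
      show "is_the (\<lambda>U. width U = a \<and> is_stationary \<gamma> U Um) (U1 a)" by (rule U1(1)[OF a])
      show "is_the (\<lambda>U. zero_speed_shock \<gamma> U (U1 a)) (Ut1 a)" by (rule Ut1(1)[OF a])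
      show "plane_point (Ut1 a) \<in> D1 \<gamma>" by (rule D1[OF Ut1(2,3)[OF a]])
      show "is_the (\<lambda>U. width U = a1 \<and> is_stationary \<gamma> U (Ut1 a)) (U2 a)" by (rule U2(1)[OF a])
      assume v: "vel (U2 a) = vel Up"
      have "leads_to \<gamma> Um [Stationary (U1 a) Um, Shock (Ut1 a) (U1 a), Stationary (U2 a) (Ut1 a)] (U2 a)"
        using zUt1[OF a] wU1(2)[OF a] U2'(2)[OF a]
        by (auto simp: leads_to_def zero_speed_shock_def shock_curve_def is_shock_def trivial_wave_def)
      from solved_by_contact[OF g this positive_physical[OF U2(2)[OF a]] assms(6)]
      show "solved_by \<gamma> Um Up [Stationary (U1 a) Um, Shock (Ut1 a) (U1 a), Stationary (U2 a) (Ut1 a), Contact Up (U2 a)]"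
        using v U2'(1)[OF a] assms(7) by simp
    qed
  qed simp_all
qed

lemma riemann_solution_subsonic:
  fixes \<gamma> a0 a1 :: real and Um Up :: state
  assumes "0 < \<gamma>" and "0 < a0" and "a0 < a1"
    and "physical Um" and "width Um = a0"
    and "physical Up" and "width Up = a1"
    and "plane_point Um \<in> D1 \<gamma>"
  shows "\<exists>UC UCs UCstar UtCs ubar Ubar.
        is_the (\<lambda>U. U \<in> rarefaction_curve \<gamma> Um \<and> plane_point U \<in> Gamma_plus \<gamma>) UC \<and>
        is_the (\<lambda>U. width U = a1 \<and> plane_point U \<in> D2 \<gamma> \<and> is_stationary \<gamma> U UC) UCs \<and>
        is_the (\<lambda>U. width U = a1 \<and> plane_point U \<in> D1 \<gamma> \<and> is_stationary \<gamma> U UC) UCstar \<and>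
        {U. width U = a1 \<and> is_stationary \<gamma> U UC} = {UCs, UCstar} \<and>
        is_the (\<lambda>U. zero_speed_shock \<gamma> U UCs) UtCs \<and>
        ubar = vel UCs + dens UCs powr \<gamma> \<and>
        Ubar = (ubar, 0, a1) \<and>
        (vel UCs < vel Up \<and> vel Up < ubar \<longrightarrow>
           (\<exists>Un1. is_the (\<lambda>U. U \<in> rarefaction_curve \<gamma> UCs \<and> vel U = vel Up) Un1 \<and>
              solved_by \<gamma> Um Up
                [Rarefaction UC Um, Stationary UCs UC, Rarefaction Un1 UCs, Contact Up Un1])) \<and>
        (vel UtCs < vel Up \<and> vel Up < vel UCs \<longrightarrow>
           (\<exists>Un2. is_the (\<lambda>U. U \<in> shock_curve \<gamma> UCs \<and> vel U = vel Up) Un2 \<and>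
              solved_by \<gamma> Um Up
                [Rarefaction UC Um, Stationary UCs UC, Shock Un2 UCs, Contact Up Un2])) \<and>
        (vel Up > ubar \<longrightarrow>
           (let M = (vel Up, 0, a1) in
              solved_by \<gamma> Um Up
                [Rarefaction UC Um, Stationary UCs UC, Rarefaction Ubar UCs, Vacuum M Ubar,
                 Contact Up M])) \<and>
        (let K = joined_curve \<gamma> a1
                   {U \<in> shock_curve \<gamma> Um \<union> rarefaction_curve \<gamma> Um. dens U > dens UC} in
           (0 < vel Up \<and> vel Up < vel Um \<longrightarrow>
              (\<forall>Uk1 Uk1star. (Uk1, Uk1star) \<in> K \<and> vel Uk1star = vel Up \<and>
                  Uk1 \<in> shock_curve \<gamma> Um \<longrightarrow>
                 is_the (\<lambda>(U0, U0s). (U0, U0s) \<in> K \<and> vel U0s = vel Up) (Uk1, Uk1star) \<and>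
                 solved_by \<gamma> Um Up [Shock Uk1 Um, Stationary Uk1star Uk1, Contact Up Uk1star])) \<and>
           (vel Um < vel Up \<and> vel Up < vel UC \<longrightarrow>
              (\<forall>Uk2 Uk2star. (Uk2, Uk2star) \<in> K \<and> vel Uk2star = vel Up \<and>
                  Uk2 \<in> rarefaction_curve \<gamma> Um \<longrightarrow>
                 is_the (\<lambda>(U0, U0s). (U0, U0s) \<in> K \<and> vel U0s = vel Up) (Uk2, Uk2star) \<and>
                 solved_by \<gamma> Um Up
                   [Rarefaction Uk2 Um, Stationary Uk2star Uk2, Contact Up Uk2star])) \<and>
           (\<exists>Umstar.
              is_the (\<lambda>U. width U = a1 \<and> is_stationary \<gamma> U Um) Umstar \<and>
              (0 < vel Up \<and> vel Up < vel Umstar \<longrightarrow>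
                 (\<exists>Uk1 Uk1star.
                    is_the (\<lambda>(U0, U0s). (U0, U0s) \<in> K \<and> vel U0s = vel Up) (Uk1, Uk1star) \<and>
                    Uk1 \<in> shock_curve \<gamma> Um \<and>
                    solved_by \<gamma> Um Up
                      [Shock Uk1 Um, Stationary Uk1star Uk1, Contact Up Uk1star])) \<and>
              (vel Umstar < vel Up \<and> vel Up < vel UCstar \<longrightarrow>
                 (\<exists>Uk2 Uk2star.
                    is_the (\<lambda>(U0, U0s). (U0, U0s) \<in> K \<and> vel U0s = vel Up) (Uk2, Uk2star) \<and>
                    Uk2 \<in> rarefaction_curve \<gamma> Um \<and>
                    solved_by \<gamma> Um Up
                      [Rarefaction Uk2 Um, Stationary Uk2star Uk2, Contact Up Uk2star])))) \<and>
        vel UCstar < vel UtCs \<and>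
        (\<exists>U3 Ut3 U4 :: real \<Rightarrow> state.
           (\<forall>a\<in>{a0..a1}.
              is_the (\<lambda>U. width U = a \<and> plane_point U \<in> closure (D2 \<gamma>) \<and> is_stationary \<gamma> U UC)
                (U3 a) \<and>
              (if a = a0 then U3 a = UC \<and> Ut3 a = UC
               else is_the (\<lambda>U. zero_speed_shock \<gamma> U (U3 a)) (Ut3 a) \<and>
                    plane_point (Ut3 a) \<in> D1 \<gamma>) \<and>
              is_the (\<lambda>U. width U = a1 \<and> plane_point U \<in> D1 \<gamma> \<and> is_stationary \<gamma> U (Ut3 a))
                (U4 a)) \<and>
           (vel UCstar < vel Up \<and> vel Up < vel UtCs \<longrightarrow>
              (\<forall>a\<in>{a0..a1}. vel (U4 a) = vel Up \<longrightarrow>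
                 solved_by \<gamma> Um Up
                   [Rarefaction UC Um, Stationary (U3 a) UC, Shock (Ut3 a) (U3 a),
                    Stationary (U4 a) (Ut3 a), Contact Up (U4 a)])))"
proof -
  note g = assms(1)
  have w: "0 < width Um" "width Um \<le> a1" and a1: "0 < a1" using assms by auto
  have Um: "positive Um" "mach \<gamma> Um < \<gamma>" using regions_mach(1)[OF w(1), of \<gamma>] assms(8) by auto
  have D1_iff: "plane_point U \<in> D1 \<gamma> \<longleftrightarrow> mach \<gamma> U < \<gamma>" and D2_iff: "plane_point U \<in> D2 \<gamma> \<longleftrightarrow> \<gamma> < mach \<gamma> U"
    and closure_D2_iff: "plane_point U \<in> closure (D2 \<gamma>) \<longleftrightarrow> \<gamma> \<le> mach \<gamma> U" if "positive U" for U
    using that regions_mach[of U \<gamma>] mach_le_iff(2)[OF that, of \<gamma>]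
      closure_D2_above[OF g, of "vel U" "dens U"] above_in_closure_D2[OF g, of "vel U" "dens U"]
    by (auto simp: positive_def plane_point_def)

  obtain UC where UC: "positive UC" "width UC = a0" "head \<gamma> UC = head \<gamma> Um" "mach \<gamma> UC = \<gamma>"
  proof -
    have h: "0 < head \<gamma> Um" by (rule positive_pos(3)[OF Um(1)])
    have "0 < head \<gamma> Um * expo \<gamma>" "head \<gamma> Um * expo \<gamma> < head \<gamma> Um"
      using h expo_bounds[OF g] by simp_all
    then obtain U where U: "positive U" "vel U = head \<gamma> Um * expo \<gamma>" "head \<gamma> U = head \<gamma> Um" "width U = a0"
      using curve_state_exists[OF g _ _ assms(2)] by blast
    have "head \<gamma> Um * (mach \<gamma> U / (1 + mach \<gamma> U)) = head \<gamma> Um * expo \<gamma>"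
      using head_mach(2)[OF U(1), of \<gamma>] unfolding U(2,3) by (rule sym)
    hence "mach \<gamma> U / (1 + mach \<gamma> U) = \<gamma> / (1 + \<gamma>)"
      using h unfolding expo_def by (simp only: mult_cancel_left) simp
    hence "mach \<gamma> U = \<gamma>"
      using positive_pos(2)[OF U(1), of \<gamma>] g by (simp add: frac_eq_eq algebra_simps)
    thus thesis using that U by blast
  qed
  have wUC: "width UC \<le> a1" "width UC < a1" using UC(2) assms(3) by auto
  have rUC: "is_rarefaction \<gamma> UC Um" using is_rarefaction_iff[OF g Um(1) UC(1)] UC Um(2) assms(5) by simp
  have lUC: "lambda1 \<gamma> UC \<le> 0" using lambda1_sign(1)[OF UC(1), of \<gamma>] UC(4) by simp
  obtain UCs where UCs: "is_stationary \<gamma> UCs UC" "width UCs = a1" "\<gamma> \<le> mach \<gamma> UCs"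
    using stationary_exists(2)[OF g UC(1) wUC(1)] UC(4) by auto
  obtain UCstar where Us: "is_stationary \<gamma> UCstar UC" "width UCstar = a1" "mach \<gamma> UCstar \<le> \<gamma>"
    using stationary_exists(1)[OF g UC(1) wUC(1)] UC(4) by auto
  have pUCs: "positive UCs" and pUs: "positive UCstar"
    using stationary_facts(1)[OF g UC(1)] UCs(1) Us(1) by auto
  have mUCs: "\<gamma> < mach \<gamma> UCs" using stationary_off_sonic[OF g UC(1) UCs(1)] UCs(2,3) wUC(2) by simp
  have mUs: "mach \<gamma> UCstar < \<gamma>" using stationary_off_sonic[OF g UC(1) Us(1)] Us(2,3) wUC(2) by simp
  have UCs_unique: "W = UCs" if "width W = a1" "is_stationary \<gamma> W UC" "\<gamma> \<le> mach \<gamma> W" for W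
    by (rule stationary_unique[OF g UC(1) UCs(1)]) (use that UCs(2,3) in auto)
  have Us_unique: "W = UCstar" if "width W = a1" "is_stationary \<gamma> W UC" "mach \<gamma> W \<le> \<gamma>" for W
    by (rule stationary_unique[OF g UC(1) Us(1)]) (use that Us(2,3) in auto)
  obtain UtCs where Ut: "is_the (\<lambda>V. zero_speed_shock \<gamma> V UCs) UtCs" "positive UtCs" "mach \<gamma> UtCs < \<gamma>"
    using zero_speed_shock_exists[OF g pUCs mUCs] by blast
  have zUt: "zero_speed_shock \<gamma> UtCs UCs" by (rule is_theD[OF Ut(1)])
  have pre: "leads_to \<gamma> Um [Rarefaction UC Um, Stationary UCs UC] UCs"
    by (rule leads_to_rarefaction_stationary[OF rUC lUC UCs(1)])
  have Up: "width Up = width UCs" using UCs(2) assms(7) by simp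
  have slower: "vel UCstar < vel UtCs"
    by (rule stationary_after_shock_slower[OF g UC(1) _ UC(1) _ refl refl refl Us(1,3,2) wUC(2)
          UCs(1) mUCs UCs(2) zUt Ut(3)]) (use UC(4) in auto)

  define K where "K = joined_curve \<gamma> a1
     {U \<in> shock_curve \<gamma> Um \<union> rarefaction_curve \<gamma> Um. dens U > dens UC}"
  have K_the: "is_the (\<lambda>(U0, U0s). (U0, U0s) \<in> K \<and> vel U0s = vel Up) (U, W)"
    if "(U, W) \<in> K" "vel W = vel Up" for U W
    using that(1) unfolding K_def
    by (rule joined_curve_is_the[OF g a1 _ that(2), of _ _ "head \<gamma> Um" "width Um"])
       (auto simp: shock_curve_def rarefaction_curve_def is_shock_def is_rarefaction_def head_def)
  have K_shock: "solved_by \<gamma> Um Up [Shock U Um, Stationary W U, Contact Up W]"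
    if m: "(U, W) \<in> K" "vel W = vel Up" "U \<in> shock_curve \<gamma> Um" for U W
  proof -
    note p = joined_curve_positive[OF g m(1)[unfolded K_def] a1]
    have sh: "is_shock \<gamma> U Um" using m(3) by (simp add: shock_curve_def)
    have s: "shock_speed \<gamma> U Um \<le> 0"
      by (rule shock_speed_subsonic[OF g Um(1) less_imp_le[OF Um(2)] sh p(1)])
    from solved_by_contact[OF g leads_to_shock_stationary[OF sh s p(5)] positive_physical[OF p(2)] assms(6)]
    show ?thesis using p(6) m(2) assms(7) by simp
  qed
  have K_rarefaction: "solved_by \<gamma> Um Up [Rarefaction U Um, Stationary W U, Contact Up W]"
    if m: "(U, W) \<in> K" "vel W = vel Up" "U \<in> rarefaction_curve \<gamma> Um" for U W
  proof -
    note p = joined_curve_positive[OF g m(1)[unfolded K_def] a1]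
    have r: "is_rarefaction \<gamma> U Um" using m(3) by (simp add: rarefaction_curve_def)
    have s: "lambda1 \<gamma> U \<le> 0" using lambda1_sign(1)[OF p(1)] p(4) by simp
    from solved_by_contact[OF g leads_to_rarefaction_stationary[OF r s p(5)] positive_physical[OF p(2)] assms(6)]
    show ?thesis using p(6) m(2) assms(7) by simp
  qed
  have K_memI: "(U, W) \<in> K"
    if U: "positive U" "head \<gamma> U = head \<gamma> Um" "mach \<gamma> U < \<gamma>" "U \<in> shock_curve \<gamma> Um \<union> rarefaction_curve \<gamma> Um"
      and W: "is_stationary \<gamma> W U" "width W = a1" "mach \<gamma> W < \<gamma>" for U W
  proof -
    have "dens UC < dens U" using same_head_order(2)[OF g U(1) UC(1)] U UC(3,4) by simp
    moreover have "plane_point W \<in> D1 \<gamma>" using D1_iff[OF stationary_facts(1)[OF g U(1) W(1)]] W(3) by simp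
    ultimately show ?thesis using U(4) W(1,2) by (simp add: K_def joined_curve_def)
  qed
  obtain Umstar where Ums: "is_the (\<lambda>V. width V = a1 \<and> is_stationary \<gamma> V Um) Umstar" "positive Umstar"
      "mach \<gamma> Umstar < \<gamma>"
    using stationary_subsonic[OF g Um w(2)] by blast
  have Ums': "width Umstar = a1" "is_stationary \<gamma> Umstar Um" using is_theD[OF Ums(1)] by auto
  have shock_part: "\<exists>U W. (U, W) \<in> K \<and> vel W = vel Up \<and> U \<in> shock_curve \<gamma> Um"
    if v: "0 < vel Up" "vel Up < vel Umstar"
  proof -
    have lt: "width Um < a1" using assms by simp
    obtain U W where U: "positive U" "width U = width Um" "head \<gamma> U = head \<gamma> Um" "mach \<gamma> U < mach \<gamma> Um"
      and W: "is_stationary \<gamma> W U" "width W = a1" "mach \<gamma> W < \<gamma>" "vel W = vel Up"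
      using stationary_image_onto[OF g Um(1) less_imp_le[OF Um(2)] lt Ums'(2,1) less_imp_le[OF Ums(3)] v] by blast
    have "U \<in> shock_curve \<gamma> Um" using is_shock_iff[OF g Um(1) U(1)] U by (simp add: shock_curve_def)
    moreover have "mach \<gamma> U < \<gamma>" using U(4) Um(2) by simp
    ultimately show ?thesis using K_memI[OF U(1,3) _ _ W(1-3)] W(4) by blast
  qed
  have rarefaction_part: "\<exists>U W. (U, W) \<in> K \<and> vel W = vel Up \<and> U \<in> rarefaction_curve \<gamma> Um"
    if v: "vel Umstar < vel Up" "vel Up < vel UCstar"
  proof -
    have v0: "0 < vel Up" using v(1) Ums(2) by (simp add: positive_def)
    have le: "mach \<gamma> UC \<le> \<gamma>" using UC(4) by simp
    obtain U W where U: "positive U" "width U = width UC" "head \<gamma> U = head \<gamma> UC" "mach \<gamma> U < mach \<gamma> UC"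
      and W: "is_stationary \<gamma> W U" "width W = a1" "mach \<gamma> W < \<gamma>" "vel W = vel Up"
      using stationary_image_onto[OF g UC(1) le wUC(2) Us(1,2,3) v0 v(2)] by blast
    have wU: "width U = width Um" "head \<gamma> U = head \<gamma> Um" using U UC assms(5) by auto
    have "\<not> mach \<gamma> U < mach \<gamma> Um"
      using stationary_image_increasing[OF g U(1) Um(1) wU _ less_imp_le[OF Um(2)] W(1) Ums'(2)]
        W(2-4) Ums'(1) Ums(3) v(1) by auto
    moreover have "mach \<gamma> U \<noteq> mach \<gamma> Um"
    proof
      assume "mach \<gamma> U = mach \<gamma> Um"
      hence "U = Um" by (rule same_head_mach_eqI[OF g U(1) Um(1) wU(2) _ wU(1)])
      hence "is_stationary \<gamma> W Um" using W(1) by simp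
      hence "W = Umstar" using Ums(1) W(2) unfolding is_the_def by blast
      thus False using W(4) v(1) by simp
    qed
    ultimately have "U \<in> rarefaction_curve \<gamma> Um"
      using is_rarefaction_iff[OF g Um(1) U(1)] wU by (simp add: rarefaction_curve_def)
    moreover have "mach \<gamma> U < \<gamma>" using U(4) UC(4) by simp
    ultimately show ?thesis using K_memI[OF U(1) wU(2) _ _ W(1-3)] W(4) by blast
  qed

  \<comment> \<open>the states around the three discontinuities of speed zero, the
    shock standing where the width is \<open>a\<close>\<close>
  have "\<forall>a\<in>{a0..a1}. \<exists>V. is_stationary \<gamma> V UC \<and> width V = a \<and> \<gamma> \<le> mach \<gamma> V"
    using stationary_exists(2)[OF g UC(1)] UC(2,4) by auto
  from bchoice[OF this] obtain U3 where U3: "\<And>a. a \<in> {a0..a1} \<Longrightarrow> is_stationary \<gamma> (U3 a) UC"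
    "\<And>a. a \<in> {a0..a1} \<Longrightarrow> width (U3 a) = a" "\<And>a. a \<in> {a0..a1} \<Longrightarrow> \<gamma> \<le> mach \<gamma> (U3 a)" by blast
  have pU3: "positive (U3 a)" if "a \<in> {a0..a1}" for a
    by (rule stationary_facts(1)[OF g UC(1) U3(1)[OF that]])
  have mU3: "\<gamma> < mach \<gamma> (U3 a)" if a: "a \<in> {a0..a1}" "a \<noteq> a0" for a
    using stationary_off_sonic[OF g UC(1) U3(1)[OF a(1)]] U3(2,3)[OF a(1)] UC(2) a by fastforce
  have U3_the: "is_the (\<lambda>U. width U = a \<and> plane_point U \<in> closure (D2 \<gamma>) \<and> is_stationary \<gamma> U UC) (U3 a)"
    if a: "a \<in> {a0..a1}" for a
  proof (rule is_theI)
    show "width (U3 a) = a \<and> plane_point (U3 a) \<in> closure (D2 \<gamma>) \<and> is_stationary \<gamma> (U3 a) UC"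
      using U3[OF a] closure_D2_iff[OF pU3[OF a]] by simp
    fix W assume W: "width W = a \<and> plane_point W \<in> closure (D2 \<gamma>) \<and> is_stationary \<gamma> W UC"
    hence "\<gamma> \<le> mach \<gamma> W" using closure_D2_iff[OF stationary_facts(1)[OF g UC(1)]] by blast
    thus "W = U3 a" using W U3[OF a] by (intro stationary_unique[OF g UC(1) U3(1)[OF a]]) auto
  qed
  have U3_a0: "U3 a0 = UC"
    using stationary_unique[OF g UC(1) U3(1)[of a0] stationary_refl[OF g UC(1)]] U3(2,3)[of a0] UC(2,4) assms(3)
    by simp
  have "\<forall>a\<in>{a0..a1}. \<exists>V. positive V \<and> mach \<gamma> V \<le> \<gamma> \<and> width V = a \<and>
     (if a = a0 then V = UC else is_the (\<lambda>U. zero_speed_shock \<gamma> U (U3 a)) V \<and> mach \<gamma> V < \<gamma>)"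
  proof
    fix a assume a: "a \<in> {a0..a1}"
    show "\<exists>V. positive V \<and> mach \<gamma> V \<le> \<gamma> \<and> width V = a \<and>
     (if a = a0 then V = UC else is_the (\<lambda>U. zero_speed_shock \<gamma> U (U3 a)) V \<and> mach \<gamma> V < \<gamma>)"
    proof (cases "a = a0")
      case True
      thus ?thesis using UC by (intro exI[of _ UC]) simp
    next
      case False
      obtain V where V: "is_the (\<lambda>V. zero_speed_shock \<gamma> V (U3 a)) V" "positive V" "mach \<gamma> V < \<gamma>"
        using zero_speed_shock_exists[OF g pU3[OF a] mU3[OF a False]] by blast
      moreover have "width V = a"
        using is_theD[OF V(1)] zero_speed_shock_iff[OF g pU3[OF a]] U3(2)[OF a] by simp
      ultimately show ?thesis using False by (intro exI[of _ V]) simp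
    qed
  qed
  from bchoice[OF this] obtain Ut3 where Ut3: "\<And>a. a \<in> {a0..a1} \<Longrightarrow> positive (Ut3 a)"
    "\<And>a. a \<in> {a0..a1} \<Longrightarrow> mach \<gamma> (Ut3 a) \<le> \<gamma>" "\<And>a. a \<in> {a0..a1} \<Longrightarrow> width (Ut3 a) = a"
    "\<And>a. a \<in> {a0..a1} \<Longrightarrow> if a = a0 then Ut3 a = UC
       else is_the (\<lambda>U. zero_speed_shock \<gamma> U (U3 a)) (Ut3 a) \<and> mach \<gamma> (Ut3 a) < \<gamma>" by blast
  have "\<forall>a\<in>{a0..a1}. \<exists>V. is_stationary \<gamma> V (Ut3 a) \<and> width V = a1 \<and> mach \<gamma> V \<le> \<gamma>"
    using stationary_exists(1)[OF g Ut3(1) _ Ut3(2)] Ut3(3) by simp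
  from bchoice[OF this] obtain U4 where U4: "\<And>a. a \<in> {a0..a1} \<Longrightarrow> is_stationary \<gamma> (U4 a) (Ut3 a)"
    "\<And>a. a \<in> {a0..a1} \<Longrightarrow> width (U4 a) = a1" "\<And>a. a \<in> {a0..a1} \<Longrightarrow> mach \<gamma> (U4 a) \<le> \<gamma>" by blast
  have pU4: "positive (U4 a)" if "a \<in> {a0..a1}" for a
    by (rule stationary_facts(1)[OF g Ut3(1)[OF that] U4(1)[OF that]])
  have mU4: "mach \<gamma> (U4 a) < \<gamma>" if a: "a \<in> {a0..a1}" for a
  proof -
    have "width (Ut3 a) < width (U4 a) \<or> width (Ut3 a) = width (U4 a) \<and> mach \<gamma> (Ut3 a) \<noteq> \<gamma>"
      using Ut3(3,4)[OF a] U4(2)[OF a] a assms(3) by (cases "a = a1") auto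
    thus ?thesis using stationary_off_sonic[OF g Ut3(1)[OF a] U4(1)[OF a]] U4(3)[OF a] by simp
  qed
  have U4_the: "is_the (\<lambda>U. width U = a1 \<and> plane_point U \<in> D1 \<gamma> \<and> is_stationary \<gamma> U (Ut3 a)) (U4 a)"
    if a: "a \<in> {a0..a1}" for a
  proof (rule is_theI)
    show "width (U4 a) = a1 \<and> plane_point (U4 a) \<in> D1 \<gamma> \<and> is_stationary \<gamma> (U4 a) (Ut3 a)"
      using U4[OF a] D1_iff[OF pU4[OF a]] mU4[OF a] by simp
    fix W assume W: "width W = a1 \<and> plane_point W \<in> D1 \<gamma> \<and> is_stationary \<gamma> W (Ut3 a)"
    hence "mach \<gamma> W < \<gamma>" using D1_iff[OF stationary_facts(1)[OF g Ut3(1)[OF a]]] by blast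
    thus "W = U4 a" using W U4[OF a] by (intro stationary_unique[OF g Ut3(1)[OF a] U4(1)[OF a]]) auto
  qed

  show ?thesis
  proof (rule exI[of _ UC], rule exI[of _ UCs], rule exI[of _ UCstar], rule exI[of _ UtCs],
      rule exI[of _ "vel UCs + dens UCs powr \<gamma>"], rule exI[of _ "(vel UCs + dens UCs powr \<gamma>, 0, a1)"],
      intro conjI impI, goal_cases)
    case 1
    show ?case
    proof (rule is_theI)
      show "UC \<in> rarefaction_curve \<gamma> Um \<and> plane_point UC \<in> Gamma_plus \<gamma>"
        using rUC UC regions_mach(3)[of UC \<gamma>] assms(2) by (simp add: rarefaction_curve_def)
      fix W assume W: "W \<in> rarefaction_curve \<gamma> Um \<and> plane_point W \<in> Gamma_plus \<gamma>"
      hence r: "is_rarefaction \<gamma> W Um" and "0 < width W"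
        by (auto simp: rarefaction_curve_def is_rarefaction_def physical_def)
      hence pW: "positive W" "mach \<gamma> W = \<gamma>" using W regions_mach(3)[of W \<gamma>] by auto
      thus "W = UC"
        using r is_rarefaction_iff[OF g Um(1) pW(1)] UC assms(5)
        by (intro same_head_mach_eqI[OF g pW(1) UC(1)]) auto
    qed
  next
    case 2
    show ?case
    proof (rule is_theI)
      show "width UCs = a1 \<and> plane_point UCs \<in> D2 \<gamma> \<and> is_stationary \<gamma> UCs UC"
        using UCs D2_iff[OF pUCs] mUCs by simp
      fix W assume W: "width W = a1 \<and> plane_point W \<in> D2 \<gamma> \<and> is_stationary \<gamma> W UC"
      hence "\<gamma> < mach \<gamma> W" using D2_iff[OF stationary_facts(1)[OF g UC(1)]] by blast
      thus "W = UCs" using UCs_unique W by simp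
    qed
  next
    case 3
    show ?case
    proof (rule is_theI)
      show "width UCstar = a1 \<and> plane_point UCstar \<in> D1 \<gamma> \<and> is_stationary \<gamma> UCstar UC"
        using Us D1_iff[OF pUs] mUs by simp
      fix W assume W: "width W = a1 \<and> plane_point W \<in> D1 \<gamma> \<and> is_stationary \<gamma> W UC"
      hence "mach \<gamma> W < \<gamma>" using D1_iff[OF stationary_facts(1)[OF g UC(1)]] by blast
      thus "W = UCstar" using Us_unique W by simp
    qed
  next
    case 4
    show ?case
    proof (intro set_eqI iffI)
      fix W assume "W \<in> {U. width U = a1 \<and> is_stationary \<gamma> U UC}"
      hence W: "width W = a1" "is_stationary \<gamma> W UC" by auto
      show "W \<in> {UCs, UCstar}"
        using UCs_unique[OF W] Us_unique[OF W] by (cases "\<gamma> \<le> mach \<gamma> W") auto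
    qed (use UCs Us in auto)
  next
    case 5 show ?case by (rule Ut(1))
  next
    case 8
    thus ?case
      using solved_by_supersonic_rarefaction[OF g pre pUCs mUCs assms(6) Up] by (simp add: head_def)
  next
    case 9
    thus ?case
      using solved_by_supersonic_shock[OF g pre pUCs mUCs zUt Ut(3) assms(6) Up] by simp
  next
    case 10
    thus ?case
      using solved_by_supersonic_vacuum[OF g pre pUCs mUCs assms(6) Up] UCs(2) by (simp add: head_def Let_def)
  next
    case 11
    \<comment> \<open>the stationary wave stays in \<open>D\<^sub>1\<close>, after a shock or a rarefaction\<close>
    show ?case unfolding K_def[symmetric] Let_def
    proof (intro conjI impI allI, goal_cases)
      case (1 U W) thus ?case using K_the by blast
    next
      case (2 U W) thus ?case using K_shock by blast
    next
      case (3 U W) thus ?case using K_the by blast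
    next
      case (4 U W) thus ?case using K_rarefaction by blast
    next
      case 5
      show ?case
      proof (rule exI[of _ Umstar], intro conjI impI, goal_cases)
        case 1 show ?case by (rule Ums(1))
      next
        case 2
        then obtain U W where m: "(U, W) \<in> K" "vel W = vel Up" "U \<in> shock_curve \<gamma> Um"
          using shock_part by blast
        show ?case by (intro exI[of _ U] exI[of _ W] conjI K_the[OF m(1,2)] K_shock[OF m] m(3))
      next
        case 3
        then obtain U W where m: "(U, W) \<in> K" "vel W = vel Up" "U \<in> rarefaction_curve \<gamma> Um"
          using rarefaction_part by blast
        show ?case by (intro exI[of _ U] exI[of _ W] conjI K_the[OF m(1,2)] K_rarefaction[OF m] m(3))
      qed
    qed
  next
    case 12 show ?case by (rule slower)
  next
    case 13
    show ?case
    proof (rule exI[of _ U3], rule exI[of _ Ut3], rule exI[of _ U4], intro conjI ballI impI)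
      fix a assume a: "a \<in> {a0..a1}"
      show "is_the (\<lambda>U. width U = a \<and> plane_point U \<in> closure (D2 \<gamma>) \<and> is_stationary \<gamma> U UC) (U3 a)"
        by (rule U3_the[OF a])
      show "if a = a0 then U3 a = UC \<and> Ut3 a = UC
            else is_the (\<lambda>U. zero_speed_shock \<gamma> U (U3 a)) (Ut3 a) \<and> plane_point (Ut3 a) \<in> D1 \<gamma>"
        using Ut3(4)[OF a] U3_a0 D1_iff[OF Ut3(1)[OF a]] by (cases "a = a0") simp_all
      show "is_the (\<lambda>U. width U = a1 \<and> plane_point U \<in> D1 \<gamma> \<and> is_stationary \<gamma> U (Ut3 a)) (U4 a)"
        by (rule U4_the[OF a])
      assume range: "vel UCstar < vel Up \<and> vel Up < vel UtCs" and v: "vel (U4 a) = vel Up"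
      \<comment> \<open>for \<open>a = a0\<close> the shock degenerates, but then \<open>U4 a = UCstar\<close> lies outside the range\<close>
      have "a \<noteq> a0"
      proof
        assume "a = a0"
        hence "is_stationary \<gamma> (U4 a) UC" using U4(1)[OF a] Ut3(4)[OF a] by simp
        hence "U4 a = UCstar" using Us_unique U4(2,3)[OF a] by blast
        thus False using v range by simp
      qed
      hence z: "zero_speed_shock \<gamma> (Ut3 a) (U3 a)" using is_theD Ut3(4)[OF a] by fastforce
      have "leads_to \<gamma> Um [Rarefaction UC Um, Stationary (U3 a) UC, Shock (Ut3 a) (U3 a),
          Stationary (U4 a) (Ut3 a)] (U4 a)"
        using rUC lUC z U3(1)[OF a] U4(1)[OF a]
        by (auto simp: leads_to_def zero_speed_shock_def shock_curve_def is_shock_def trivial_wave_def)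
      from solved_by_contact[OF g this positive_physical[OF pU4[OF a]] assms(6)]
      show "solved_by \<gamma> Um Up [Rarefaction UC Um, Stationary (U3 a) UC, Shock (Ut3 a) (U3 a),
          Stationary (U4 a) (Ut3 a), Contact Up (U4 a)]"
        using v U4(2)[OF a] assms(7) by simp
    qed
  qed simp_all
qed

theorem mainTheorem1:
  fixes \<gamma> a0 a1 :: real and Um Up :: state
  assumes "0 < \<gamma>" and "0 < a0" and "a0 < a1"
    and "physical Um" and "width Um = a0"
    and "physical Up" and "width Up = a1"
  shows
  \<comment> \<open>Case 1\<close>
  "(plane_point Um \<in> D2 \<gamma> \<longrightarrow>
     (\<exists>Ums Utm Utms Utmstar ubar Ubar.
        is_the (\<lambda>U. width U = a1 \<and> plane_point U \<in> D2 \<gamma> \<and> is_stationary \<gamma> U Um) Ums \<and>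
        is_the (\<lambda>U. zero_speed_shock \<gamma> U Um) Utm \<and> plane_point Utm \<in> D1 \<gamma> \<and>
        is_the (\<lambda>U. zero_speed_shock \<gamma> U Ums) Utms \<and> plane_point Utms \<in> D1 \<gamma> \<and>
        is_the (\<lambda>U. width U = a1 \<and> is_stationary \<gamma> U Utm) Utmstar \<and> plane_point Utmstar \<in> D1 \<gamma> \<and>
        ubar = vel Ums + dens Ums powr \<gamma> \<and>
        Ubar = (ubar, 0, a1) \<and>
        \<comment> \<open>(1.1)\<close>
        (vel Utms < vel Up \<and> vel Up < vel Ums \<longrightarrow>
           (\<exists>Um1. is_the (\<lambda>U. U \<in> shock_curve \<gamma> Ums \<and> vel U = vel Up) Um1 \<and>
              solved_by \<gamma> Um Up [Stationary Ums Um, Shock Um1 Ums, Contact Up Um1])) \<and>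
        \<comment> \<open>(1.2)\<close>
        (vel Ums < vel Up \<and> vel Up < ubar \<longrightarrow>
           (\<exists>Um2. is_the (\<lambda>U. U \<in> rarefaction_curve \<gamma> Ums \<and> vel U = vel Up) Um2 \<and>
              solved_by \<gamma> Um Up [Stationary Ums Um, Rarefaction Um2 Ums, Contact Up Um2])) \<and>
        \<comment> \<open>(1.3)\<close>
        (vel Up > ubar \<longrightarrow>
           (let M = (vel Up, 0, a1) in
              solved_by \<gamma> Um Up
                [Stationary Ums Um, Rarefaction Ubar Ums, Vacuum M Ubar, Contact Up M])) \<and>
        \<comment> \<open>(1.4)\<close>
        (0 < vel Up \<and> vel Up < vel Utmstar \<longrightarrow>
           (\<exists>Um3 Um3star.
              is_the (\<lambda>(U0, U0s).
                 (U0, U0s) \<in> joined_curve \<gamma> a1 {U \<in> shock_curve \<gamma> Um. dens U > dens Utm} \<and>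
                 vel U0s = vel Up) (Um3, Um3star) \<and>
              solved_by \<gamma> Um Up [Shock Um3 Um, Stationary Um3star Um3, Contact Up Um3star])) \<and>
        \<comment> \<open>(1.5)\<close>
        vel Utmstar < vel Utms \<and>
        (\<exists>U1 Ut1 U2 :: real \<Rightarrow> state.
           (\<forall>a\<in>{a0..a1}.
              is_the (\<lambda>U. width U = a \<and> is_stationary \<gamma> U Um) (U1 a) \<and>
              is_the (\<lambda>U. zero_speed_shock \<gamma> U (U1 a)) (Ut1 a) \<and> plane_point (Ut1 a) \<in> D1 \<gamma> \<and>
              is_the (\<lambda>U. width U = a1 \<and> is_stationary \<gamma> U (Ut1 a)) (U2 a)) \<and>
           (vel Utmstar < vel Up \<and> vel Up < vel Utms \<longrightarrow>
              (\<forall>a\<in>{a0..a1}. vel (U2 a) = vel Up \<longrightarrow>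
                 solved_by \<gamma> Um Up
                   [Stationary (U1 a) Um, Shock (Ut1 a) (U1 a), Stationary (U2 a) (Ut1 a),
                    Contact Up (U2 a)])))))
   \<and>
   \<comment> \<open>Case 2\<close>
   (plane_point Um \<in> D1 \<gamma> \<longrightarrow>
     (\<exists>UC UCs UCstar UtCs ubar Ubar.
        is_the (\<lambda>U. U \<in> rarefaction_curve \<gamma> Um \<and> plane_point U \<in> Gamma_plus \<gamma>) UC \<and>
        is_the (\<lambda>U. width U = a1 \<and> plane_point U \<in> D2 \<gamma> \<and> is_stationary \<gamma> U UC) UCs \<and>
        is_the (\<lambda>U. width U = a1 \<and> plane_point U \<in> D1 \<gamma> \<and> is_stationary \<gamma> U UC) UCstar \<and>
        {U. width U = a1 \<and> is_stationary \<gamma> U UC} = {UCs, UCstar} \<and>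
        is_the (\<lambda>U. zero_speed_shock \<gamma> U UCs) UtCs \<and>
        ubar = vel UCs + dens UCs powr \<gamma> \<and>
        Ubar = (ubar, 0, a1) \<and>
        \<comment> \<open>(2.1)\<close>
        (vel UCs < vel Up \<and> vel Up < ubar \<longrightarrow>
           (\<exists>Un1. is_the (\<lambda>U. U \<in> rarefaction_curve \<gamma> UCs \<and> vel U = vel Up) Un1 \<and>
              solved_by \<gamma> Um Up
                [Rarefaction UC Um, Stationary UCs UC, Rarefaction Un1 UCs, Contact Up Un1])) \<and>
        \<comment> \<open>(2.2)\<close>
        (vel UtCs < vel Up \<and> vel Up < vel UCs \<longrightarrow>
           (\<exists>Un2. is_the (\<lambda>U. U \<in> shock_curve \<gamma> UCs \<and> vel U = vel Up) Un2 \<and>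
              solved_by \<gamma> Um Up
                [Rarefaction UC Um, Stationary UCs UC, Shock Un2 UCs, Contact Up Un2])) \<and>
        \<comment> \<open>(2.3)\<close>
        (vel Up > ubar \<longrightarrow>
           (let M = (vel Up, 0, a1) in
              solved_by \<gamma> Um Up
                [Rarefaction UC Um, Stationary UCs UC, Rarefaction Ubar UCs, Vacuum M Ubar,
                 Contact Up M])) \<and>
        \<comment> \<open>(2.4)\<close>
        (let K = joined_curve \<gamma> a1
                   {U \<in> shock_curve \<gamma> Um \<union> rarefaction_curve \<gamma> Um. dens U > dens UC} in
           (0 < vel Up \<and> vel Up < vel Um \<longrightarrow>
              (\<forall>Uk1 Uk1star. (Uk1, Uk1star) \<in> K \<and> vel Uk1star = vel Up \<and>
                  Uk1 \<in> shock_curve \<gamma> Um \<longrightarrow>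
                 is_the (\<lambda>(U0, U0s). (U0, U0s) \<in> K \<and> vel U0s = vel Up) (Uk1, Uk1star) \<and>
                 solved_by \<gamma> Um Up [Shock Uk1 Um, Stationary Uk1star Uk1, Contact Up Uk1star])) \<and>
           (vel Um < vel Up \<and> vel Up < vel UC \<longrightarrow>
              (\<forall>Uk2 Uk2star. (Uk2, Uk2star) \<in> K \<and> vel Uk2star = vel Up \<and>
                  Uk2 \<in> rarefaction_curve \<gamma> Um \<longrightarrow>
                 is_the (\<lambda>(U0, U0s). (U0, U0s) \<in> K \<and> vel U0s = vel Up) (Uk2, Uk2star) \<and>
                 solved_by \<gamma> Um Up
                   [Rarefaction Uk2 Um, Stationary Uk2star Uk2, Contact Up Uk2star])) \<and>
           \<comment> \<open>exact velocity ranges of the two parts of the curve\<close>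
           (\<exists>Umstar.
              is_the (\<lambda>U. width U = a1 \<and> is_stationary \<gamma> U Um) Umstar \<and>
              (0 < vel Up \<and> vel Up < vel Umstar \<longrightarrow>
                 (\<exists>Uk1 Uk1star.
                    is_the (\<lambda>(U0, U0s). (U0, U0s) \<in> K \<and> vel U0s = vel Up) (Uk1, Uk1star) \<and>
                    Uk1 \<in> shock_curve \<gamma> Um \<and>
                    solved_by \<gamma> Um Up
                      [Shock Uk1 Um, Stationary Uk1star Uk1, Contact Up Uk1star])) \<and>
              (vel Umstar < vel Up \<and> vel Up < vel UCstar \<longrightarrow>
                 (\<exists>Uk2 Uk2star.
                    is_the (\<lambda>(U0, U0s). (U0, U0s) \<in> K \<and> vel U0s = vel Up) (Uk2, Uk2star) \<and>
                    Uk2 \<in> rarefaction_curve \<gamma> Um \<and>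
                    solved_by \<gamma> Um Up
                      [Rarefaction Uk2 Um, Stationary Uk2star Uk2, Contact Up Uk2star])))) \<and>
        \<comment> \<open>(2.5)\<close>
        vel UCstar < vel UtCs \<and>
        (\<exists>U3 Ut3 U4 :: real \<Rightarrow> state.
           (\<forall>a\<in>{a0..a1}.
              is_the (\<lambda>U. width U = a \<and> plane_point U \<in> closure (D2 \<gamma>) \<and> is_stationary \<gamma> U UC)
                (U3 a) \<and>
              (if a = a0 then U3 a = UC \<and> Ut3 a = UC
               else is_the (\<lambda>U. zero_speed_shock \<gamma> U (U3 a)) (Ut3 a) \<and>
                    plane_point (Ut3 a) \<in> D1 \<gamma>) \<and>
              is_the (\<lambda>U. width U = a1 \<and> plane_point U \<in> D1 \<gamma> \<and> is_stationary \<gamma> U (Ut3 a))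
                (U4 a)) \<and>
           (vel UCstar < vel Up \<and> vel Up < vel UtCs \<longrightarrow>
              (\<forall>a\<in>{a0..a1}. vel (U4 a) = vel Up \<longrightarrow>
                 solved_by \<gamma> Um Up
                   [Rarefaction UC Um, Stationary (U3 a) UC, Shock (Ut3 a) (U3 a),
                    Stationary (U4 a) (Ut3 a), Contact Up (U4 a)])))))"
  using riemann_solution_supersonic[OF assms] riemann_solution_subsonic[OF assms]
  by (intro conjI impI)

end
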